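(* Let $\theta$ be an inner function on $\mathbb{C}_+$, and let $\mu$ be a positive regular Borel measure on $\mathbb{C}_+$ supported on a sector $\Gamma$ based at $0$. In addition, suppose that $0\notin\sigma(\theta)$, and that either $\infty\notin\sigma(\theta)$, or $|\theta|$ is bounded away from $1$ on the intersection of $\Gamma$ with some right half-plane (that is, there are $N>0$ and $\eta<1$ with $|\theta(z)|\le\eta$ for all $z\in\Gamma$ with $\operatorname{Re}z\ge N$). Then the following are equivalent: (1) $\mu$ is a Carleson measure for $K^{\mathbb{C}_+}_\theta$, that is, the natural mapping $K^{\mathbb{C}_+}_\theta\to L^2(\mathbb{C}_+,\mu)$ is bounded; (2) there is a constant $c>0$ such that $$\int_{\mathbb{C}_+}\frac{w}{|w+s|^2}\,d\mu(s)\le\frac{c}{1-|\theta(w)|}$$ for all $w\in(0,\infty)$.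
   Context: $\mathbb{C}_+=\{s\in\mathbb{C}:\operatorname{Re}s>0\}$. A sector based at $0$ is a set $\Gamma=\{re^{i\varphi}:r>0,\ \alpha\le\varphi\le\beta\}$ with $-\pi/2<\alpha<\beta<\pi/2$. For an inner function $\theta\in H^\infty(\mathbb{C}_+)$, $K^{\mathbb{C}_+}_\theta=H^2(\mathbb{C}_+)\ominus\theta H^2(\mathbb{C}_+)$ is the model space; the natural mapping sends $f$ to $f$ regarded as an element of $L^2(\mathbb{C}_+,\mu)$. The spectrum of $\theta$ is $\sigma(\theta)=\{\zeta\in\overline{\mathbb{C}_+}\cup\{\infty\}:\liminf_{z\to\zeta,\ z\in\mathbb{C}_+}|\theta(z)|=0\}$. The right-hand side in (2) is read as $+\infty$ if $|\theta(w)|=1$. *)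

theory Defs
  imports "HOL-Complex_Analysis.Complex_Analysis"
begin

definition rhp :: "complex set" where
  "rhp = {s. Re s > 0}"

definition sector :: "real \<Rightarrow> real \<Rightarrow> complex set" where
  "sector \<alpha> \<beta> = {of_real r * cis \<phi> | r \<phi>. r > 0 \<and> \<alpha> \<le> \<phi> \<and> \<phi> \<le> \<beta>}"

text \<open>
  Elements of function spaces on \<^const>\<open>rhp\<close> are represented by total functions; none of the
  notions below depends on the values outside \<^const>\<open>rhp\<close>.
\<close>

text \<open>
  For bounded holomorphic functions the non-tangential and the horizontal boundary limits
  agree almost everywhere on the imaginary axis, so horizontal limits are used.
\<close>

definition inner_function :: "(complex \<Rightarrow> complex) \<Rightarrow> bool" where
  "inner_function \<theta> \<longleftrightarrow>
     \<theta> holomorphic_on rhp \<and> bounded (\<theta> ` rhp) \<and>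
     (AE y in lborel. \<exists>l. ((\<lambda>x. \<theta> (Complex x y)) \<longlongrightarrow> l) (at_right 0) \<and> norm l = 1)"

definition h2_norm_sq :: "(complex \<Rightarrow> complex) \<Rightarrow> ennreal" where
  "h2_norm_sq f =
     (SUP x\<in>{0<..}. (\<integral>\<^sup>+ y. ennreal ((norm (f (Complex x y)))\<^sup>2) \<partial>lborel) / ennreal (2 * pi))"

definition hardy2 :: "(complex \<Rightarrow> complex) set" where
  "hardy2 = {f. f holomorphic_on rhp \<and> h2_norm_sq f < \<infinity>}"

text \<open>
  For \<open>f\<close> in the Hardy space, \<open>f(x + i \<cdot>)\<close> converges in the \<open>L\<^sup>2\<close> norm on the real line to the
  boundary function of \<open>f\<close> as \<open>x\<close> decreases to \<open>0\<close>, and the norms increase. Hence this limit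
  exists, is the \<open>L\<^sup>2\<close> pairing of the boundary functions, and induces the norm above.
\<close>

definition h2_inner :: "(complex \<Rightarrow> complex) \<Rightarrow> (complex \<Rightarrow> complex) \<Rightarrow> complex" where
  "h2_inner f g =
     Lim (at_right 0)
       (\<lambda>x. (\<integral>y. f (Complex x y) * cnj (g (Complex x y)) \<partial>lborel) / of_real (2 * pi))"

definition model_space :: "(complex \<Rightarrow> complex) \<Rightarrow> (complex \<Rightarrow> complex) set" where
  "model_space \<theta> = {f \<in> hardy2. \<forall>g\<in>hardy2. h2_inner f (\<lambda>s. \<theta> s * g s) = 0}"

text \<open>
  Points of the Riemann sphere are encoded as options, with \<^const>\<open>None\<close> the point at infinity.
  The punctured neighbourhood filter makes no difference at points of \<^const>\<open>rhp\<close>, where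
  \<open>\<theta>\<close> is continuous.
\<close>

definition approach_rhp :: "complex option \<Rightarrow> complex filter" where
  "approach_rhp p =
     (case p of None \<Rightarrow> inf at_infinity (principal rhp) | Some \<zeta> \<Rightarrow> at \<zeta> within rhp)"

definition inner_spectrum :: "(complex \<Rightarrow> complex) \<Rightarrow> complex option set" where
  "inner_spectrum \<theta> =
     {p \<in> insert None (Some ` closure rhp).
        Liminf (approach_rhp p) (\<lambda>z. ereal (norm (\<theta> z))) = 0}"

text \<open>
  Regularity means outer and inner regularity on all Borel sets; finiteness on compact sets
  is not required.
\<close>

definition regular_borel_measure_rhp :: "complex measure \<Rightarrow> bool" where
  "regular_borel_measure_rhp \<mu> \<longleftrightarrow>
     sets \<mu> = sets (restrict_space borel rhp) \<and>
     (\<forall>A\<in>sets \<mu>.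
        emeasure \<mu> A = (INF U\<in>{U. open U \<and> A \<subseteq> U \<and> U \<subseteq> rhp}. emeasure \<mu> U) \<and>
        emeasure \<mu> A = (SUP K\<in>{K. compact K \<and> K \<subseteq> A}. emeasure \<mu> K))"

definition carleson_measure :: "(complex \<Rightarrow> complex) set \<Rightarrow> complex measure \<Rightarrow> bool" where
  "carleson_measure K \<mu> \<longleftrightarrow>
     (\<exists>C::real. \<forall>f\<in>K.
        (\<integral>\<^sup>+ s. ennreal ((norm (f s))\<^sup>2) \<partial>\<mu>) \<le> ennreal (C\<^sup>2) * h2_norm_sq f)"

end

theory Submission
  imports Defs
begin

text \<open>
  The two conditions are compared through the reproducing kernels of the model space
  \<open>K\<^sub>\<theta>\<close>. Write \<open>k\<^sub>w(z) = 1 / (z + cnj w)\<close> for the Szego kernel. Then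
  \<open>(1 - cnj (\<theta> w) \<theta>) k\<^sub>w\<close> lies in \<open>K\<^sub>\<theta>\<close>, reproduces the value at \<open>w\<close>, and has norm squared at most
  \<open>(1 - \<bar>\<theta> w\<bar>\<^sup>2) / (2 Re w)\<close>.

  Testing a Carleson measure on these kernels for real \<open>w\<close> gives the integral condition
  at once, since \<open>\<bar>1 - cnj (\<theta> w) \<theta> s\<bar> \<ge> 1 - \<bar>\<theta> w\<bar>\<close> (\<open>carleson_measure_imp_kernel_test\<close>).

  For the converse, the kernels bound every \<open>f\<close> in \<open>K\<^sub>\<theta>\<close> pointwise:
  \<open>\<bar>f s\<bar>\<^sup>2 \<le> \<parallel>f\<parallel>\<^sup>2 (1 - \<bar>\<theta> s\<bar>\<^sup>2) / (2 Re s)\<close> (\<open>model_space_pointwise_bound\<close>). The integral condition at a single \<open>w\<close>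
  with \<open>\<bar>\<theta> w\<bar> < 1\<close> says that \<open>1 / \<bar>w + s\<bar>\<^sup>2\<close> is integrable, so it suffices to dominate the
  right-hand side by a multiple of this function on the sector, where \<open>Re s\<close> is comparable to \<open>\<bar>s\<bar>\<close>.
  Near \<open>0\<close> that means \<open>1 - \<bar>\<theta> s\<bar> = O(\<bar>s\<bar>)\<close>, and near infinity \<open>1 - \<bar>\<theta> s\<bar> = O(1 / \<bar>s\<bar>)\<close>. The first
  estimate holds because \<open>\<theta>\<close> is bounded below near \<open>0\<close>: there \<open>\<theta>\<close> and its reflection
  \<open>1 / cnj (\<theta> (- cnj z))\<close> are two bounded functions with the same boundary values on the
  imaginary axis, and the Cauchy formula shows that \<open>\<theta>\<close> is Lipschitz up to the boundary
  (\<open>inner_function_Lipschitz_near_zero\<close>). The second follows from the first by the inversion \<open>z \<mapsto> 1 / z\<close>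
  (\<open>inner_function_inversion\<close>).

  If \<open>\<bar>\<theta>\<bar>\<close> is instead bounded away from \<open>1\<close> far out in the sector, a Harnack inequality
  transports this bound to the real axis, and the integral condition becomes the classical
  Carleson condition for the part of the measure far from \<open>0\<close>. This part then embeds
  the whole Hardy space: the Cauchy integral is dominated on the sector by an integral operator with the
  kernel \<open>1 / (r + \<bar>y\<bar>)\<close>, for which a Schur test gives a Hilbert inequality
  (\<open>hardy2_Carleson_embedding_cone\<close>).

  The Hardy space facts behind the kernels come from one contour shift between
  vertical lines (\<open>line_shift_residue\<close>). It yields the Cauchy formula and also the midpoint
  convexity of the energy on vertical lines, from which the existence of the limit that defines the
  Hardy space pairing follows by polarization.
\<close>

section \<open>Contour integrals over rectangles\<close>

lemma contour_integral_linepath_horizontal: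
  fixes a b c :: real
  assumes "a < b"
  shows "contour_integral (linepath (Complex a c) (Complex b c)) f = integral {a..b} (\<lambda>x. f (Complex x c))"
proof -
  have "contour_integral (linepath (Complex a c) (Complex b c)) f
      = contour_integral (linepath (Complex (-c) a) (Complex (-c) b)) (\<lambda>z. f (- \<i> * z)) * (- \<i>)"
  proof -
    have *: "linepath (Complex a c) (Complex b c) t = - \<i> * linepath (Complex (-c) a) (Complex (-c) b) t" for t
      by (simp add: linepath_def complex_eq_iff)
    have "Complex b c - Complex a c = - \<i> * (Complex (-c) b - Complex (-c) a)"
      by (simp add: complex_eq_iff)
    then have "f (linepath (Complex a c) (Complex b c) t) * (Complex b c - Complex a c)
        = - \<i> * (f (- \<i> * linepath (Complex (-c) a) (Complex (-c) b) t) * (Complex (-c) b - Complex (-c) a))" for t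
      by (simp only: *) (simp only: mult_ac)
    then have "contour_integral (linepath (Complex a c) (Complex b c)) f
      = integral {0..1} (\<lambda>t. - \<i> * (f (- \<i> * linepath (Complex (-c) a) (Complex (-c) b) t) * (Complex (-c) b - Complex (-c) a)))"
      by (simp only: contour_integral_integral vector_derivative_linepath_at)
    then show ?thesis
      by (simp only: integral_mult_right contour_integral_integral vector_derivative_linepath_at mult.commute)
  qed
  also have "\<dots> = integral {a..b} (\<lambda>x. f (- \<i> * Complex (-c) x))"
    using assms by (subst contour_integral_linepath_same_Re[of _ "-c" _ a b]) (auto simp: mult.commute[of _ \<i>])
  also have "(\<lambda>x. f (- \<i> * Complex (-c) x)) = (\<lambda>x. f (Complex x c))"
    by (rule ext, rule arg_cong[of _ _ f]) (simp add: complex_eq_iff)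
  finally show ?thesis .
qed

lemma contour_integral_rectpath:
  fixes a b c d :: real
  assumes "a < b" "c < d"
    and cont: "continuous_on (path_image (rectpath (Complex a c) (Complex b d))) f"
  shows "contour_integral (rectpath (Complex a c) (Complex b d)) f =
     (integral {a..b} (\<lambda>x. f (Complex x c)) - integral {a..b} (\<lambda>x. f (Complex x d)))
     + \<i> * (integral {c..d} (\<lambda>y. f (Complex b y)) - integral {c..d} (\<lambda>y. f (Complex a y)))"
proof -
  have sub: "closed_segment (Complex a c) (Complex b c) \<subseteq> path_image (rectpath (Complex a c) (Complex b d))"
     "closed_segment (Complex b c) (Complex b d) \<subseteq> path_image (rectpath (Complex a c) (Complex b d))"
     "closed_segment (Complex b d) (Complex a d) \<subseteq> path_image (rectpath (Complex a c) (Complex b d))"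
     "closed_segment (Complex a d) (Complex a c) \<subseteq> path_image (rectpath (Complex a c) (Complex b d))"
    by (auto simp: rectpath_def Let_def path_image_join)
  have ci: "f contour_integrable_on linepath (Complex a c) (Complex b c)"
     "f contour_integrable_on linepath (Complex b c) (Complex b d)"
     "f contour_integrable_on linepath (Complex b d) (Complex a d)"
     "f contour_integrable_on linepath (Complex a d) (Complex a c)"
    using sub cont by (auto intro!: contour_integrable_continuous_linepath elim: continuous_on_subset)
  have r1: "contour_integral (linepath (Complex b d) (Complex a d)) f
          = - contour_integral (linepath (Complex a d) (Complex b d)) f"
    using sub cont by (intro contour_integral_reverse_linepath) (auto elim: continuous_on_subset)
  have r2: "contour_integral (linepath (Complex a d) (Complex a c)) f
          = - contour_integral (linepath (Complex a c) (Complex a d)) f"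
    using sub cont by (intro contour_integral_reverse_linepath) (auto elim: continuous_on_subset)
  show ?thesis
    using ci assms
    by (simp add: rectpath_def Let_def contour_integral_join contour_integrable_join
        r1 r2 contour_integral_linepath_horizontal contour_integral_linepath_same_Re algebra_simps)
qed

lemma has_contour_integral_rectpath_pole:
  fixes \<phi> :: "complex \<Rightarrow> complex"
  assumes hol: "\<phi> holomorphic_on S" and S: "convex S" "open S" "cbox a b \<subseteq> S" and s: "s \<in> box a b"
  shows "((\<lambda>z. \<phi> z / (z - s)) has_contour_integral (2 * pi * \<i> * \<phi> s)) (rectpath a b)"
proof -
  have le: "Re a < Re b" "Im a < Im b"
    using s by (auto simp: in_box_complex_iff)
  have "((\<lambda>z. \<phi> z / (z - s)) has_contour_integral
        (2 * pi * \<i> * winding_number (rectpath a b) s * \<phi> s)) (rectpath a b)"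
  proof (rule Cauchy_integral_formula_convex_simple[OF \<open>convex S\<close> hol])
    show "s \<in> interior S"
      using S s box_subset_cbox by (metis interior_open subset_eq)
    show "path_image (rectpath a b) \<subseteq> S - {s}"
      using S s le path_image_rectpath_cbox_minus_box[of a b] by auto
  qed auto
  then show ?thesis
    using winding_number_rectpath[OF s] by simp
qed

text \<open>
  Closing a contour between two vertical lines needs horizontal sides that contribute
  nothing. They exist by Fubini: the horizontal integrals, as a function of the
  height, are integrable, so they cannot stay above a positive constant at all large heights.
\<close>

lemma small_horizontal_segments:
  fixes G :: "complex \<Rightarrow> real"
  assumes ab: "a \<le> b"
    and cont: "continuous_on {z. a \<le> Re z \<and> Re z \<le> b \<and> \<bar>Im z - y0\<bar> \<ge> 1} G"
    and nn: "\<And>z. G z \<ge> 0"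
    and bound: "\<And>x. a \<le> x \<Longrightarrow> x \<le> b \<Longrightarrow>
       (\<integral>\<^sup>+y\<in>{y. \<bar>y - y0\<bar> \<ge> 1}. ennreal (G (Complex x y)) \<partial>lborel) \<le> ennreal B"
    and e: "e > 0"
  shows "\<exists>T\<ge>T1. integral {a..b} (\<lambda>x. G (Complex x T)) < e \<and> integral {a..b} (\<lambda>x. G (Complex x (-T))) < e"
proof (rule ccontr)
  assume neg: "\<not> ?thesis"
  define Y where "Y = {y::real. \<bar>y - y0\<bar> \<ge> 1}"
  have clY: "closed Y"
    unfolding Y_def by (intro closed_Collect_le continuous_intros)
  define h where "h = (\<lambda>(x,y). ennreal (indicator ({a..b} \<times> Y) (x,y) *\<^sub>R G (Complex x y)))"
  have contG: "continuous_on ({a..b} \<times> Y) (\<lambda>p. G (Complex (fst p) (snd p)))"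
    by (rule continuous_on_compose2[OF cont]) (auto intro!: continuous_intros simp: Y_def)
  have "(\<lambda>p. indicator ({a..b} \<times> Y) p *\<^sub>R G (Complex (fst p) (snd p))) \<in> borel_measurable borel"
    by (rule borel_measurable_continuous_on_indicator[OF _ contG])
      (intro borel_closed closed_Times clY closed_real_atLeastAtMost)
  then have meas: "h \<in> borel_measurable (lborel \<Otimes>\<^sub>M lborel)"
    by (simp add: h_def case_prod_beta' lborel_prod)
  note Fubini = lborel_pair.Fubini
  have "(\<integral>\<^sup>+y. \<integral>\<^sup>+x. h (x,y) \<partial>lborel \<partial>lborel) = (\<integral>\<^sup>+x. \<integral>\<^sup>+y. h (x,y) \<partial>lborel \<partial>lborel)"
    using Fubini[OF meas] by simp
  also have "\<dots> \<le> (\<integral>\<^sup>+x. ennreal B * indicator {a..b} x \<partial>lborel)"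
  proof (rule nn_integral_mono)
    fix x :: real
    show "(\<integral>\<^sup>+y. h (x,y) \<partial>lborel) \<le> ennreal B * indicator {a..b} x"
    proof (cases "x \<in> {a..b}")
      case True
      then have "(\<integral>\<^sup>+y. h (x,y) \<partial>lborel) = (\<integral>\<^sup>+y\<in>Y. ennreal (G (Complex x y)) \<partial>lborel)"
        by (intro nn_integral_cong) (auto simp: h_def indicator_def)
      then show ?thesis
        using bound[of x] True by (simp add: Y_def)
    next
      case False
      then have "h (x,y) = 0" for y by (auto simp: h_def indicator_def)
      then show ?thesis using False by simp
    qed
  qed
  also have "\<dots> = ennreal B * ennreal (b - a)"
    using ab by (simp add: nn_integral_cmult_indicator)
  finally have fin: "(\<integral>\<^sup>+y. \<integral>\<^sup>+x. h (x,y) \<partial>lborel \<partial>lborel) < \<infinity>"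
    by (rule le_less_trans) (auto simp: ennreal_mult_less_top)
  define T0 where "T0 = max T1 (\<bar>y0\<bar> + 1)"
  have slice: "(\<integral>\<^sup>+x. h (x,y) \<partial>lborel) = ennreal (integral {a..b} (\<lambda>x. G (Complex x y)))" if "y \<in> Y" for y
  proof -
    have c: "continuous_on {a..b} (\<lambda>x. G (Complex x y))"
      by (rule continuous_on_compose2[OF cont]) (use that in \<open>auto intro!: continuous_intros simp: Y_def\<close>)
    have "(\<integral>\<^sup>+x. h (x,y) \<partial>lborel) = (\<integral>\<^sup>+x. ennreal (indicator {a..b} x *\<^sub>R G (Complex x y)) \<partial>lborel)"
      using that by (intro nn_integral_cong) (auto simp: h_def indicator_def)
    also have "\<dots> = ennreal (LINT x|lborel. indicator {a..b} x *\<^sub>R G (Complex x y))"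
      by (rule nn_integral_eq_integral)
        (use borel_integrable_atLeastAtMost'[OF c] nn in \<open>auto simp: set_integrable_def\<close>)
    also have "\<dots> = ennreal (integral {a..b} (\<lambda>x. G (Complex x y)))"
      using set_borel_integral_eq_integral(2)[OF borel_integrable_atLeastAtMost'[OF c]]
      by (simp add: set_lebesgue_integral_def)
    finally show ?thesis .
  qed
  have big: "ennreal e \<le> (\<integral>\<^sup>+x. h (x,T) \<partial>lborel) + (\<integral>\<^sup>+x. h (x,-T) \<partial>lborel)" if "T \<ge> T0" for T
  proof -
    have "T \<in> Y" "-T \<in> Y" "T \<ge> T1" using that by (auto simp: Y_def T0_def)
    moreover have "e \<le> integral {a..b} (\<lambda>x. G (Complex x T)) \<or> e \<le> integral {a..b} (\<lambda>x. G (Complex x (-T)))"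
      using neg \<open>T \<ge> T1\<close> by force
    ultimately show ?thesis
      by (auto simp: slice intro: add_increasing add_increasing2 ennreal_leI)
  qed
  have m1: "(\<lambda>y. \<integral>\<^sup>+x. h (x,y) \<partial>lborel) \<in> borel_measurable lborel"
    using meas by measurable
  have "of_nat n \<le> emeasure lborel {T0..}" for n
    using emeasure_mono[of "{T0..T0 + real n}" "{T0..}" lborel] by (simp add: ennreal_of_nat_eq_real_of_nat)
  then have "(SUP n. of_nat n :: ennreal) \<le> emeasure lborel {T0..}"
    by (intro SUP_least)
  then have "emeasure lborel {T0..} = \<infinity>"
    by (simp add: ennreal_SUP_of_nat_eq_top top_unique)
  then have "\<infinity> = (\<integral>\<^sup>+T. ennreal e * indicator {T0..} T \<partial>lborel)"
    using e by (simp add: nn_integral_cmult_indicator ennreal_mult_top)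
  also have "\<dots> \<le> (\<integral>\<^sup>+T. (\<integral>\<^sup>+x. h (x,T) \<partial>lborel) + (\<integral>\<^sup>+x. h (x,-T) \<partial>lborel) \<partial>lborel)"
    by (rule nn_integral_mono) (use big in \<open>auto simp: indicator_def\<close>)
  also have "\<dots> = (\<integral>\<^sup>+T. \<integral>\<^sup>+x. h (x,T) \<partial>lborel \<partial>lborel) + (\<integral>\<^sup>+T. \<integral>\<^sup>+x. h (x,-T) \<partial>lborel \<partial>lborel)"
    by (rule nn_integral_add) (use m1 in measurable)
  also have "(\<integral>\<^sup>+T. \<integral>\<^sup>+x. h (x,-T) \<partial>lborel \<partial>lborel) = (\<integral>\<^sup>+T. \<integral>\<^sup>+x. h (x,T) \<partial>lborel \<partial>lborel)"
    using nn_integral_real_affine[of "\<lambda>y. \<integral>\<^sup>+x. h (x,y) \<partial>lborel" "-1" 0] m1 by simp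
  finally show False using fin by (auto simp: top_unique)
qed

lemma tendsto_integral_symmetric_interval:
  fixes g :: "real \<Rightarrow> complex"
  assumes g: "integrable lborel g" and T: "filterlim T at_top sequentially"
  shows "(\<lambda>n. integral {- T n..T n} g) \<longlonglongrightarrow> (\<integral>y. g y \<partial>lborel)"
proof -
  have *: "integral {- T n..T n} g = (\<integral>y. indicator {- T n..T n} y *\<^sub>R g y \<partial>lborel)" for n
  proof -
    have "set_integrable lborel {- T n..T n} g"
      unfolding set_integrable_def by (rule integrable_mult_indicator[OF _ g]) simp
    then show ?thesis
      using set_borel_integral_eq_integral(2) by (metis set_lebesgue_integral_def)
  qed
  show ?thesis
    unfolding *
  proof (rule integral_dominated_convergence[where w="\<lambda>y. norm (g y)"])
    show "AE y in lborel. (\<lambda>n. indicator {- T n..T n} y *\<^sub>R g y) \<longlonglongrightarrow> g y"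
    proof
      fix y
      have "\<forall>\<^sub>F n in sequentially. T n \<ge> \<bar>y\<bar>"
        using T by (simp add: filterlim_at_top)
      then have "\<forall>\<^sub>F n in sequentially. indicator {- T n..T n} y *\<^sub>R g y = g y"
        by eventually_elim (auto simp: indicator_def)
      then show "(\<lambda>n. indicator {- T n..T n} y *\<^sub>R g y) \<longlonglongrightarrow> g y"
        by (rule tendsto_eventually)
    qed
  qed (use g in \<open>auto simp: indicator_def\<close>)
qed

text \<open>
  The bound is asked for only at distance at least one from the pole in the vertical direction,
  which is all that the horizontal sides see. An integral bound suffices in place of pointwise decay,
  so the lemma applies to products of Hardy space functions.
\<close>

lemma line_shift_residue:
  fixes \<phi> :: "complex \<Rightarrow> complex"
  assumes hol: "\<phi> holomorphic_on {z. l < Re z \<and> Re z < r}" and l: "l < a" and r: "b < r"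
    and s: "a < Re s" "Re s < b"
    and int_a: "integrable lborel (\<lambda>y. \<phi> (Complex a y) / (Complex a y - s))"
    and int_b: "integrable lborel (\<lambda>y. \<phi> (Complex b y) / (Complex b y - s))"
    and bound: "\<And>x. a \<le> x \<Longrightarrow> x \<le> b \<Longrightarrow>
       (\<integral>\<^sup>+y\<in>{y. \<bar>y - Im s\<bar> \<ge> 1}. ennreal (norm (\<phi> (Complex x y) / (Complex x y - s))) \<partial>lborel) \<le> ennreal B"
  shows "(\<integral>y. \<phi> (Complex b y) / (Complex b y - s) \<partial>lborel)
       - (\<integral>y. \<phi> (Complex a y) / (Complex a y - s) \<partial>lborel) = 2 * pi * \<phi> s"
proof -
  define F where "F = (\<lambda>z. \<phi> z / (z - s))"
  define S where "S = {z. l < Re z \<and> Re z < r}"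
  have S: "convex S" "open S"
  proof -
    have eq: "S = {z. l < Re z} \<inter> {z. Re z < r}" by (auto simp: S_def)
    show "convex S" unfolding eq by (intro convex_Int convex_halfspace_Re_gt convex_halfspace_Re_lt)
    show "open S" unfolding eq by (intro open_Int open_halfspace_Re_gt open_halfspace_Re_lt)
  qed
  have cphi: "continuous_on S \<phi>"
    using hol by (auto simp: S_def intro: holomorphic_on_imp_continuous_on)
  have "\<exists>T\<ge>max (real n) (\<bar>Im s\<bar> + 1). integral {a..b} (\<lambda>x. norm (F (Complex x T))) < 1 / Suc n
        \<and> integral {a..b} (\<lambda>x. norm (F (Complex x (-T)))) < 1 / Suc n" for n
  proof (rule small_horizontal_segments)
    show "continuous_on {z. a \<le> Re z \<and> Re z \<le> b \<and> \<bar>Im z - Im s\<bar> \<ge> 1} (\<lambda>z. norm (F z))"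
      unfolding F_def using l r s
      by (intro continuous_intros continuous_on_subset[OF cphi]) (auto simp: S_def)
  qed (use bound s in \<open>auto simp: F_def\<close>)
  then obtain T where T: "\<And>n. T n \<ge> max (real n) (\<bar>Im s\<bar> + 1)"
    and h1: "\<And>n. integral {a..b} (\<lambda>x. norm (F (Complex x (T n)))) < 1 / Suc n"
    and h2: "\<And>n. integral {a..b} (\<lambda>x. norm (F (Complex x (- T n)))) < 1 / Suc n"
    by metis
  have Tn: "T n \<ge> real n" "T n \<ge> \<bar>Im s\<bar> + 1" for n using T[of n] by auto
  have Tlim: "filterlim T at_top sequentially"
    by (rule filterlim_at_top_mono[OF filterlim_real_sequentially]) (use Tn in auto)
  define D where "D = (\<lambda>n. integral {- T n..T n} (\<lambda>y. F (Complex b y)) - integral {- T n..T n} (\<lambda>y. F (Complex a y)))"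
  have lim1: "D \<longlonglongrightarrow> (\<integral>y. F (Complex b y) \<partial>lborel) - (\<integral>y. F (Complex a y) \<partial>lborel)"
    unfolding D_def using int_a int_b
    by (intro tendsto_diff tendsto_integral_symmetric_interval Tlim) (auto simp: F_def)
  have est: "norm (D n - 2 * pi * \<phi> s) \<le> 2 / Suc n" for n
  proof -
    let ?a = "Complex a (- T n)" and ?b = "Complex b (T n)"
    have sbox: "s \<in> box ?a ?b" and cb: "cbox ?a ?b \<subseteq> S"
      using s l r Tn(2)[of n] by (auto simp: in_box_complex_iff in_cbox_complex_iff S_def)
    have ne: "path_image (rectpath ?a ?b) \<subseteq> S - {s}"
      using sbox cb path_image_rectpath_cbox_minus_box[of ?a ?b]
      by (auto simp: in_box_complex_iff)
    have cF: "continuous_on (S - {s}) F"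
      unfolding F_def by (intro continuous_intros continuous_on_subset[OF cphi]) auto
    have ab: "a < b" "- T n < T n" using s Tn(2)[of n] by auto
    have "2 * pi * \<i> * \<phi> s = contour_integral (rectpath ?a ?b) F"
      using contour_integral_unique[OF has_contour_integral_rectpath_pole[OF _ S cb sbox]] hol by (simp add: F_def S_def)
    also have "\<dots> = (integral {a..b} (\<lambda>x. F (Complex x (- T n))) - integral {a..b} (\<lambda>x. F (Complex x (T n)))) + \<i> * D n"
      unfolding D_def using ab by (intro contour_integral_rectpath continuous_on_subset[OF cF ne]) auto
    finally have "\<i> * (D n - 2 * pi * \<phi> s) = integral {a..b} (\<lambda>x. F (Complex x (T n))) - integral {a..b} (\<lambda>x. F (Complex x (- T n)))"
      by (simp add: algebra_simps)
    then have "norm (D n - 2 * pi * \<phi> s) = norm (integral {a..b} (\<lambda>x. F (Complex x (T n))) - integral {a..b} (\<lambda>x. F (Complex x (- T n))))"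
      by (metis norm_mult norm_ii mult_1)
    also have "\<dots> \<le> norm (integral {a..b} (\<lambda>x. F (Complex x (T n)))) + norm (integral {a..b} (\<lambda>x. F (Complex x (- T n))))"
      by (rule norm_triangle_ineq4)
    also have "\<dots> \<le> integral {a..b} (\<lambda>x. norm (F (Complex x (T n)))) + integral {a..b} (\<lambda>x. norm (F (Complex x (- T n))))"
    proof (rule add_mono)
      have *: "norm (integral {a..b} (\<lambda>x. F (Complex x t))) \<le> integral {a..b} (\<lambda>x. norm (F (Complex x t)))"
        if t: "\<bar>t - Im s\<bar> \<ge> 1" for t
      proof -
        have "continuous_on {a..b} (\<lambda>x. F (Complex x t))"
          by (rule continuous_on_compose2[OF cF]) (use t l r in \<open>auto intro!: continuous_intros simp: S_def\<close>)
        then show ?thesis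
          by (intro integral_norm_bound_integral integrable_continuous_real continuous_intros) auto
      qed
      show "norm (integral {a..b} (\<lambda>x. F (Complex x (T n)))) \<le> integral {a..b} (\<lambda>x. norm (F (Complex x (T n))))"
        "norm (integral {a..b} (\<lambda>x. F (Complex x (- T n)))) \<le> integral {a..b} (\<lambda>x. norm (F (Complex x (- T n))))"
        by (rule *; use Tn(2)[of n] in linarith)+
    qed
    also have "\<dots> \<le> 2 / Suc n" using h1[of n] h2[of n] by simp
    finally show ?thesis .
  qed
  have "(\<lambda>n. D n - 2 * pi * \<phi> s) \<longlonglongrightarrow> 0"
  proof (rule Lim_null_comparison)
    show "\<forall>\<^sub>F n in sequentially. norm (D n - 2 * pi * \<phi> s) \<le> 2 / Suc n"
      using est by simp
    show "(\<lambda>n. 2 / real (Suc n)) \<longlonglongrightarrow> 0"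
      by real_asymp
  qed
  then have "D \<longlonglongrightarrow> 2 * pi * \<phi> s"
    by (rule LIM_zero_cancel)
  then show ?thesis
    using LIMSEQ_unique lim1 unfolding F_def by blast
qed

section \<open>Square integrability on vertical lines and the Hardy space\<close>

lemma Lorentzian_integral:
  fixes c t :: real
  assumes c: "c > 0"
  shows "integrable lborel (\<lambda>y. 1 / (c\<^sup>2 + (y - t)\<^sup>2))" "(\<integral>y. 1 / (c\<^sup>2 + (y - t)\<^sup>2) \<partial>lborel) = pi / c"
proof -
  let ?F = "\<lambda>y. arctan ((y - t) / c) / c" and ?f = "\<lambda>y. 1 / (c\<^sup>2 + (y - t)\<^sup>2)"
  have pos: "c\<^sup>2 + (y - t)\<^sup>2 > 0" for y using c by (simp add: add_pos_nonneg)
  have D: "(?F has_real_derivative ?f y) (at y)" for y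
  proof -
    have "1 + ((y - t) / c)\<^sup>2 = (c\<^sup>2 + (y - t)\<^sup>2) / c\<^sup>2"
      using c by (simp add: field_simps)
    then have *: "inverse (1 + ((y - t) / c)\<^sup>2) * (1 / c) / c = ?f y"
      using c by (simp add: power2_eq_square)
    have "((\<lambda>y. (y - t) / c) has_real_derivative 1 / c) (at y)"
      using c by (auto intro!: derivative_eq_intros)
    from DERIV_cdivide[OF DERIV_chain'[OF this DERIV_arctan], of c] show ?thesis
      unfolding *[symmetric] by (simp add: mult.commute)
  qed
  have C: "isCont ?f y" for y
    using pos[of y] by (intro continuous_intros) auto
  have A: "((?F \<circ> real_of_ereal) \<longlongrightarrow> - (pi / 2 / c)) (at_right (-\<infinity>))"
    using c by (simp add: ereal_tendsto_simps1) (real_asymp simp: field_simps)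
  have B: "((?F \<circ> real_of_ereal) \<longlongrightarrow> pi / 2 / c) (at_left \<infinity>)"
    using c by (simp add: ereal_tendsto_simps1) (real_asymp simp: field_simps)
  have i: "set_integrable lborel (einterval (-\<infinity>) \<infinity>) ?f"
    by (rule interval_integral_FTC_nonneg(1)[OF _ D C _ A B]) (auto simp: pos less_imp_le)
  have v: "(LBINT y=-\<infinity>..\<infinity>. ?f y) = pi / 2 / c - (- (pi / 2 / c))"
    by (rule interval_integral_FTC_nonneg(2)[OF _ D C _ A B]) (auto simp: pos less_imp_le)
  show "integrable lborel ?f" using i by (simp add: set_integrable_def)
  show "(\<integral>y. ?f y \<partial>lborel) = pi / c"
    using v by (simp add: interval_lebesgue_integral_def set_lebesgue_integral_def)
qed

definition sq_integrable :: "(real \<Rightarrow> complex) \<Rightarrow> bool" where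
  "sq_integrable f \<longleftrightarrow> f \<in> borel_measurable borel \<and> integrable lborel (\<lambda>y. (norm (f y))\<^sup>2)"

lemma mult_le_add_squares: "(a::real) \<ge> 0 \<Longrightarrow> b \<ge> 0 \<Longrightarrow> a * b \<le> a\<^sup>2 + b\<^sup>2"
  using zero_le_power2[of "a - b"] mult_nonneg_nonneg[of a b] unfolding power2_diff by linarith

lemma sq_integrable_mult:
  assumes f: "sq_integrable f" and g: "sq_integrable g"
  shows "integrable lborel (\<lambda>y. f y * g y)"
proof (rule Bochner_Integration.integrable_bound)
  show "integrable lborel (\<lambda>y. (norm (f y))\<^sup>2 + (norm (g y))\<^sup>2)"
    using f g by (auto simp: sq_integrable_def)
  show "AE y in lborel. norm (f y * g y) \<le> norm ((norm (f y))\<^sup>2 + (norm (g y))\<^sup>2)"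
  proof
    fix y
    show "norm (f y * g y) \<le> norm ((norm (f y))\<^sup>2 + (norm (g y))\<^sup>2)"
      using mult_le_add_squares[of "norm (f y)" "norm (g y)"] by (simp add: norm_mult)
  qed
qed (use f g in \<open>auto simp: sq_integrable_def\<close>)

lemma sq_integrable_Cauchy_Schwarz:
  assumes f: "sq_integrable f" and g: "sq_integrable g"
  shows "(norm (\<integral>y. f y * g y \<partial>lborel))\<^sup>2 \<le> (\<integral>y. (norm (f y))\<^sup>2 \<partial>lborel) * (\<integral>y. (norm (g y))\<^sup>2 \<partial>lborel)"
proof -
  have [measurable]: "f \<in> borel_measurable borel" "g \<in> borel_measurable borel"
    using f g by (auto simp: sq_integrable_def)
  have i: "integrable lborel (\<lambda>y. norm (f y) * norm (g y))"
    using integrable_norm[OF sq_integrable_mult[OF f g]] by (simp add: norm_mult)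
  have "norm (\<integral>y. f y * g y \<partial>lborel) \<le> (\<integral>y. norm (f y) * norm (g y) \<partial>lborel)"
    using integral_norm_bound[of lborel "\<lambda>y. f y * g y"] by (simp add: norm_mult)
  then have 1: "(norm (\<integral>y. f y * g y \<partial>lborel))\<^sup>2 \<le> (\<integral>y. norm (f y) * norm (g y) \<partial>lborel)\<^sup>2"
    by (rule power_mono) simp
  have "ennreal ((\<integral>y. norm (f y) * norm (g y) \<partial>lborel)\<^sup>2) = (\<integral>\<^sup>+y. ennreal (norm (f y)) * ennreal (norm (g y)) \<partial>lborel)\<^sup>2"
    using nn_integral_eq_integral[OF i] by (simp add: ennreal_mult' ennreal_power integral_nonneg_AE)
  also have "\<dots> \<le> (\<integral>\<^sup>+y. ennreal (norm (f y)) ^ 2 \<partial>lborel) * (\<integral>\<^sup>+y. ennreal (norm (g y)) ^ 2 \<partial>lborel)"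
    by (rule Cauchy_Schwarz_nn_integral) auto
  also have "\<dots> = ennreal ((\<integral>y. (norm (f y))\<^sup>2 \<partial>lborel) * (\<integral>y. (norm (g y))\<^sup>2 \<partial>lborel))"
    using f g by (simp add: ennreal_power nn_integral_eq_integral sq_integrable_def ennreal_mult')
  finally have "(\<integral>y. norm (f y) * norm (g y) \<partial>lborel)\<^sup>2 \<le> (\<integral>y. (norm (f y))\<^sup>2 \<partial>lborel) * (\<integral>y. (norm (g y))\<^sup>2 \<partial>lborel)"
    by (subst (asm) ennreal_le_iff) (auto intro!: mult_nonneg_nonneg)
  with 1 show ?thesis by (rule order_trans)
qed

definition line_energy :: "(complex \<Rightarrow> complex) \<Rightarrow> real \<Rightarrow> real" where
  "line_energy f x = (\<integral>y. (norm (f (Complex x y)))\<^sup>2 \<partial>lborel)"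

lemma continuous_on_vertical_line:
  assumes "f holomorphic_on rhp" "x > 0"
  shows "continuous_on UNIV (\<lambda>y. f (Complex x y))"
  by (rule continuous_on_compose2[OF holomorphic_on_imp_continuous_on[OF assms(1)]])
    (use assms in \<open>auto intro!: continuous_intros simp: rhp_def\<close>)

lemma hardy2_line:
  assumes f: "f \<in> hardy2" and x: "x > 0"
  shows "sq_integrable (\<lambda>y. f (Complex x y))"
    and "line_energy f x \<le> 2 * pi * enn2real (h2_norm_sq f)"
proof -
  let ?I = "\<integral>\<^sup>+ y. ennreal ((norm (f (Complex x y)))\<^sup>2) \<partial>lborel"
  have hol: "f holomorphic_on rhp" and fin: "h2_norm_sq f < \<infinity>" using f by (auto simp: hardy2_def)
  have [measurable]: "(\<lambda>y. f (Complex x y)) \<in> borel_measurable borel"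
    by (intro borel_measurable_continuous_onI continuous_on_vertical_line hol x)
  have "?I / ennreal (2 * pi) \<le> h2_norm_sq f"
    unfolding h2_norm_sq_def using x by (intro SUP_upper) auto
  then have "?I / ennreal (2 * pi) * ennreal (2 * pi) \<le> h2_norm_sq f * ennreal (2 * pi)"
    by (rule mult_right_mono) simp
  moreover have "?I / ennreal (2 * pi) * ennreal (2 * pi) = ?I"
    by (metis ennreal_divide_times ennreal_mult_divide_eq ennreal_times_divide ennreal_neq_top ennreal_eq_0_iff pi_gt_zero not_le zero_less_mult_iff zero_less_numeral)
  ultimately have "?I \<le> h2_norm_sq f * ennreal (2 * pi)" by simp
  also have "h2_norm_sq f * ennreal (2 * pi) = ennreal (2 * pi * enn2real (h2_norm_sq f))"
    using fin by (simp add: ennreal_mult' mult.commute)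
  finally have le: "?I \<le> ennreal (2 * pi * enn2real (h2_norm_sq f))" .
  then have i: "integrable lborel (\<lambda>y. (norm (f (Complex x y)))\<^sup>2)"
    by (intro integrableI_nonneg) (auto simp: le_less_trans)
  then show "sq_integrable (\<lambda>y. f (Complex x y))"
    by (simp add: sq_integrable_def)
  have "?I = ennreal (line_energy f x)"
    unfolding line_energy_def using i by (intro nn_integral_eq_integral) auto
  then show "line_energy f x \<le> 2 * pi * enn2real (h2_norm_sq f)"
    using le by simp
qed

lemma line_energy_nonneg: "line_energy f x \<ge> 0"
  unfolding line_energy_def by (rule integral_nonneg_AE) simp

lemma hardy2I:
  assumes hol: "f holomorphic_on rhp"
    and int: "\<And>x. x > 0 \<Longrightarrow> integrable lborel (\<lambda>y. (norm (f (Complex x y)))\<^sup>2)"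
    and le: "\<And>x. x > 0 \<Longrightarrow> line_energy f x \<le> 2 * pi * B"
  shows "f \<in> hardy2" "h2_norm_sq f \<le> ennreal B"
proof -
  show *: "h2_norm_sq f \<le> ennreal B"
    unfolding h2_norm_sq_def
  proof (rule SUP_least)
    fix x :: real assume "x \<in> {0<..}"
    then have x: "x > 0" by simp
    have "(\<integral>\<^sup>+ y. ennreal ((norm (f (Complex x y)))\<^sup>2) \<partial>lborel) = ennreal (line_energy f x)"
      unfolding line_energy_def using int[OF x] by (intro nn_integral_eq_integral) auto
    then have "(\<integral>\<^sup>+ y. ennreal ((norm (f (Complex x y)))\<^sup>2) \<partial>lborel) / ennreal (2 * pi) = ennreal (line_energy f x / (2 * pi))"
      by (simp add: divide_ennreal line_energy_nonneg)
    also have "\<dots> \<le> ennreal B"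
      using le[OF x] by (intro ennreal_leI) (simp add: field_simps)
    finally show "(\<integral>\<^sup>+ y. ennreal ((norm (f (Complex x y)))\<^sup>2) \<partial>lborel) / ennreal (2 * pi) \<le> ennreal B" .
  qed
  then show "f \<in> hardy2"
    using hol by (auto simp: hardy2_def intro: le_less_trans)
qed

lemma hardy2_holomorphic: "f \<in> hardy2 \<Longrightarrow> f holomorphic_on rhp"
  by (simp add: hardy2_def)

lemma hardy2_bounded_mult:
  assumes f: "f \<in> hardy2" and hol: "\<phi> holomorphic_on rhp" and M: "\<And>z. z \<in> rhp \<Longrightarrow> norm (\<phi> z) \<le> M"
  shows "(\<lambda>z. \<phi> z * f z) \<in> hardy2"
proof (rule hardy2I(1))
  show "(\<lambda>z. \<phi> z * f z) holomorphic_on rhp"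
    using hol hardy2_holomorphic[OF f] by (intro holomorphic_intros)
  fix x :: real assume x: "x > 0"
  have [measurable]: "(\<lambda>y. f (Complex x y)) \<in> borel_measurable borel" "(\<lambda>y. \<phi> (Complex x y)) \<in> borel_measurable borel"
    using hol hardy2_holomorphic[OF f] x by (auto intro!: borel_measurable_continuous_onI continuous_on_vertical_line)
  have M0: "norm (\<phi> (Complex x y)) \<le> \<bar>M\<bar>" for y
    using M[of "Complex x y"] x by (simp add: rhp_def)
  have le: "(norm (\<phi> (Complex x y) * f (Complex x y)))\<^sup>2 \<le> M\<^sup>2 * (norm (f (Complex x y)))\<^sup>2" for y
    using power_mono[OF mult_right_mono[OF M0[of y], of "norm (f (Complex x y))"], of 2]
    by (simp add: norm_mult power_mult_distrib)
  have i: "integrable lborel (\<lambda>y. M\<^sup>2 * (norm (f (Complex x y)))\<^sup>2)"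
    using hardy2_line(1)[OF f x] by (simp add: sq_integrable_def)
  show j: "integrable lborel (\<lambda>y. (norm (\<phi> (Complex x y) * f (Complex x y)))\<^sup>2)"
    by (rule Bochner_Integration.integrable_bound[OF i]) (use le in auto)
  have "line_energy (\<lambda>z. \<phi> z * f z) x \<le> M\<^sup>2 * line_energy f x"
    unfolding line_energy_def using integral_mono[OF j i le] by simp
  also have "\<dots> \<le> M\<^sup>2 * (2 * pi * enn2real (h2_norm_sq f))"
    by (rule mult_left_mono[OF hardy2_line(2)[OF f x]]) simp
  finally show "line_energy (\<lambda>z. \<phi> z * f z) x \<le> 2 * pi * (M\<^sup>2 * enn2real (h2_norm_sq f))"
    by (simp add: mult_ac)
qed

lemma hardy2_add:
  assumes f: "f \<in> hardy2" and g: "g \<in> hardy2"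
  shows "(\<lambda>z. f z + g z) \<in> hardy2"
proof (rule hardy2I(1))
  show "(\<lambda>z. f z + g z) holomorphic_on rhp"
    using hardy2_holomorphic[OF f] hardy2_holomorphic[OF g] by (intro holomorphic_intros)
  fix x :: real assume x: "x > 0"
  have [measurable]: "(\<lambda>y. f (Complex x y)) \<in> borel_measurable borel" "(\<lambda>y. g (Complex x y)) \<in> borel_measurable borel"
    using hardy2_line(1)[OF f x] hardy2_line(1)[OF g x] by (auto simp: sq_integrable_def)
  have le: "(norm (f (Complex x y) + g (Complex x y)))\<^sup>2 \<le> 2 * (norm (f (Complex x y)))\<^sup>2 + 2 * (norm (g (Complex x y)))\<^sup>2" for y
  proof -
    have "(norm (f (Complex x y) + g (Complex x y)))\<^sup>2 \<le> (norm (f (Complex x y)) + norm (g (Complex x y)))\<^sup>2"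
      by (intro power_mono norm_triangle_ineq) simp
    also have "\<dots> \<le> 2 * (norm (f (Complex x y)))\<^sup>2 + 2 * (norm (g (Complex x y)))\<^sup>2"
      using zero_le_power2[of "norm (f (Complex x y)) - norm (g (Complex x y))"]
      by (simp add: power2_sum power2_diff)
    finally show ?thesis .
  qed
  have fi: "integrable lborel (\<lambda>y. (norm (f (Complex x y)))\<^sup>2)" "integrable lborel (\<lambda>y. (norm (g (Complex x y)))\<^sup>2)"
    using hardy2_line(1)[OF f x] hardy2_line(1)[OF g x] by (auto simp: sq_integrable_def)
  then have i: "integrable lborel (\<lambda>y. 2 * (norm (f (Complex x y)))\<^sup>2 + 2 * (norm (g (Complex x y)))\<^sup>2)"
    by simp
  show j: "integrable lborel (\<lambda>y. (norm (f (Complex x y) + g (Complex x y)))\<^sup>2)"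
    by (rule Bochner_Integration.integrable_bound[OF i]) (use le in auto)
  have "line_energy (\<lambda>z. f z + g z) x \<le> 2 * line_energy f x + 2 * line_energy g x"
    unfolding line_energy_def using integral_mono[OF j i le] fi by simp
  also have "\<dots> \<le> 2 * pi * (2 * enn2real (h2_norm_sq f) + 2 * enn2real (h2_norm_sq g))"
    using hardy2_line(2)[OF f x] hardy2_line(2)[OF g x] by (simp add: algebra_simps)
  finally show "line_energy (\<lambda>z. f z + g z) x \<le> 2 * pi * (2 * enn2real (h2_norm_sq f) + 2 * enn2real (h2_norm_sq g))" .
qed

lemma hardy2_cmult: "f \<in> hardy2 \<Longrightarrow> (\<lambda>z. c * f z) \<in> hardy2"
  by (rule hardy2_bounded_mult[where M="norm c"]) auto

section \<open>The Cauchy formula and the Szego kernel\<close>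

text \<open>
  The reproducing kernel of the Hardy space of the half-plane for the pairing
  normalized by \<open>1 / (2\<pi>)\<close>.
\<close>

definition szego_kernel :: "complex \<Rightarrow> complex \<Rightarrow> complex" where
  "szego_kernel w z = 1 / (z + cnj w)"

definition line_pairing :: "(complex \<Rightarrow> complex) \<Rightarrow> (complex \<Rightarrow> complex) \<Rightarrow> real \<Rightarrow> complex" where
  "line_pairing f g x = (\<integral>y. f (Complex x y) * cnj (g (Complex x y)) \<partial>lborel)"

lemma sq_integrable_cnj: "sq_integrable f \<Longrightarrow> sq_integrable (\<lambda>y. cnj (f y))"
  unfolding sq_integrable_def
  by (auto intro: measurable_compose[OF _ borel_measurable_continuous_onI[of cnj]] continuous_intros)

lemma hardy2_line_pairing:
  assumes "f \<in> hardy2" "g \<in> hardy2" "x > 0"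
  shows "integrable lborel (\<lambda>y. f (Complex x y) * cnj (g (Complex x y)))"
    and "(norm (line_pairing f g x))\<^sup>2 \<le> line_energy f x * line_energy g x"
proof -
  have sq: "sq_integrable (\<lambda>y. f (Complex x y))" "sq_integrable (\<lambda>y. cnj (g (Complex x y)))"
    by (intro sq_integrable_cnj hardy2_line(1) assms)+
  show "integrable lborel (\<lambda>y. f (Complex x y) * cnj (g (Complex x y)))"
    by (rule sq_integrable_mult[OF sq])
  show "(norm (line_pairing f g x))\<^sup>2 \<le> line_energy f x * line_energy g x"
    using sq_integrable_Cauchy_Schwarz[OF sq] by (simp add: line_pairing_def line_energy_def)
qed

lemma norm_inverse_line:
  "(norm (1 / (Complex b y - s)))\<^sup>2 = 1 / ((b - Re s)\<^sup>2 + (y - Im s)\<^sup>2)"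
  by (simp add: norm_divide power_divide cmod_power2)

lemma inverse_line_sq_integrable:
  assumes "b \<noteq> Re s"
  shows "sq_integrable (\<lambda>y. 1 / (Complex b y - s))"
    and "(\<integral>y. (norm (1 / (Complex b y - s)))\<^sup>2 \<partial>lborel) = pi / \<bar>b - Re s\<bar>"
proof -
  have ne: "Complex b y - s \<noteq> 0" for y using assms by (auto simp: complex_eq_iff)
  have "(\<lambda>y. 1 / (Complex b y - s)) \<in> borel_measurable borel"
    by (intro borel_measurable_continuous_onI continuous_intros) (use ne in auto)
  then show "sq_integrable (\<lambda>y. 1 / (Complex b y - s))"
    using Lorentzian_integral(1)[of "\<bar>b - Re s\<bar>" "Im s"] assms
    unfolding sq_integrable_def norm_inverse_line by simp
  show "(\<integral>y. (norm (1 / (Complex b y - s)))\<^sup>2 \<partial>lborel) = pi / \<bar>b - Re s\<bar>"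
    using Lorentzian_integral(2)[of "\<bar>b - Re s\<bar>" "Im s"] assms
    unfolding norm_inverse_line by simp
qed

text \<open>
  On a vertical line conjugation is \<open>z \<mapsto> 2x - z\<close>. Thus the conjugated kernel is
  a Cauchy kernel, with its pole at \<open>2x + w\<close>.
\<close>

lemma szego_kernel_line: "cnj (szego_kernel w (Complex x y)) = - (1 / (Complex x y - (of_real (2 * x) + w)))"
proof -
  have *: "cnj (Complex x y + cnj w) = - (Complex x y - (of_real (2 * x) + w))"
    by (simp add: complex_eq_iff)
  have "cnj (szego_kernel w (Complex x y)) = 1 / cnj (Complex x y + cnj w)"
    by (simp add: szego_kernel_def del: complex_cnj_add)
  then show ?thesis unfolding * by (simp only: divide_minus_right)
qed

lemma szego_kernel_energy:
  assumes "x > 0" "Re w > 0"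
  shows "line_energy (szego_kernel w) x = pi / (x + Re w)"
    and "sq_integrable (\<lambda>y. szego_kernel w (Complex x y))"
proof -
  have *: "szego_kernel w (Complex x y) = 1 / (Complex x y - (- cnj w))" for y
    by (simp add: szego_kernel_def)
  show "line_energy (szego_kernel w) x = pi / (x + Re w)"
    unfolding line_energy_def * using inverse_line_sq_integrable(2)[of x "- cnj w"] assms by simp
  show "sq_integrable (\<lambda>y. szego_kernel w (Complex x y))"
    unfolding * using inverse_line_sq_integrable(1)[of x "- cnj w"] assms by simp
qed

lemma szego_kernel_denominator: "z \<in> rhp \<Longrightarrow> Re w > 0 \<Longrightarrow> z + cnj w \<noteq> 0"
  by (auto simp: rhp_def complex_eq_iff)

lemma szego_kernel_hardy2:
  assumes "Re w > 0"
  shows "szego_kernel w \<in> hardy2"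
proof (rule hardy2I(1))
  show "szego_kernel w holomorphic_on rhp"
    unfolding szego_kernel_def using szego_kernel_denominator assms by (auto intro!: holomorphic_intros)
  fix x :: real assume x: "x > 0"
  show "integrable lborel (\<lambda>y. (norm (szego_kernel w (Complex x y)))\<^sup>2)"
    using szego_kernel_energy(2)[OF x assms] by (simp add: sq_integrable_def)
  show "line_energy (szego_kernel w) x \<le> 2 * pi * (1 / (2 * Re w))"
    using szego_kernel_energy(1)[OF x assms] x assms divide_left_mono[of "Re w" "x + Re w" pi] by simp
qed

lemma nn_integral_norm_mult_le:
  assumes f: "sq_integrable f"
    and g: "g \<in> borel_measurable borel"
    and i: "integrable lborel h" "\<And>y. y \<in> A \<Longrightarrow> (norm (g y))\<^sup>2 \<le> h y" "\<And>y. h y \<ge> 0"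
    and E: "(\<integral>y. (norm (f y))\<^sup>2 \<partial>lborel) + (\<integral>y. h y \<partial>lborel) \<le> B"
  shows "(\<integral>\<^sup>+y\<in>A. ennreal (norm (f y * g y)) \<partial>lborel) \<le> ennreal B"
proof -
  have fi: "integrable lborel (\<lambda>y. (norm (f y))\<^sup>2)" using f by (simp add: sq_integrable_def)
  have "(\<integral>\<^sup>+y\<in>A. ennreal (norm (f y * g y)) \<partial>lborel) \<le> (\<integral>\<^sup>+y. ennreal ((norm (f y))\<^sup>2 + h y) \<partial>lborel)"
  proof (rule nn_integral_mono)
    fix y
    show "ennreal (norm (f y * g y)) * indicator A y \<le> ennreal ((norm (f y))\<^sup>2 + h y)"
    proof (cases "y \<in> A")
      case True
      have "norm (f y * g y) \<le> (norm (f y))\<^sup>2 + h y"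
        using mult_le_add_squares[of "norm (f y)" "norm (g y)"] i(2)[OF True] by (simp add: norm_mult)
      then show ?thesis using True by (simp add: ennreal_leI)
    qed simp
  qed
  also have "\<dots> = ennreal ((\<integral>y. (norm (f y))\<^sup>2 + h y \<partial>lborel))"
    using fi i by (intro nn_integral_eq_integral) auto
  also have "\<dots> \<le> ennreal B"
    using E fi i by (intro ennreal_leI) simp
  finally show ?thesis .
qed

text \<open>
  The contour is shifted from the line through \<open>a\<close> across the pole to a line through \<open>b\<close>,
  where the integral tends to zero as \<open>b\<close> grows, because the Cauchy kernel has
  \<open>L\<^sup>2\<close> norm squared \<open>\<pi> / (b - Re s)\<close>.
\<close>

lemma hardy2_Cauchy_formula:
  fixes f :: "complex \<Rightarrow> complex"
  assumes f: "f \<in> hardy2" and a: "a > 0" and s: "a < Re s"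
  shows "(\<integral>y. f (Complex a y) * (1 / (Complex a y - s)) \<partial>lborel) = - (2 * pi * f s)"
proof -
  define H where "H = enn2real (h2_norm_sq f)"
  define P where "P = (\<lambda>b. \<integral>y. f (Complex b y) * (1 / (Complex b y - s)) \<partial>lborel)"
  have shift: "P b - P a = 2 * pi * f s" if b: "b > Re s" for b
  proof -
    have "(\<integral>y. f (Complex b y) / (Complex b y - s) \<partial>lborel) - (\<integral>y. f (Complex a y) / (Complex a y - s) \<partial>lborel) = 2 * pi * f s"
    proof (rule line_shift_residue[where l=0 and r="b+1" and B="2 * pi * H + 2 * pi"])
      show "f holomorphic_on {z. 0 < Re z \<and> Re z < b + 1}"
        by (rule holomorphic_on_subset[OF hardy2_holomorphic[OF f]]) (auto simp: rhp_def)
      show "integrable lborel (\<lambda>y. f (Complex a y) / (Complex a y - s))"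
        using sq_integrable_mult[OF hardy2_line(1)[OF f a] inverse_line_sq_integrable(1)[of a s]] s by simp
      show "integrable lborel (\<lambda>y. f (Complex b y) / (Complex b y - s))"
        using sq_integrable_mult[OF hardy2_line(1)[OF f] inverse_line_sq_integrable(1)[of b s]] s b a by simp
      fix x assume x: "a \<le> x" "x \<le> b"
      have L: "integrable lborel (\<lambda>y. 1 / (1\<^sup>2 + (y - Im s)\<^sup>2))" "(\<integral>y. 1 / (1\<^sup>2 + (y - Im s)\<^sup>2) \<partial>lborel) = pi / 1"
        by (rule Lorentzian_integral; simp)+
      have "(\<integral>\<^sup>+y\<in>{y. \<bar>y - Im s\<bar> \<ge> 1}. ennreal (norm (f (Complex x y) * (1 / (Complex x y - s)))) \<partial>lborel) \<le> ennreal (2 * pi * H + 2 * pi)"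
      proof (rule nn_integral_norm_mult_le[where h="\<lambda>y. 2 * (1 / (1\<^sup>2 + (y - Im s)\<^sup>2))"])
        show "sq_integrable (\<lambda>y. f (Complex x y))" using hardy2_line(1)[OF f] x a by simp
        have [measurable]: "(\<lambda>y. Complex x y) \<in> borel_measurable borel"
          by (intro borel_measurable_continuous_onI continuous_intros)
        show "(\<lambda>y. 1 / (Complex x y - s)) \<in> borel_measurable borel" by measurable
        show "integrable lborel (\<lambda>y. 2 * (1 / (1\<^sup>2 + (y - Im s)\<^sup>2)))"
          using L(1) by (rule integrable_mult_right)
        have "(\<integral>y. 2 * (1 / (1\<^sup>2 + (y - Im s)\<^sup>2)) \<partial>lborel) = 2 * pi"
          unfolding integral_mult_right_zero L(2) by simp
        then show "(\<integral>y. (norm (f (Complex x y)))\<^sup>2 \<partial>lborel) + (\<integral>y. 2 * (1 / (1\<^sup>2 + (y - Im s)\<^sup>2)) \<partial>lborel) \<le> 2 * pi * H + 2 * pi"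
          using hardy2_line(2)[OF f, of x] x a by (simp add: line_energy_def H_def)
        fix y assume "y \<in> {y. 1 \<le> \<bar>y - Im s\<bar>}"
        then have y: "1 \<le> (y - Im s)\<^sup>2"
          by (metis mem_Collect_eq one_le_power power2_abs)
        have "(1\<^sup>2 + v) / 2 \<le> u + v" if "1 \<le> v" "0 \<le> u" for u v :: real
          using that by simp
        then have "(1\<^sup>2 + (y - Im s)\<^sup>2) / 2 \<le> (x - Re s)\<^sup>2 + (y - Im s)\<^sup>2"
          using y zero_le_power2 by blast
        moreover have "(1\<^sup>2 + (y - Im s)\<^sup>2) / 2 > 0"
          by (simp add: add_pos_nonneg)
        ultimately have "1 / ((x - Re s)\<^sup>2 + (y - Im s)\<^sup>2) \<le> 1 / ((1\<^sup>2 + (y - Im s)\<^sup>2) / 2)"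
          by (intro frac_le) auto
        then show "(norm (1 / (Complex x y - s)))\<^sup>2 \<le> 2 * (1 / (1\<^sup>2 + (y - Im s)\<^sup>2))"
          unfolding norm_inverse_line by simp
      qed auto
      then show "(\<integral>\<^sup>+y\<in>{y. \<bar>y - Im s\<bar> \<ge> 1}. ennreal (norm (f (Complex x y) / (Complex x y - s))) \<partial>lborel) \<le> ennreal (2 * pi * H + 2 * pi)"
        by simp
    qed (use a b s in auto)
    then show ?thesis by (simp add: P_def)
  qed
  have est: "norm (P b) \<le> sqrt (2 * pi * H * (pi / (b - Re s)))" if b: "b > Re s" for b
  proof -
    have b0: "b > 0" using b s a by simp
    have "(norm (P b))\<^sup>2 \<le> line_energy f b * (pi / \<bar>b - Re s\<bar>)"
      unfolding P_def line_energy_def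
      using sq_integrable_Cauchy_Schwarz[OF hardy2_line(1)[OF f b0] inverse_line_sq_integrable(1)[of b s]]
        inverse_line_sq_integrable(2)[of b s] b by simp
    also have "\<dots> \<le> 2 * pi * H * (pi / \<bar>b - Re s\<bar>)"
      using hardy2_line(2)[OF f b0] by (intro mult_right_mono) (auto simp: H_def)
    finally show ?thesis using b by (intro real_le_rsqrt) simp
  qed
  have "((\<lambda>b. sqrt (2 * pi * H * (pi / (b - Re s)))) \<longlongrightarrow> sqrt (2 * pi * H * 0)) at_top"
    by (intro tendsto_intros tendsto_divide_0[OF tendsto_const] filterlim_at_top_imp_at_infinity) real_asymp
  then have "(P \<longlongrightarrow> 0) at_top"
    by (intro Lim_null_comparison[OF eventually_mono[OF eventually_gt_at_top[of "Re s"] est]]) auto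
  then have "((\<lambda>b. P b - P a) \<longlongrightarrow> 0 - P a) at_top"
    by (intro tendsto_intros)
  moreover have "((\<lambda>b. P b - P a) \<longlongrightarrow> 2 * pi * f s) at_top"
    by (rule tendsto_eventually, rule eventually_mono[OF eventually_gt_at_top[of "Re s"] shift])
  ultimately have "0 - P a = 2 * pi * f s"
    by (rule tendsto_unique[OF trivial_limit_at_top_linorder])
  then have "P a = - (2 * pi * f s)"
    by (simp add: neg_eq_iff_add_eq_0 eq_neg_iff_add_eq_0 add.commute)
  then show ?thesis by (simp only: P_def)
qed

lemma hardy2_pairing_szego_kernel:
  fixes f :: "complex \<Rightarrow> complex"
  assumes f: "f \<in> hardy2" and x: "x > 0" and w: "Re w > 0"
  shows "line_pairing f (szego_kernel w) x = of_real (2 * pi) * f (of_real (2 * x) + w)"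
proof -
  have "line_pairing f (szego_kernel w) x = - (\<integral>y. f (Complex x y) * (1 / (Complex x y - (of_real (2 * x) + w))) \<partial>lborel)"
    unfolding line_pairing_def szego_kernel_line by simp
  also have "\<dots> = of_real (2 * pi) * f (of_real (2 * x) + w)"
    using hardy2_Cauchy_formula[OF f x, of "of_real (2 * x) + w"] x w by simp
  finally show ?thesis .
qed

section \<open>Boundary behaviour of the Hardy space pairing\<close>

text \<open>
  A single increase, propagated by convexity, forces at least linear growth.
\<close>

lemma midpoint_convex_bounded_antimono:
  fixes N :: "real \<Rightarrow> real"
  assumes mid: "\<And>a b. 0 < a \<Longrightarrow> a < b \<Longrightarrow> N ((a + b) / 2) \<le> (N a + N b) / 2"
    and B: "\<And>x. x > 0 \<Longrightarrow> N x \<le> B"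
    and ab: "0 < a" "a \<le> b"
  shows "N b \<le> N a"
proof (rule ccontr)
  assume "\<not> N b \<le> N a"
  then have d: "N b - N a > 0" and lt: "a < b" using ab by (auto simp: order_le_less)
  define p where "p = (\<lambda>k. a + real k * (b - a))"
  have pos: "p k > 0" for k using ab lt by (simp add: p_def add_pos_nonneg)
  have step: "N (p (Suc k)) - N (p k) \<ge> N b - N a" for k
  proof (induction k)
    case 0
    show ?case by (simp add: p_def)
  next
    case (Suc k)
    have "(p k + p (Suc (Suc k))) / 2 = p (Suc k)" by (simp add: p_def field_simps)
    moreover have "p k < p (Suc (Suc k))" using lt by (simp add: p_def)
    ultimately have "N (p (Suc k)) \<le> (N (p k) + N (p (Suc (Suc k)))) / 2"
      using mid[OF pos[of k]] by metis
    with Suc show ?case by simp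
  qed
  have "N (p k) \<ge> N a + real k * (N b - N a)" for k
  proof (induction k)
    case 0
    show ?case by (simp add: p_def)
  next
    case (Suc k)
    then show ?case using step[of k] by (simp add: algebra_simps)
  qed
  moreover obtain k where "real k * (N b - N a) > B - N a"
    using reals_Archimedean3[OF d] by blast
  ultimately show False
    using B[OF pos[of k]] by (smt (verit))
qed

lemma mult_indicator_cong: "(x \<in> A \<Longrightarrow> u = v) \<Longrightarrow> u * indicator A x = v * (indicator A x :: ennreal)"
  by (simp add: indicator_def)

text \<open>
  The function \<open>z \<mapsto> f z * cnj (f (a + b - cnj z))\<close> is holomorphic in the strip
  \<open>0 < Re z < a + b\<close>. Its integral over the line through \<open>a\<close> is the left-hand side, and
  its integral over the middle line is the energy.
\<close>

lemma hardy2_pairing_translates: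
  assumes f: "f \<in> hardy2" and a: "0 < a" "a < b"
  shows "(\<integral>y. f (Complex a y) * cnj (f (Complex b y)) \<partial>lborel) = of_real (line_energy f ((a + b) / 2))"
proof -
  define m where "m = (a + b) / 2"
  define H where "H = enn2real (h2_norm_sq f)"
  have am: "a < m" "m < b" and m0: "m > 0" using a by (auto simp: m_def)
  \<comment> \<open>An artificial pole with residue zero: the contour shift is applied to the product of the function with z - s.\<close>
  define s where "s = complex_of_real ((a + m) / 2)"
  have s: "a < Re s" "Re s < m" using am by (auto simp: s_def)
  define F where "F = (\<lambda>z. f z * (cnj \<circ> f \<circ> cnj) (of_real (a + b) - z))"
  have F_line: "F (Complex x y) = f (Complex x y) * cnj (f (Complex (a + b - x) y))" for x y
  proof -
    have "cnj (of_real (a + b) - Complex x y) = Complex (a + b - x) y"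
      by (simp add: complex_eq_iff)
    then show ?thesis by (simp add: F_def)
  qed
  have Fphi: "F z * (z - s) / (z - s) = F z" if "Re z \<noteq> Re s \<or> Im z \<noteq> 0" for z
  proof -
    have "Im s = 0" by (simp add: s_def)
    then have "z - s \<noteq> 0" using that by auto
    then show ?thesis by simp
  qed
  have holc: "(cnj \<circ> f \<circ> cnj) holomorphic_on rhp"
    by (rule holomorphic_on_compose_cnj_cnj, rule holomorphic_on_subset[OF hardy2_holomorphic[OF f]])
      (auto simp: rhp_def open_halfspace_Re_gt)
  have "((cnj \<circ> f \<circ> cnj) \<circ> (\<lambda>z. of_real (a + b) - z)) holomorphic_on {z. 0 < Re z \<and> Re z < a + b}"
    by (rule holomorphic_on_compose_gen[OF _ holc])
      (intro holomorphic_intros, auto simp: rhp_def)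
  then have holg: "(\<lambda>z. (cnj \<circ> f \<circ> cnj) (of_real (a + b) - z)) holomorphic_on {z. 0 < Re z \<and> Re z < a + b}"
    by (simp add: comp_def)
  have holF: "F holomorphic_on {z. 0 < Re z \<and> Re z < a + b}"
    unfolding F_def using holg
    by (intro holomorphic_intros holomorphic_on_subset[OF hardy2_holomorphic[OF f]]) (auto simp: rhp_def)
  have sq: "sq_integrable (\<lambda>y. f (Complex x y))" if "x > 0" for x
    by (rule hardy2_line(1)[OF f that])
  have intF: "integrable lborel (\<lambda>y. F (Complex x y))" if "0 < x" "x < a + b" for x
    unfolding F_line using that by (intro sq_integrable_mult sq sq_integrable_cnj) auto
  have "(\<integral>y. (F (Complex m y) * (Complex m y - s)) / (Complex m y - s) \<partial>lborel)
      - (\<integral>y. (F (Complex a y) * (Complex a y - s)) / (Complex a y - s) \<partial>lborel) = 2 * pi * (F s * (s - s))"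
  proof (rule line_shift_residue[where l=0 and r="a+b" and B="4 * pi * H"])
    show "(\<lambda>z. F z * (z - s)) holomorphic_on {z. 0 < Re z \<and> Re z < a + b}"
      using holF by (intro holomorphic_intros)
    show "integrable lborel (\<lambda>y. F (Complex a y) * (Complex a y - s) / (Complex a y - s))"
      "integrable lborel (\<lambda>y. F (Complex m y) * (Complex m y - s) / (Complex m y - s))"
      using intF[of a] intF[of m] a am s by (simp_all add: Fphi)
    fix x assume x: "a \<le> x" "x \<le> m"
    then have x0: "x > 0" "a + b - x > 0" using a am by auto
    have "(\<integral>\<^sup>+y\<in>{y. \<bar>y - Im s\<bar> \<ge> 1}. ennreal (norm (f (Complex x y) * cnj (f (Complex (a + b - x) y)))) \<partial>lborel) \<le> ennreal (4 * pi * H)"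
    proof (rule nn_integral_norm_mult_le[OF sq[OF x0(1)], where h="\<lambda>y. (norm (f (Complex (a + b - x) y)))\<^sup>2"])
      show "(\<lambda>y. cnj (f (Complex (a + b - x) y))) \<in> borel_measurable borel"
        using sq_integrable_cnj[OF sq[OF x0(2)]] by (simp add: sq_integrable_def)
      show "integrable lborel (\<lambda>y. (norm (f (Complex (a + b - x) y)))\<^sup>2)"
        using sq[OF x0(2)] by (simp add: sq_integrable_def)
      show "(\<integral>y. (norm (f (Complex x y)))\<^sup>2 \<partial>lborel) + (\<integral>y. (norm (f (Complex (a + b - x) y)))\<^sup>2 \<partial>lborel) \<le> 4 * pi * H"
        using hardy2_line(2)[OF f x0(1)] hardy2_line(2)[OF f x0(2)] by (simp add: line_energy_def H_def)
    qed auto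
    moreover have "F (Complex x y) * (Complex x y - s) / (Complex x y - s) = f (Complex x y) * cnj (f (Complex (a + b - x) y))"
      if "\<bar>y - Im s\<bar> \<ge> 1" for y
    proof -
      have "Im (Complex x y) \<noteq> 0" using that by (auto simp: s_def)
      then have "F (Complex x y) * (Complex x y - s) / (Complex x y - s) = F (Complex x y)"
        by (intro Fphi) simp
      then show ?thesis by (simp only: F_line)
    qed
    then have "(\<integral>\<^sup>+y\<in>{y. \<bar>y - Im s\<bar> \<ge> 1}. ennreal (norm (F (Complex x y) * (Complex x y - s) / (Complex x y - s))) \<partial>lborel)
      = (\<integral>\<^sup>+y\<in>{y. \<bar>y - Im s\<bar> \<ge> 1}. ennreal (norm (f (Complex x y) * cnj (f (Complex (a + b - x) y)))) \<partial>lborel)"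
      by (intro nn_integral_cong mult_indicator_cong) (simp only: mem_Collect_eq)
    ultimately show "(\<integral>\<^sup>+y\<in>{y. \<bar>y - Im s\<bar> \<ge> 1}. ennreal (norm (F (Complex x y) * (Complex x y - s) / (Complex x y - s))) \<partial>lborel) \<le> ennreal (4 * pi * H)"
      by simp
  qed (use a am s in auto)
  then have "(\<integral>y. F (Complex m y) \<partial>lborel) = (\<integral>y. F (Complex a y) \<partial>lborel)"
    using s by (simp add: Fphi)
  moreover have "F (Complex a y) = f (Complex a y) * cnj (f (Complex b y))" for y
    by (simp add: F_line)
  moreover have "F (Complex m y) = of_real ((norm (f (Complex m y)))\<^sup>2)" for y
  proof -
    have "a + b - m = m" by (simp add: m_def field_simps)
    then show ?thesis by (simp add: F_line complex_norm_square del: of_real_power)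
  qed
  ultimately show ?thesis
    by (simp add: line_energy_def m_def[symmetric] del: of_real_power)
qed

text \<open>
  The pairing of two translates and the Cauchy-Schwarz inequality give midpoint convexity of
  the energy, and the energy is bounded.
\<close>

lemma line_energy_antimono:
  assumes f: "f \<in> hardy2" and ab: "0 < a" "a \<le> b"
  shows "line_energy f b \<le> line_energy f a"
proof (rule midpoint_convex_bounded_antimono[OF _ _ ab])
  fix x :: real assume "x > 0"
  then show "line_energy f x \<le> 2 * pi * enn2real (h2_norm_sq f)"
    by (rule hardy2_line(2)[OF f])
next
  fix a b :: real assume ab: "0 < a" "a < b"
  let ?E = "line_energy f"
  have "(?E ((a + b) / 2))\<^sup>2 = (norm (\<integral>y. f (Complex a y) * cnj (f (Complex b y)) \<partial>lborel))\<^sup>2"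
    unfolding hardy2_pairing_translates[OF f ab] by simp
  also have "\<dots> \<le> ?E a * ?E b"
    using sq_integrable_Cauchy_Schwarz[OF hardy2_line(1)[OF f] sq_integrable_cnj[OF hardy2_line(1)[OF f]], of a b] ab
    by (simp add: line_energy_def)
  also have "\<dots> \<le> ((?E a + ?E b) / 2)\<^sup>2"
    using zero_le_power2[of "?E a - ?E b"] by (simp add: power2_sum power2_diff power_divide)
  finally show "?E ((a + b) / 2) \<le> (?E a + ?E b) / 2"
    by (rule power2_le_imp_le) (simp add: line_energy_nonneg)
qed

lemma tendsto_at_right_of_antimono_bounded:
  fixes N :: "real \<Rightarrow> real"
  assumes mono: "\<And>a b. 0 < a \<Longrightarrow> a \<le> b \<Longrightarrow> N b \<le> N a" and B: "\<And>x. x > 0 \<Longrightarrow> N x \<le> B"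
  shows "\<exists>L. (N \<longlongrightarrow> L) (at_right 0)"
proof
  have bdd: "bdd_above (N ` {0<..})" using B by (auto simp: bdd_above_def)
  show "(N \<longlongrightarrow> (SUP x\<in>{0<..}. N x)) (at_right 0)"
  proof (rule order_tendstoI)
    fix l assume "l < (SUP x\<in>{0<..}. N x)"
    then obtain x where x: "x > 0" "l < N x"
      using less_cSUP_iff[of "{0::real<..}" N l] bdd by auto
    then show "\<forall>\<^sub>F x in at_right 0. l < N x"
      unfolding eventually_at_right_field using mono by (intro exI[of _ x]) (auto intro: less_le_trans)
  next
    fix u assume u: "(SUP x\<in>{0<..}. N x) < u"
    have "N x < u" if "x > 0" for x
      using cSUP_upper[OF _ bdd, of x] that u by auto
    then show "\<forall>\<^sub>F x in at_right 0. N x < u"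
      unfolding eventually_at_right_field by (intro exI[of _ 1]) auto
  qed
qed

lemma line_energy_tendsto:
  assumes f: "f \<in> hardy2"
  shows "\<exists>L. (line_energy f \<longlongrightarrow> L) (at_right 0)"
  using line_energy_antimono[OF f] hardy2_line(2)[OF f] by (rule tendsto_at_right_of_antimono_bounded)

lemma line_pairing_polarization:
  assumes f: "f \<in> hardy2" and g: "g \<in> hardy2" and x: "x > 0"
  shows "line_pairing f g x =
    (of_real (line_energy (\<lambda>z. f z + g z) x) - of_real (line_energy (\<lambda>z. f z + (-1) * g z) x)
     + \<i> * of_real (line_energy (\<lambda>z. f z + \<i> * g z) x) - \<i> * of_real (line_energy (\<lambda>z. f z + (-\<i>) * g z) x)) / 4"
proof -
  have i: "integrable lborel (\<lambda>y. complex_of_real ((norm (f (Complex x y) + c * g (Complex x y)))\<^sup>2))" for c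
  proof -
    have "(\<lambda>z. f z + c * g z) \<in> hardy2"
      by (intro hardy2_add f hardy2_cmult g)
    from hardy2_line(1)[OF this x] show ?thesis
      unfolding sq_integrable_def by (intro integrable_of_real) simp
  qed
  have e: "of_real (line_energy (\<lambda>z. f z + c * g z) x) = (\<integral>y. complex_of_real ((norm (f (Complex x y) + c * g (Complex x y)))\<^sup>2) \<partial>lborel)" for c
    by (simp add: line_energy_def del: of_real_power)
  have pw: "u * cnj v = (of_real ((norm (u + 1 * v))\<^sup>2) - of_real ((norm (u + (-1) * v))\<^sup>2)
     + \<i> * of_real ((norm (u + \<i> * v))\<^sup>2) - \<i> * of_real ((norm (u + (-\<i>) * v))\<^sup>2)) / 4" for u v :: complex
    unfolding complex_norm_square by (simp add: algebra_simps)
  have "line_pairing f g x = (\<integral>y. (of_real ((norm (f (Complex x y) + 1 * g (Complex x y)))\<^sup>2) - of_real ((norm (f (Complex x y) + (-1) * g (Complex x y)))\<^sup>2)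
     + \<i> * of_real ((norm (f (Complex x y) + \<i> * g (Complex x y)))\<^sup>2) - \<i> * of_real ((norm (f (Complex x y) + (-\<i>) * g (Complex x y)))\<^sup>2)) / 4 \<partial>lborel)"
    unfolding line_pairing_def pw ..
  also have "\<dots> = (of_real (line_energy (\<lambda>z. f z + 1 * g z) x) - of_real (line_energy (\<lambda>z. f z + (-1) * g z) x)
     + \<i> * of_real (line_energy (\<lambda>z. f z + \<i> * g z) x) - \<i> * of_real (line_energy (\<lambda>z. f z + (-\<i>) * g z) x)) / 4"
    unfolding e integral_divide_zero
    by (subst Bochner_Integration.integral_diff Bochner_Integration.integral_add;
        (intro Bochner_Integration.integrable_diff Bochner_Integration.integrable_add integrable_mult_right i)?)+
      (simp only: integral_mult_right_zero)
  finally show ?thesis by simp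
qed

text \<open>
  The limit operator in the definition of the pairing has an unspecified value where no limit exists,
  so membership in the model space has content only through this convergence. By polarization the pairing is a combination of four
  energies, each of which is monotone and bounded.
\<close>

lemma h2_inner_tendsto:
  assumes f: "f \<in> hardy2" and g: "g \<in> hardy2"
  shows "((\<lambda>x. line_pairing f g x / of_real (2 * pi)) \<longlongrightarrow> h2_inner f g) (at_right 0)"
proof -
  have "\<exists>L. (line_energy (\<lambda>z. f z + c * g z) \<longlongrightarrow> L) (at_right 0)" for c
    by (intro line_energy_tendsto hardy2_add f hardy2_cmult g)
  then obtain L where L: "((\<lambda>x. line_energy (\<lambda>z. f z + c * g z) x) \<longlongrightarrow> L c) (at_right 0)" for c
    by metis
  define l where "l = (of_real (L 1) - of_real (L (-1)) + \<i> * of_real (L \<i>) - \<i> * of_real (L (-\<i>))) / 4"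
  have "((\<lambda>x. (of_real (line_energy (\<lambda>z. f z + 1 * g z) x) - of_real (line_energy (\<lambda>z. f z + (-1) * g z) x)
     + \<i> * of_real (line_energy (\<lambda>z. f z + \<i> * g z) x) - \<i> * of_real (line_energy (\<lambda>z. f z + (-\<i>) * g z) x)) / 4) \<longlongrightarrow> l) (at_right 0)"
    unfolding l_def by (intro tendsto_intros L) auto
  then have "(line_pairing f g \<longlongrightarrow> l) (at_right 0)"
    by (rule Lim_transform_eventually)
      (auto simp: eventually_at_right_field line_pairing_polarization[OF f g] intro!: exI[of _ 1])
  then have lim: "((\<lambda>x. line_pairing f g x / of_real (2 * pi)) \<longlongrightarrow> l / of_real (2 * pi)) (at_right 0)"
    by (intro tendsto_intros) auto
  moreover have "h2_inner f g = l / of_real (2 * pi)"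
    unfolding h2_inner_def using lim
    by (intro tendsto_Lim) (auto simp: line_pairing_def)
  ultimately show ?thesis by simp
qed

section \<open>The Poisson formula and the reproducing kernels of the model space\<close>

text \<open>
  The reproducing kernel of the model space at \<open>w\<close>.
\<close>

definition model_kernel :: "(complex \<Rightarrow> complex) \<Rightarrow> complex \<Rightarrow> complex \<Rightarrow> complex" where
  "model_kernel \<theta> w z = (1 - cnj (\<theta> w) * \<theta> z) * szego_kernel w z"

lemma inner_function_holomorphic: "inner_function \<theta> \<Longrightarrow> \<theta> holomorphic_on rhp"
  by (simp add: inner_function_def)

lemma Re_mult_of_real: "Re (z * of_real r) = Re z * r"
  by simp

lemma szego_kernel_norm_sq: "(norm (szego_kernel w (Complex x y)))\<^sup>2 = 1 / ((x + Re w)\<^sup>2 + (y - Im w)\<^sup>2)"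
  using norm_inverse_line[of x y "- cnj w"] by (simp add: szego_kernel_def)

text \<open>
  The reproducing property applied to \<open>\<phi>\<close> times the Szego kernel at \<open>w\<close>: the squared modulus of the
  kernel is, up to normalization, the Poisson kernel.
\<close>

lemma Poisson_formula_bounded:
  fixes \<phi> :: "complex \<Rightarrow> complex"
  assumes hol: "\<phi> holomorphic_on rhp" and M: "\<forall>z\<in>rhp. norm (\<phi> z) \<le> M"
    and x: "x > 0" and w: "Re w > 0"
  shows "integrable lborel (\<lambda>y. \<phi> (Complex x y) * of_real ((norm (szego_kernel w (Complex x y)))\<^sup>2))"
    and "(\<integral>y. \<phi> (Complex x y) * of_real ((norm (szego_kernel w (Complex x y)))\<^sup>2) \<partial>lborel)
         = of_real (pi / (x + Re w)) * \<phi> (of_real (2 * x) + w)"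
proof -
  have f: "(\<lambda>z. \<phi> z * szego_kernel w z) \<in> hardy2"
    using M by (intro hardy2_bounded_mult[OF szego_kernel_hardy2[OF w] hol]) auto
  have eq: "\<phi> (Complex x y) * of_real ((norm (szego_kernel w (Complex x y)))\<^sup>2)
      = \<phi> (Complex x y) * szego_kernel w (Complex x y) * cnj (szego_kernel w (Complex x y))" for y
    by (simp add: complex_norm_square del: of_real_power)
  show "integrable lborel (\<lambda>y. \<phi> (Complex x y) * of_real ((norm (szego_kernel w (Complex x y)))\<^sup>2))"
    unfolding eq by (rule hardy2_line_pairing(1)[OF f szego_kernel_hardy2[OF w] x])
  have "of_real (2 * x) + w + cnj w = of_real (2 * (x + Re w))"
    by (simp add: complex_eq_iff)
  then have "szego_kernel w (of_real (2 * x) + w) = of_real (1 / (2 * (x + Re w)))"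
    by (simp only: szego_kernel_def of_real_divide of_real_1)
  moreover have "of_real (2 * pi) * of_real (1 / (2 * (x + Re w))) = complex_of_real (pi / (x + Re w))"
  proof -
    have "2 * pi * (1 / (2 * X)) = pi / X" for X by simp
    then show ?thesis by (metis of_real_mult)
  qed
  ultimately show "(\<integral>y. \<phi> (Complex x y) * of_real ((norm (szego_kernel w (Complex x y)))\<^sup>2) \<partial>lborel)
         = of_real (pi / (x + Re w)) * \<phi> (of_real (2 * x) + w)"
    using hardy2_pairing_szego_kernel[OF f x w] unfolding eq line_pairing_def by (metis mult.left_commute mult.commute)
qed

text \<open>
  Limits at the imaginary axis are taken along this sequence, so that dominated convergence
  applies.
\<close>

definition height :: "nat \<Rightarrow> real" where "height n = 1 / real (Suc n)"

lemma height_pos [simp]: "height n > 0" by (simp add: height_def)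

lemma height_tendsto: "height \<longlonglongrightarrow> 0"
  unfolding height_def by real_asymp

lemma filterlim_height: "filterlim height (at_right 0) sequentially"
  by (rule tendsto_imp_filterlim_at_right[OF height_tendsto]) simp

lemma shifted_point_tendsto: "(\<lambda>n. complex_of_real (2 * height n) + w) \<longlonglongrightarrow> w"
  by (rule tendsto_eq_intros height_tendsto | simp)+

lemma shifted_value_tendsto:
  assumes "f holomorphic_on rhp" "Re w > 0"
  shows "(\<lambda>n. f (complex_of_real (2 * height n) + w)) \<longlonglongrightarrow> f w"
proof -
  have "open rhp" by (simp add: rhp_def open_halfspace_Re_gt)
  then have "isCont f w"
    using assms holomorphic_on_imp_continuous_on continuous_on_eq_continuous_at by (fastforce simp: rhp_def)
  then show ?thesis
    using shifted_point_tendsto by (rule isCont_tendsto_compose)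
qed

text \<open>
  The Poisson kernels of the lines with positive abscissa are dominated by the one of
  the imaginary axis.
\<close>

lemma Poisson_dominated_limit:
  fixes G :: "nat \<Rightarrow> real \<Rightarrow> real"
  assumes meas: "\<And>n. G n \<in> borel_measurable borel" and M: "\<And>n y. \<bar>G n y\<bar> \<le> M"
    and lim: "AE y in lborel. (\<lambda>n. G n y) \<longlonglongrightarrow> c" and w: "Re w > 0"
  shows "(\<lambda>n. \<integral>y. G n y * (norm (szego_kernel w (Complex (height n) y)))\<^sup>2 \<partial>lborel) \<longlonglongrightarrow> c * (pi / Re w)"
proof -
  let ?P = "\<lambda>x y. 1 / ((x + Re w)\<^sup>2 + (y - Im w)\<^sup>2)"
  have P0: "integrable lborel (?P 0)" "(\<integral>y. ?P 0 y \<partial>lborel) = pi / Re w"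
    using Lorentzian_integral[OF w, of "Im w"] by simp_all
  have mono: "?P (height n) y \<le> ?P 0 y" for n y
  proof (rule frac_le)
    show "0 < (0 + Re w)\<^sup>2 + (y - Im w)\<^sup>2" using w by (simp add: add_pos_nonneg)
    show "(0 + Re w)\<^sup>2 + (y - Im w)\<^sup>2 \<le> (height n + Re w)\<^sup>2 + (y - Im w)\<^sup>2"
      using w less_imp_le[OF height_pos[of n]] by (intro add_right_mono power_mono) auto
  qed auto
  have "(\<lambda>n. \<integral>y. G n y * ?P (height n) y \<partial>lborel) \<longlonglongrightarrow> (\<integral>y. c * ?P 0 y \<partial>lborel)"
  proof (rule integral_dominated_convergence)
    show "integrable lborel (\<lambda>y. M * ?P 0 y)"
      by (rule integrable_mult_right[OF P0(1)])
    show "AE y in lborel. (\<lambda>n. G n y * ?P (height n) y) \<longlonglongrightarrow> c * ?P 0 y"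
      using lim
    proof eventually_elim
      case (elim y)
      have "(Re w)\<^sup>2 + (y - Im w)\<^sup>2 > 0" using w by (intro add_pos_nonneg) auto
      then show ?case
        by (intro tendsto_mult elim tendsto_divide tendsto_const tendsto_add tendsto_power height_tendsto) auto
    qed
    fix n
    show "AE y in lborel. norm (G n y * ?P (height n) y) \<le> M * ?P 0 y"
    proof
      fix y
      have "\<bar>G n y\<bar> * \<bar>?P (height n) y\<bar> \<le> M * ?P 0 y"
        using M[of n y] mono[of n y] order_trans[OF abs_ge_zero M[of n y]]
        by (intro mult_mono) (auto simp: less_imp_le)
      then show "norm (G n y * ?P (height n) y) \<le> M * ?P 0 y"
        by (simp add: abs_mult)
    qed
    show "(\<lambda>y. G n y * ?P (height n) y) \<in> borel_measurable lborel"
      using meas[of n] by measurable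
  qed measurable
  then show ?thesis
    unfolding szego_kernel_norm_sq integral_mult_right_zero P0(2) .
qed

lemma inner_function_boundary_modulus:
  assumes "inner_function \<theta>"
  shows "AE y in lborel. (\<lambda>n. norm (\<theta> (Complex (height n) y))) \<longlonglongrightarrow> 1"
proof -
  have "AE y in lborel. \<exists>l. ((\<lambda>x. \<theta> (Complex x y)) \<longlongrightarrow> l) (at_right 0) \<and> norm l = 1"
    using assms by (simp add: inner_function_def)
  then show ?thesis
  proof eventually_elim
    case (elim y)
    then obtain l where l: "((\<lambda>x. \<theta> (Complex x y)) \<longlongrightarrow> l) (at_right 0)" "norm l = 1" by blast
    show ?case
      using tendsto_norm[OF filterlim_compose[OF l(1) filterlim_height]] l(2) by simp
  qed
qed

lemma holomorphic_line_measurable: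
  assumes "f holomorphic_on rhp" "x > 0"
  shows "(\<lambda>y. f (Complex x y)) \<in> borel_measurable borel"
  by (rule borel_measurable_continuous_onI[OF continuous_on_vertical_line[OF assms]])

text \<open>
  The maximum principle through the Poisson formula: the modulus at \<open>w\<close> is at most the Poisson
  average of the boundary moduli, which are \<open>1\<close>.
\<close>

lemma inner_function_norm_le_1:
  assumes inner: "inner_function \<theta>" and w: "w \<in> rhp"
  shows "norm (\<theta> w) \<le> 1"
proof -
  have w0: "Re w > 0" using w by (simp add: rhp_def)
  have hol: "\<theta> holomorphic_on rhp" by (rule inner_function_holomorphic[OF inner])
  obtain M where M: "\<forall>z\<in>rhp. norm (\<theta> z) \<le> M"
    using inner by (auto simp: inner_function_def bounded_iff)
  have le: "norm (\<theta> (of_real (2 * height n) + w)) * (pi / (height n + Re w))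
      \<le> (\<integral>y. norm (\<theta> (Complex (height n) y)) * (norm (szego_kernel w (Complex (height n) y)))\<^sup>2 \<partial>lborel)" for n
  proof -
    have "norm (\<theta> (of_real (2 * height n) + w)) * (pi / (height n + Re w))
       = norm (of_real (pi / (height n + Re w)) * \<theta> (of_real (2 * height n) + w))"
      using w0 height_pos[of n] unfolding norm_mult norm_of_real by (simp add: abs_of_pos add_pos_pos)
    also have "\<dots> = norm (\<integral>y. \<theta> (Complex (height n) y) * of_real ((norm (szego_kernel w (Complex (height n) y)))\<^sup>2) \<partial>lborel)"
      unfolding Poisson_formula_bounded(2)[OF hol M height_pos w0] ..
    also have "\<dots> \<le> (\<integral>y. norm (\<theta> (Complex (height n) y) * of_real ((norm (szego_kernel w (Complex (height n) y)))\<^sup>2)) \<partial>lborel)"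
      by (rule integral_norm_bound)
    finally show ?thesis
      by (simp add: norm_mult del: of_real_power)
  qed
  have "(\<lambda>n. \<integral>y. norm (\<theta> (Complex (height n) y)) * (norm (szego_kernel w (Complex (height n) y)))\<^sup>2 \<partial>lborel) \<longlonglongrightarrow> 1 * (pi / Re w)"
  proof (rule Poisson_dominated_limit[OF _ _ inner_function_boundary_modulus[OF inner] w0])
    show "(\<lambda>y. norm (\<theta> (Complex (height n) y))) \<in> borel_measurable borel" for n
      using holomorphic_line_measurable[OF hol height_pos] by measurable
    show "\<bar>norm (\<theta> (Complex (height n) y))\<bar> \<le> M" for n y
      using M by (simp add: rhp_def)
  qed
  moreover have "(\<lambda>n. norm (\<theta> (of_real (2 * height n) + w)) * (pi / (height n + Re w))) \<longlonglongrightarrow> norm (\<theta> w) * (pi / (0 + Re w))"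
    using w0 by (intro tendsto_intros tendsto_norm shifted_value_tendsto hol height_tendsto) auto
  ultimately have "norm (\<theta> w) * (pi / (0 + Re w)) \<le> 1 * (pi / Re w)"
    using le by (intro LIMSEQ_le) auto
  then show ?thesis using w0 by (simp add: field_simps)
qed

lemma norm_sq_one_minus_le:
  fixes c t :: complex
  assumes "norm t \<le> 1"
  shows "(norm (1 - c * t))\<^sup>2 \<le> 1 + (norm c)\<^sup>2 - 2 * Re (c * t)"
proof -
  have "(norm (1 - c * t))\<^sup>2 = 1 + (norm c)\<^sup>2 * (norm t)\<^sup>2 - 2 * Re (c * t)"
  proof -
    have "(norm (1 - v))\<^sup>2 = 1 + (norm v)\<^sup>2 - 2 * Re v" for v
      by (simp add: cmod_power2 power2_diff)
    from this[of "c * t"] show ?thesis by (simp add: norm_mult power_mult_distrib)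
  qed
  moreover have "(norm c)\<^sup>2 * (norm t)\<^sup>2 \<le> (norm c)\<^sup>2 * 1"
    using assms by (intro mult_left_mono power_le_one) auto
  ultimately show ?thesis by simp
qed

lemma model_kernel_hardy2:
  assumes inner: "inner_function \<theta>" and w: "Re w > 0"
  shows "model_kernel \<theta> w \<in> hardy2"
proof -
  have "(\<lambda>z. (1 - cnj (\<theta> w) * \<theta> z) * szego_kernel w z) \<in> hardy2"
  proof (rule hardy2_bounded_mult[OF szego_kernel_hardy2[OF w], where M=2])
    show "(\<lambda>z. 1 - cnj (\<theta> w) * \<theta> z) holomorphic_on rhp"
      using inner_function_holomorphic[OF inner] by (intro holomorphic_intros)
    fix z assume z: "z \<in> rhp"
    have "norm (1 - cnj (\<theta> w) * \<theta> z) \<le> norm (1::complex) + norm (cnj (\<theta> w) * \<theta> z)"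
      by (rule norm_triangle_ineq4)
    also have "norm (cnj (\<theta> w) * \<theta> z) \<le> 1 * 1"
      unfolding norm_mult using inner_function_norm_le_1[OF inner] z w
      by (intro mult_mono) (auto simp: rhp_def)
    finally show "norm (1 - cnj (\<theta> w) * \<theta> z) \<le> 2" by simp
  qed
  then show ?thesis by (simp add: model_kernel_def[abs_def])
qed

text \<open>
  Expand \<open>\<bar>1 - c \<theta>\<bar>\<^sup>2 \<le> 1 + \<bar>c\<bar>\<^sup>2 - 2 Re (c \<theta>)\<close> with \<open>c = cnj (\<theta> w)\<close> and integrate against the Poisson
  kernel. The resulting bound is sharp only in the limit at the imaginary axis, and
  monotonicity of the energy carries that limit to every line.
\<close>

lemma model_kernel_energy:
  assumes inner: "inner_function \<theta>" and w: "Re w > 0" and x: "x > 0"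
  shows "line_energy (model_kernel \<theta> w) x \<le> pi * (1 - (norm (\<theta> w))\<^sup>2) / Re w"
proof -
  define c where "c = cnj (\<theta> w)"
  have hol: "\<theta> holomorphic_on rhp" by (rule inner_function_holomorphic[OF inner])
  have le1: "\<forall>z\<in>rhp. norm (\<theta> z) \<le> 1" using inner_function_norm_le_1[OF inner] by blast
  define U where "U = (\<lambda>t. pi / (t + Re w) * (1 + (norm c)\<^sup>2 - 2 * Re (c * \<theta> (of_real (2 * t) + w))))"
  have bound: "line_energy (model_kernel \<theta> w) t \<le> U t" if t: "t > 0" for t
  proof -
    let ?k = "\<lambda>y. (norm (szego_kernel w (Complex t y)))\<^sup>2"
    have ik: "integrable lborel ?k" and ek: "(\<integral>y. ?k y \<partial>lborel) = pi / (t + Re w)"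
      using szego_kernel_energy[OF t w] by (simp_all add: sq_integrable_def line_energy_def)
    note P = Poisson_formula_bounded[OF hol le1 t w]
    have ip: "integrable lborel (\<lambda>y. c * (\<theta> (Complex t y) * of_real (?k y)))"
      using P(1) by (rule integrable_mult_right)
    have ire: "integrable lborel (\<lambda>y. Re (c * (\<theta> (Complex t y) * of_real (?k y))))"
      using ip by (rule integrable_Re)
    have ere: "(\<integral>y. Re (c * (\<theta> (Complex t y) * of_real (?k y))) \<partial>lborel) = Re (c * (of_real (pi / (t + Re w)) * \<theta> (of_real (2 * t) + w)))"
      using integral_Re[OF ip] unfolding integral_mult_right_zero P(2) .
    have "line_energy (model_kernel \<theta> w) t \<le> (\<integral>y. (1 + (norm c)\<^sup>2) * ?k y - 2 * Re (c * (\<theta> (Complex t y) * of_real (?k y))) \<partial>lborel)"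
      unfolding line_energy_def
    proof (rule integral_mono)
      show "integrable lborel (\<lambda>y. (norm (model_kernel \<theta> w (Complex t y)))\<^sup>2)"
        using hardy2_line(1)[OF model_kernel_hardy2[OF inner w] t] by (simp add: sq_integrable_def)
      show "integrable lborel (\<lambda>y. (1 + (norm c)\<^sup>2) * ?k y - 2 * Re (c * (\<theta> (Complex t y) * of_real (?k y))))"
        by (intro Bochner_Integration.integrable_diff integrable_mult_right ik ire)
      fix y
      have "(norm (model_kernel \<theta> w (Complex t y)))\<^sup>2 = (norm (1 - c * \<theta> (Complex t y)))\<^sup>2 * ?k y"
        by (simp add: model_kernel_def c_def norm_mult power_mult_distrib)
      also have "\<dots> \<le> (1 + (norm c)\<^sup>2 - 2 * Re (c * \<theta> (Complex t y))) * ?k y"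
        using le1 t by (intro mult_right_mono norm_sq_one_minus_le) (auto simp: rhp_def)
      also have "\<dots> = (1 + (norm c)\<^sup>2) * ?k y - 2 * Re (c * (\<theta> (Complex t y) * of_real (?k y)))"
      proof -
        have "Re (c * (\<theta> (Complex t y) * of_real (?k y))) = Re (c * \<theta> (Complex t y)) * ?k y"
          unfolding mult.assoc[symmetric] by (rule Re_mult_of_real)
        then show ?thesis by (simp add: left_diff_distrib)
      qed
      finally show "(norm (model_kernel \<theta> w (Complex t y)))\<^sup>2 \<le> (1 + (norm c)\<^sup>2) * ?k y - 2 * Re (c * (\<theta> (Complex t y) * of_real (?k y)))" .
    qed
    also have "\<dots> = (1 + (norm c)\<^sup>2) * (pi / (t + Re w)) - 2 * Re (c * (of_real (pi / (t + Re w)) * \<theta> (of_real (2 * t) + w)))"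
      by (subst Bochner_Integration.integral_diff)
        (intro integrable_mult_right ik ire | simp only: integral_mult_right_zero ek ere)+
    also have "\<dots> = U t"
    proof -
      have "Re (c * (of_real (pi / (t + Re w)) * \<theta> (of_real (2 * t) + w))) = pi / (t + Re w) * Re (c * \<theta> (of_real (2 * t) + w))"
        by (metis Re_mult_of_real mult.commute mult.left_commute)
      then show ?thesis unfolding U_def right_diff_distrib by (simp only: mult_ac)
    qed
    finally show ?thesis .
  qed
  have "(\<lambda>n. U (height n)) \<longlonglongrightarrow> pi / (0 + Re w) * (1 + (norm c)\<^sup>2 - 2 * Re (c * \<theta> w))"
    unfolding U_def using w
    by (intro tendsto_intros shifted_value_tendsto hol height_tendsto) auto
  moreover have "\<forall>\<^sub>F n in sequentially. line_energy (model_kernel \<theta> w) x \<le> U (height n)"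
  proof -
    have "\<forall>\<^sub>F n in sequentially. height n < x"
      by (rule order_tendstoD(2)[OF height_tendsto x])
    then show ?thesis
    proof eventually_elim
      case (elim n)
      then show ?case
        using line_energy_antimono[OF model_kernel_hardy2[OF inner w] height_pos less_imp_le[OF elim]]
          bound[OF height_pos, of n] by linarith
    qed
  qed
  ultimately have "line_energy (model_kernel \<theta> w) x \<le> pi / (0 + Re w) * (1 + (norm c)\<^sup>2 - 2 * Re (c * \<theta> w))"
    by (intro tendsto_lowerbound) auto
  also have "Re (c * \<theta> w) = (norm (\<theta> w))\<^sup>2"
    unfolding c_def cmod_power2 by (simp add: power2_eq_square)
  finally show ?thesis by (simp add: c_def)
qed

lemma model_kernel_norm:
  assumes inner: "inner_function \<theta>" and w: "Re w > 0"
  shows "h2_norm_sq (model_kernel \<theta> w) \<le> ennreal ((1 - (norm (\<theta> w))\<^sup>2) / (2 * Re w))"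
proof (rule hardy2I(2))
  show "model_kernel \<theta> w holomorphic_on rhp"
    by (rule hardy2_holomorphic[OF model_kernel_hardy2[OF inner w]])
  fix x :: real assume x: "x > 0"
  show "integrable lborel (\<lambda>y. (norm (model_kernel \<theta> w (Complex x y)))\<^sup>2)"
    using hardy2_line(1)[OF model_kernel_hardy2[OF inner w] x] by (simp add: sq_integrable_def)
  show "line_energy (model_kernel \<theta> w) x \<le> 2 * pi * ((1 - (norm (\<theta> w))\<^sup>2) / (2 * Re w))"
    using model_kernel_energy[OF inner w x] by simp
qed

text \<open>
  In the pairing with \<open>\<theta> g\<close>, replacing \<open>\<bar>\<theta>\<bar>\<^sup>2\<close> by \<open>1\<close> leaves two values of the reproducing formula that cancel
  at the boundary. The error \<open>R n\<close> tends to zero by the Cauchy-Schwarz inequality, since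
  \<open>1 - \<bar>\<theta>\<bar>\<^sup>2\<close> vanishes at almost every boundary point.
\<close>

lemma model_kernel_in_model_space:
  assumes inner: "inner_function \<theta>" and w: "Re w > 0"
  shows "model_kernel \<theta> w \<in> model_space \<theta>"
proof -
  let ?k = "szego_kernel w" and ?K = "model_kernel \<theta> w" and ?c = "cnj (\<theta> w)"
  have hol: "\<theta> holomorphic_on rhp" by (rule inner_function_holomorphic[OF inner])
  have le1: "norm (\<theta> z) \<le> 1" if "z \<in> rhp" for z by (rule inner_function_norm_le_1[OF inner that])
  have K: "?K \<in> hardy2" by (rule model_kernel_hardy2[OF inner w])
  have k: "?k \<in> hardy2" by (rule szego_kernel_hardy2[OF w])
  have "h2_inner ?K (\<lambda>s. \<theta> s * g s) = 0" if g: "g \<in> hardy2" for g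
  proof -
    let ?tg = "\<lambda>s. \<theta> s * g s"
    have tg: "?tg \<in> hardy2" by (rule hardy2_bounded_mult[OF g hol le1])
    have tk: "(\<lambda>z. \<theta> z * ?k z) \<in> hardy2" by (rule hardy2_bounded_mult[OF k hol le1])
    define d where "d = (\<lambda>z. 1 - (norm (\<theta> z))\<^sup>2)"
    define R where "R = (\<lambda>n. \<integral>y. (of_real (d (Complex (height n) y)) * ?k (Complex (height n) y)) * cnj (g (Complex (height n) y)) \<partial>lborel)"
    have d01: "0 \<le> d (Complex (height n) y)" "d (Complex (height n) y) \<le> 1" for n y
      using le1[of "Complex (height n) y"] by (auto simp: d_def rhp_def power_le_one)
    have dm[measurable]: "(\<lambda>y. d (Complex (height n) y)) \<in> borel_measurable borel" for n
      unfolding d_def using holomorphic_line_measurable[OF hol height_pos] by measurable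
    have dk: "sq_integrable (\<lambda>y. of_real (d (Complex (height n) y)) * ?k (Complex (height n) y))"
      and dkE: "(norm (of_real (d (Complex (height n) y)) * ?k (Complex (height n) y)))\<^sup>2
            = (d (Complex (height n) y))\<^sup>2 * (norm (?k (Complex (height n) y)))\<^sup>2" for n y
    proof -
      show eq: "(norm (of_real (d (Complex (height n) y)) * ?k (Complex (height n) y)))\<^sup>2
            = (d (Complex (height n) y))\<^sup>2 * (norm (?k (Complex (height n) y)))\<^sup>2" for y
        by (simp add: norm_mult power_mult_distrib)
      have [measurable]: "(\<lambda>y. ?k (Complex (height n) y)) \<in> borel_measurable borel"
        using szego_kernel_energy(2)[OF height_pos w] by (simp add: sq_integrable_def)
      have i: "integrable lborel (\<lambda>y. (norm (?k (Complex (height n) y)))\<^sup>2)"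
        using szego_kernel_energy(2)[OF height_pos w] by (simp add: sq_integrable_def)
      have "integrable lborel (\<lambda>y. (norm (of_real (d (Complex (height n) y)) * ?k (Complex (height n) y)))\<^sup>2)"
      proof (rule Bochner_Integration.integrable_bound[OF i])
        show "AE y in lborel. norm ((norm (of_real (d (Complex (height n) y)) * ?k (Complex (height n) y)))\<^sup>2) \<le> norm ((norm (?k (Complex (height n) y)))\<^sup>2)"
          unfolding eq using d01 by (auto simp: power_le_one mult_left_le_one_le)
      qed measurable
      then show "sq_integrable (\<lambda>y. of_real (d (Complex (height n) y)) * ?k (Complex (height n) y))"
        by (simp add: sq_integrable_def)
    qed
    have "(\<lambda>n. \<integral>y. (d (Complex (height n) y))\<^sup>2 * (norm (?k (Complex (height n) y)))\<^sup>2 \<partial>lborel) \<longlonglongrightarrow> 0 * (pi / Re w)"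
    proof (rule Poisson_dominated_limit[OF _ _ _ w])
      show "(\<lambda>y. (d (Complex (height n) y))\<^sup>2) \<in> borel_measurable borel" for n by measurable
      show "\<bar>(d (Complex (height n) y))\<^sup>2\<bar> \<le> 1" for n y using d01[of n y] by (simp add: power_le_one)
      show "AE y in lborel. (\<lambda>n. (d (Complex (height n) y))\<^sup>2) \<longlonglongrightarrow> 0"
        using inner_function_boundary_modulus[OF inner]
      proof eventually_elim
        case (elim y)
        have "(\<lambda>n. (d (Complex (height n) y))\<^sup>2) \<longlonglongrightarrow> (1 - 1\<^sup>2)\<^sup>2"
          unfolding d_def by (intro tendsto_intros elim)
        then show ?case by simp
      qed
    qed
    then have E0: "(\<lambda>n. (\<integral>y. (d (Complex (height n) y))\<^sup>2 * (norm (?k (Complex (height n) y)))\<^sup>2 \<partial>lborel) * (2 * pi * enn2real (h2_norm_sq g))) \<longlonglongrightarrow> 0"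
      using tendsto_mult_left_zero by force
    have Rle: "(norm (R n))\<^sup>2 \<le> (\<integral>y. (d (Complex (height n) y))\<^sup>2 * (norm (?k (Complex (height n) y)))\<^sup>2 \<partial>lborel) * (2 * pi * enn2real (h2_norm_sq g))" for n
    proof -
      have "(norm (R n))\<^sup>2 \<le> (\<integral>y. (d (Complex (height n) y))\<^sup>2 * (norm (?k (Complex (height n) y)))\<^sup>2 \<partial>lborel) * line_energy g (height n)"
        using sq_integrable_Cauchy_Schwarz[OF dk[of n] sq_integrable_cnj[OF hardy2_line(1)[OF g height_pos[of n]]]]
        unfolding dkE R_def line_energy_def by simp
      also have "\<dots> \<le> (\<integral>y. (d (Complex (height n) y))\<^sup>2 * (norm (?k (Complex (height n) y)))\<^sup>2 \<partial>lborel) * (2 * pi * enn2real (h2_norm_sq g))"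
        by (intro mult_left_mono hardy2_line(2)[OF g height_pos] integral_nonneg_AE) auto
      finally show ?thesis .
    qed
    have "(\<lambda>n. (norm (R n))\<^sup>2) \<longlonglongrightarrow> 0"
      by (rule Lim_null_comparison[OF _ E0]) (use Rle in auto)
    then have "(\<lambda>n. sqrt ((norm (R n))\<^sup>2)) \<longlonglongrightarrow> sqrt 0"
      by (intro tendsto_intros)
    then have R0: "R \<longlonglongrightarrow> 0"
      by (simp add: tendsto_norm_zero_iff)
    have pair: "line_pairing ?K ?tg (height n) = cnj (line_pairing ?tg ?k (height n)) - ?c * (cnj (line_pairing g ?k (height n)) - R n)" for n
    proof -
      let ?z = "\<lambda>y. Complex (height n) y"
      have pw: "?K z * cnj (?tg z) = cnj (?tg z * cnj (?k z)) - ?c * (cnj (g z * cnj (?k z)) - (of_real (d z) * ?k z) * cnj (g z))" for z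
      proof -
        have od: "of_real (d z) = 1 - \<theta> z * cnj (\<theta> z)"
          by (simp add: d_def complex_norm_square del: of_real_power)
        show ?thesis unfolding od by (simp add: model_kernel_def algebra_simps)
      qed
      have i1: "integrable lborel (\<lambda>y. cnj (?tg (?z y) * cnj (?k (?z y))))"
        using hardy2_line_pairing(1)[OF tg k height_pos[of n]] by (rule integrable_cnj)
      have i2: "integrable lborel (\<lambda>y. cnj (g (?z y) * cnj (?k (?z y))))"
        using hardy2_line_pairing(1)[OF g k height_pos[of n]] by (rule integrable_cnj)
      have i3: "integrable lborel (\<lambda>y. (of_real (d (?z y)) * ?k (?z y)) * cnj (g (?z y)))"
        by (rule sq_integrable_mult[OF dk sq_integrable_cnj[OF hardy2_line(1)[OF g height_pos]]])
      have i23: "integrable lborel (\<lambda>y. ?c * (cnj (g (?z y) * cnj (?k (?z y))) - (of_real (d (?z y)) * ?k (?z y)) * cnj (g (?z y))))"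
        by (intro integrable_mult_right Bochner_Integration.integrable_diff i2 i3)
      show ?thesis
        unfolding line_pairing_def pw R_def
        unfolding Bochner_Integration.integral_diff[OF i1 i23] integral_mult_right_zero
          Bochner_Integration.integral_diff[OF i2 i3] Bochner_Integration.integral_cnj ..
    qed
    have "(\<lambda>n. line_pairing ?K ?tg (height n)) \<longlonglongrightarrow> cnj (of_real (2 * pi) * (\<theta> w * g w)) - ?c * (cnj (of_real (2 * pi) * g w) - 0)"
      unfolding pair hardy2_pairing_szego_kernel[OF tg height_pos w] hardy2_pairing_szego_kernel[OF g height_pos w]
      by (intro tendsto_intros R0 shifted_value_tendsto hol w hardy2_holomorphic[OF g])
    then have "(\<lambda>n. line_pairing ?K ?tg (height n) / of_real (2 * pi)) \<longlonglongrightarrow> 0 / of_real (2 * pi)"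
      by (intro tendsto_intros) (auto simp: algebra_simps)
    moreover have "(\<lambda>n. line_pairing ?K ?tg (height n) / of_real (2 * pi)) \<longlonglongrightarrow> h2_inner ?K ?tg"
      by (rule filterlim_compose[OF h2_inner_tendsto[OF K tg] filterlim_height])
    ultimately have "0 / of_real (2 * pi) = h2_inner ?K ?tg"
      by (rule LIMSEQ_unique)
    then show ?thesis by simp
  qed
  then show ?thesis using K by (simp add: model_space_def)
qed

text \<open>
  The orthogonality of \<open>f\<close> to \<open>\<theta> k\<^sub>w\<close> makes the model kernel reproduce \<open>f w\<close>, and the
  Cauchy-Schwarz inequality bounds the pairing.
\<close>

lemma model_space_pointwise_bound:
  assumes inner: "inner_function \<theta>" and f: "f \<in> model_space \<theta>" and w: "Re w > 0"
  shows "(norm (f w))\<^sup>2 \<le> (1 - (norm (\<theta> w))\<^sup>2) / (2 * Re w) * enn2real (h2_norm_sq f)"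
proof -
  let ?k = "szego_kernel w" and ?K = "model_kernel \<theta> w"
  have hol: "\<theta> holomorphic_on rhp" by (rule inner_function_holomorphic[OF inner])
  have le1: "norm (\<theta> z) \<le> 1" if "z \<in> rhp" for z by (rule inner_function_norm_le_1[OF inner that])
  have K: "?K \<in> hardy2" by (rule model_kernel_hardy2[OF inner w])
  have k: "?k \<in> hardy2" by (rule szego_kernel_hardy2[OF w])
  have tk: "(\<lambda>z. \<theta> z * ?k z) \<in> hardy2" by (rule hardy2_bounded_mult[OF k hol le1])
  have fH: "f \<in> hardy2" and orth: "h2_inner f (\<lambda>z. \<theta> z * ?k z) = 0"
    using f k by (auto simp: model_space_def)
  have pair: "line_pairing f ?K (height n) = line_pairing f ?k (height n) - \<theta> w * line_pairing f (\<lambda>z. \<theta> z * ?k z) (height n)" for n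
  proof -
    have pw: "f z * cnj (?K z) = f z * cnj (?k z) - \<theta> w * (f z * cnj (\<theta> z * ?k z))" for z
      by (simp add: model_kernel_def algebra_simps)
    show ?thesis
      unfolding line_pairing_def pw
      by (subst Bochner_Integration.integral_diff)
        (intro integrable_mult_right hardy2_line_pairing(1)[OF fH k height_pos] hardy2_line_pairing(1)[OF fH tk height_pos]
          | simp only: integral_mult_right_zero)+
  qed
  have "(\<lambda>n. line_pairing f (\<lambda>z. \<theta> z * ?k z) (height n) / of_real (2 * pi)) \<longlonglongrightarrow> 0"
    using filterlim_compose[OF h2_inner_tendsto[OF fH tk] filterlim_height] orth by simp
  then have "(\<lambda>n. of_real (2 * pi) * (line_pairing f (\<lambda>z. \<theta> z * ?k z) (height n) / of_real (2 * pi))) \<longlonglongrightarrow> of_real (2 * pi) * 0"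
    by (intro tendsto_intros)
  then have z: "(\<lambda>n. line_pairing f (\<lambda>z. \<theta> z * ?k z) (height n)) \<longlonglongrightarrow> 0" by simp
  have "(\<lambda>n. line_pairing f ?K (height n)) \<longlonglongrightarrow> of_real (2 * pi) * f w - \<theta> w * 0"
    unfolding pair hardy2_pairing_szego_kernel[OF fH height_pos w]
    by (intro tendsto_intros z shifted_value_tendsto w hardy2_holomorphic[OF fH])
  then have "(\<lambda>n. (norm (line_pairing f ?K (height n)))\<^sup>2) \<longlonglongrightarrow> (norm (of_real (2 * pi) * f w - \<theta> w * 0))\<^sup>2"
    by (intro tendsto_intros)
  then have "(norm (of_real (2 * pi) * f w - \<theta> w * 0))\<^sup>2 \<le> (2 * pi * enn2real (h2_norm_sq f)) * (pi * (1 - (norm (\<theta> w))\<^sup>2) / Re w)"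
  proof (rule LIMSEQ_le_const2)
    have "(norm (line_pairing f ?K (height n)))\<^sup>2 \<le> (2 * pi * enn2real (h2_norm_sq f)) * (pi * (1 - (norm (\<theta> w))\<^sup>2) / Re w)" for n
    proof -
      have "(norm (line_pairing f ?K (height n)))\<^sup>2 \<le> line_energy f (height n) * line_energy ?K (height n)"
        by (rule hardy2_line_pairing(2)[OF fH K height_pos])
      also have "\<dots> \<le> (2 * pi * enn2real (h2_norm_sq f)) * (pi * (1 - (norm (\<theta> w))\<^sup>2) / Re w)"
        using hardy2_line(2)[OF fH height_pos] model_kernel_energy[OF inner w height_pos] line_energy_nonneg
        by (intro mult_mono) auto
      finally show ?thesis .
    qed
    then show "\<exists>N. \<forall>n\<ge>N. (norm (line_pairing f ?K (height n)))\<^sup>2 \<le> (2 * pi * enn2real (h2_norm_sq f)) * (pi * (1 - (norm (\<theta> w))\<^sup>2) / Re w)"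
      by blast
  qed
  also have "(norm (of_real (2 * pi) * f w - \<theta> w * 0))\<^sup>2 = (2 * pi)\<^sup>2 * (norm (f w))\<^sup>2"
    by (simp add: norm_mult power_mult_distrib)
  finally have "(2 * pi)\<^sup>2 * (norm (f w))\<^sup>2 \<le> (2 * pi)\<^sup>2 * ((1 - (norm (\<theta> w))\<^sup>2) / (2 * Re w) * enn2real (h2_norm_sq f))"
    using w by (simp add: power2_eq_square field_simps)
  then show ?thesis
    by (subst (asm) mult_le_cancel_left_pos) auto
qed

section \<open>The kernel test and a Harnack inequality\<close>

lemma holomorphic_measurable_rhp:
  assumes "sets \<mu> = sets (restrict_space borel rhp)" "f holomorphic_on rhp"
  shows "f \<in> borel_measurable \<mu>"
proof -
  have "f \<in> borel_measurable (restrict_space borel rhp)"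
    by (intro borel_measurable_continuous_on_restrict holomorphic_on_imp_continuous_on assms)
  then show ?thesis using assms(1) by (simp cong: measurable_cong_sets)
qed

lemma space_measure_rhp: "sets \<mu> = sets (restrict_space borel rhp) \<Longrightarrow> space \<mu> = rhp"
  by (drule sets_eq_imp_space_eq) (simp add: space_restrict_space)

lemma of_real_add_rhp_nonzero:
  assumes "s \<in> rhp" "w > 0"
  shows "of_real w + s \<noteq> 0"
  using assms by (auto simp: rhp_def complex_eq_iff)

text \<open>
  The model kernel at \<open>w\<close> dominates \<open>(1 - \<bar>\<theta> w\<bar>) / \<bar>w + s\<bar>\<close>. If \<open>\<bar>\<theta> w\<bar> = 1\<close> the
  right-hand side is infinite, which is where positivity of the constant matters.
\<close>

proposition carleson_measure_imp_kernel_test: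
  assumes inner: "inner_function \<theta>" and sets: "sets \<mu> = sets (restrict_space borel rhp)"
    and carl: "carleson_measure (model_space \<theta>) \<mu>"
  shows "\<exists>c>0. \<forall>w>0. (\<integral>\<^sup>+ s. ennreal (w / (norm (of_real w + s))\<^sup>2) \<partial>\<mu>)
            \<le> ennreal c / ennreal (1 - norm (\<theta> (of_real w)))"
proof -
  obtain C :: real where C: "\<And>f. f \<in> model_space \<theta> \<Longrightarrow>
        (\<integral>\<^sup>+ s. ennreal ((norm (f s))\<^sup>2) \<partial>\<mu>) \<le> ennreal (C\<^sup>2) * h2_norm_sq f"
    using carl unfolding carleson_measure_def by blast
  have "(\<integral>\<^sup>+ s. ennreal (w / (norm (of_real w + s))\<^sup>2) \<partial>\<mu>) \<le> ennreal (C\<^sup>2 + 1) / ennreal (1 - norm (\<theta> (of_real w)))"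
    if w: "w > 0" for w :: real
  proof -
    define t where "t = norm (\<theta> (of_real w))"
    have w': "Re (of_real w) > 0" "of_real w \<in> rhp" using w by (auto simp: rhp_def)
    have t1: "0 \<le> t" "t \<le> 1" using inner_function_norm_le_1[OF inner w'(2)] by (auto simp: t_def)
    show ?thesis
    proof (cases "t = 1")
      case True
      have "C\<^sup>2 + 1 > 0" by (simp add: add_nonneg_pos)
      then have "ennreal (C\<^sup>2 + 1) / 0 = top" by (simp add: divide_ennreal_def ennreal_mult_top)
      then show ?thesis using True by (simp add: t_def[symmetric])
    next
      case False
      then have t: "t < 1" using t1 by simp
      let ?K = "model_kernel \<theta> (of_real w)"
      have Kmod: "?K \<in> model_space \<theta>" by (rule model_kernel_in_model_space[OF inner w'(1)])
      have Km: "?K \<in> borel_measurable \<mu>"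
        by (rule holomorphic_measurable_rhp[OF sets hardy2_holomorphic[OF model_kernel_hardy2[OF inner w'(1)]]])
      have pw: "w / (norm (of_real w + s))\<^sup>2 \<le> w / (1 - t)\<^sup>2 * (norm (?K s))\<^sup>2" if s: "s \<in> rhp" for s
      proof -
        have "norm (cnj (\<theta> (of_real w)) * \<theta> s) \<le> t * 1"
          unfolding norm_mult t_def complex_mod_cnj
          by (intro mult_left_mono inner_function_norm_le_1[OF inner s]) auto
        then have "1 - t \<le> norm (1 - cnj (\<theta> (of_real w)) * \<theta> s)"
          using norm_triangle_ineq2[of 1 "cnj (\<theta> (of_real w)) * \<theta> s"] by simp
        then have "(1 - t)\<^sup>2 \<le> (norm (1 - cnj (\<theta> (of_real w)) * \<theta> s))\<^sup>2"
          using t by (intro power_mono) auto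
        moreover have "(norm (?K s))\<^sup>2 = (norm (1 - cnj (\<theta> (of_real w)) * \<theta> s))\<^sup>2 / (norm (of_real w + s))\<^sup>2"
          by (simp add: model_kernel_def szego_kernel_def norm_divide norm_mult power_divide add.commute)
        ultimately have "(1 - t)\<^sup>2 / (norm (of_real w + s))\<^sup>2 \<le> (norm (?K s))\<^sup>2"
          by (simp add: divide_right_mono)
        then have "w / (1 - t)\<^sup>2 * ((1 - t)\<^sup>2 / (norm (of_real w + s))\<^sup>2) \<le> w / (1 - t)\<^sup>2 * (norm (?K s))\<^sup>2"
          using w by (intro mult_left_mono) auto
        then show ?thesis using t by simp
      qed
      have "(\<integral>\<^sup>+ s. ennreal (w / (norm (of_real w + s))\<^sup>2) \<partial>\<mu>) \<le> (\<integral>\<^sup>+ s. ennreal (w / (1 - t)\<^sup>2) * ennreal ((norm (?K s))\<^sup>2) \<partial>\<mu>)"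
      proof (rule nn_integral_mono)
        fix s assume "s \<in> space \<mu>"
        then have "s \<in> rhp" using space_measure_rhp[OF sets] by simp
        from pw[OF this] show "ennreal (w / (norm (of_real w + s))\<^sup>2) \<le> ennreal (w / (1 - t)\<^sup>2) * ennreal ((norm (?K s))\<^sup>2)"
          using w by (subst ennreal_mult'[symmetric]) (auto intro: ennreal_leI)
      qed
      also have "\<dots> = ennreal (w / (1 - t)\<^sup>2) * (\<integral>\<^sup>+ s. ennreal ((norm (?K s))\<^sup>2) \<partial>\<mu>)"
        using Km by (intro nn_integral_cmult) measurable
      also have "\<dots> \<le> ennreal (w / (1 - t)\<^sup>2) * (ennreal (C\<^sup>2) * ennreal ((1 - t\<^sup>2) / (2 * w)))"
        using C[OF Kmod] model_kernel_norm[OF inner w'(1)]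
        by (intro mult_left_mono order_trans[OF C[OF Kmod]]) (auto simp: t_def)
      also have "\<dots> = ennreal (w / (1 - t)\<^sup>2 * (C\<^sup>2 * ((1 - t\<^sup>2) / (2 * w))))"
        using w t1 by (simp add: ennreal_mult'[symmetric])
      also have "\<dots> \<le> ennreal ((C\<^sup>2 + 1) / (1 - t))"
      proof (rule ennreal_leI)
        have "1 - t\<^sup>2 = (1 - t) * (1 + t)" by (simp add: power2_eq_square algebra_simps)
        then have "w / (1 - t)\<^sup>2 * (C\<^sup>2 * ((1 - t\<^sup>2) / (2 * w))) = C\<^sup>2 * ((1 + t) / 2) / (1 - t)"
        proof -
          have "u / q\<^sup>2 * (v * (q * p / (2 * u))) = v * (p / 2) / q" if "u \<noteq> 0" "q \<noteq> 0" for u q v p :: real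
            using that by (simp add: power2_eq_square field_simps)
          then show ?thesis using w t \<open>1 - t\<^sup>2 = _\<close> by (metis diff_gt_0_iff_gt less_irrefl)
        qed
        also have "\<dots> \<le> (C\<^sup>2 + 1) / (1 - t)"
          using t1 t mult_left_le[of "(1 + t) / 2" "C\<^sup>2"] by (intro divide_right_mono) auto
        finally show "w / (1 - t)\<^sup>2 * (C\<^sup>2 * ((1 - t\<^sup>2) / (2 * w))) \<le> (C\<^sup>2 + 1) / (1 - t)" .
      qed
      also have "\<dots> = ennreal (C\<^sup>2 + 1) / ennreal (1 - t)"
        using t by (subst divide_ennreal) auto
      finally show ?thesis by (simp add: t_def)
    qed
  qed
  moreover have "C\<^sup>2 + 1 > 0" by (simp add: add_nonneg_pos)
  ultimately show ?thesis by blast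
qed

text \<open>
  Harnack's inequality between a point \<open>s\<close> of a cone and the point of the same modulus on
  the real axis. It is applied to the positive harmonic function \<open>h = 1 - Re (c \<theta>)\<close>,
  with \<open>c\<close> unimodular and chosen so that \<open>h\<close> equals \<open>1 - \<bar>\<theta>\<bar>\<close> at the real point. The Poisson
  kernels of the two points are comparable.
\<close>

lemma Harnack_inequality_sector:
  assumes hol: "\<theta> holomorphic_on rhp" and le1: "\<forall>z\<in>rhp. norm (\<theta> z) \<le> 1"
    and \<kappa>: "0 < \<kappa>" and s: "Re s \<ge> \<kappa> * norm s" "s \<noteq> 0"
  shows "1 - norm (\<theta> s) \<le> 3 / \<kappa>\<^sup>2 * (1 - norm (\<theta> (of_real (norm s))))"
proof -
  define w where "w = norm s"
  have w: "w > 0" using s by (simp add: w_def)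
  have Res: "Re s > 0" using s \<kappa> by (metis less_le_trans mult_pos_pos zero_less_norm_iff)
  have Resw: "Re s \<le> w" using complex_Re_le_cmod by (simp add: w_def)
  have \<kappa>1: "\<kappa> \<le> 1"
    using order_trans[OF s(1) complex_Re_le_cmod] s(2) by (simp add: mult_le_cancel_right1)
  obtain c where c: "norm c = 1" "c * \<theta> (of_real w) = of_real (norm (\<theta> (of_real w)))"
  proof (cases "\<theta> (of_real w) = 0")
    case True then show ?thesis using that[of 1] by simp
  next
    case False
    then show ?thesis
      using that[of "cnj (\<theta> (of_real w)) / of_real (norm (\<theta> (of_real w)))"]
      by (simp add: norm_divide mult.commute[of "cnj _"] complex_norm_square[symmetric] power2_eq_square)
  qed
  define h where "h = (\<lambda>z. 1 - Re (c * \<theta> z))"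
  define \<phi> where "\<phi> = (\<lambda>z. 1 - c * \<theta> z)"
  have Re\<phi>: "Re (\<phi> z) = h z" for z by (simp add: \<phi>_def h_def)
  have Rele: "Re (c * \<theta> z) \<le> norm (\<theta> z)" for z
    using complex_Re_le_cmod[of "c * \<theta> z"] c(1) by (simp add: norm_mult)
  have h0: "h z \<ge> 0" if "z \<in> rhp" for z
    using Rele[of z] le1 that unfolding h_def by fastforce
  have hol\<phi>: "\<phi> holomorphic_on rhp"
    unfolding \<phi>_def using hol by (intro holomorphic_intros)
  have M: "\<forall>z\<in>rhp. norm (\<phi> z) \<le> 2"
  proof
    fix z assume "z \<in> rhp"
    then have "norm (c * \<theta> z) \<le> 1" using le1 c(1) by (simp add: norm_mult)
    then show "norm (\<phi> z) \<le> 2"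
      unfolding \<phi>_def using norm_triangle_ineq4[of 1 "c * \<theta> z"] by simp
  qed
  have P: "integrable lborel (\<lambda>y. h (Complex x y) * (norm (szego_kernel v (Complex x y)))\<^sup>2)"
    "(\<integral>y. h (Complex x y) * (norm (szego_kernel v (Complex x y)))\<^sup>2 \<partial>lborel) = pi / (x + Re v) * h (of_real (2 * x) + v)"
    if "x > 0" "Re v > 0" for x v
  proof -
    note P = Poisson_formula_bounded[OF hol\<phi> M that]
    have eq: "h z * r = Re (\<phi> z * of_real r)" for z r unfolding Re_mult_of_real Re\<phi> ..
    show "integrable lborel (\<lambda>y. h (Complex x y) * (norm (szego_kernel v (Complex x y)))\<^sup>2)"
      unfolding eq using P(1) by (rule integrable_Re)
    have "Re (of_real (pi / (x + Re v)) * \<phi> (of_real (2 * x) + v)) = pi / (x + Re v) * h (of_real (2 * x) + v)"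
      unfolding mult.commute[of "of_real _"] Re_mult_of_real Re\<phi> by (rule mult.commute)
    then show "(\<integral>y. h (Complex x y) * (norm (szego_kernel v (Complex x y)))\<^sup>2 \<partial>lborel) = pi / (x + Re v) * h (of_real (2 * x) + v)"
      unfolding eq integral_Re[OF P(1)] P(2) .
  qed
  have ker: "(norm (szego_kernel s (Complex x y)))\<^sup>2 \<le> 3 / \<kappa>\<^sup>2 * (norm (szego_kernel (of_real w) (Complex x y)))\<^sup>2"
    if x: "x > 0" for x y
  proof -
    let ?u = "x + Re s" and ?v = "y - Im s"
    have "x + w \<le> ?u / \<kappa>"
    proof -
      have "\<kappa> * x \<le> x" using \<kappa>1 x by simp
      then have "\<kappa> * (x + w) \<le> ?u" using s(1) by (simp add: w_def distrib_left)
      then show ?thesis using \<kappa> by (simp add: field_simps)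
    qed
    then have 1: "(x + w)\<^sup>2 \<le> ?u\<^sup>2 / \<kappa>\<^sup>2"
      using x w by (subst power_divide[symmetric], intro power_mono) auto
    have "\<bar>Im s\<bar> \<le> ?u / \<kappa>"
    proof -
      have "\<kappa> * \<bar>Im s\<bar> \<le> \<kappa> * norm s" using \<kappa> abs_Im_le_cmod by (intro mult_left_mono) auto
      then have "\<kappa> * \<bar>Im s\<bar> \<le> ?u" using s(1) x by linarith
      then show ?thesis using \<kappa> by (simp add: field_simps)
    qed
    then have "(Im s)\<^sup>2 \<le> ?u\<^sup>2 / \<kappa>\<^sup>2"
      using x Res \<kappa> by (subst power_divide[symmetric], intro power2_le_iff_abs_le[THEN iffD2]) auto
    moreover have "y\<^sup>2 \<le> 2 * ?v\<^sup>2 + 2 * (Im s)\<^sup>2"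
      using zero_le_power2[of "?v - Im s"] by (simp add: power2_eq_square algebra_simps)
    moreover have "2 * ?v\<^sup>2 \<le> 3 * (?v\<^sup>2 / \<kappa>\<^sup>2)"
    proof -
      have "?v\<^sup>2 * \<kappa>\<^sup>2 \<le> ?v\<^sup>2 * 1" using \<kappa> \<kappa>1 by (intro mult_left_mono power_le_one) auto
      then have "?v\<^sup>2 \<le> ?v\<^sup>2 / \<kappa>\<^sup>2" using \<kappa> by (simp add: pos_le_divide_eq)
      then show ?thesis using zero_le_power2[of ?v] by linarith
    qed
    ultimately have "(x + w)\<^sup>2 + y\<^sup>2 \<le> 3 * (?u\<^sup>2 / \<kappa>\<^sup>2) + 3 * (?v\<^sup>2 / \<kappa>\<^sup>2)"
      using 1 by linarith
    then have le: "(x + w)\<^sup>2 + y\<^sup>2 \<le> 3 / \<kappa>\<^sup>2 * (?u\<^sup>2 + ?v\<^sup>2)"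
      by (simp add: distrib_left)
    have p: "(x + w)\<^sup>2 + y\<^sup>2 > 0" "?u\<^sup>2 + ?v\<^sup>2 > 0" using x w Res by (auto intro!: add_pos_nonneg)
    have "1 * ((x + w)\<^sup>2 + y\<^sup>2) \<le> 3 / \<kappa>\<^sup>2 * (?u\<^sup>2 + ?v\<^sup>2)" using le by simp
    then have "1 / (?u\<^sup>2 + ?v\<^sup>2) \<le> 3 / \<kappa>\<^sup>2 / ((x + w)\<^sup>2 + y\<^sup>2)"
      using p by (subst frac_le_eq) (auto simp: divide_le_0_iff mult.commute)
    then show ?thesis unfolding szego_kernel_norm_sq by simp
  qed
  have "pi / (height n + Re s) * h (of_real (2 * height n) + s)
      \<le> 3 / \<kappa>\<^sup>2 * (pi / (height n + w) * h (of_real (2 * height n) + of_real w))" for n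
  proof -
    have w': "Re (of_real w) > 0" using w by simp
    have "pi / (height n + Re s) * h (of_real (2 * height n) + s)
        = (\<integral>y. h (Complex (height n) y) * (norm (szego_kernel s (Complex (height n) y)))\<^sup>2 \<partial>lborel)"
      by (rule P(2)[OF height_pos Res, symmetric])
    also have "\<dots> \<le> (\<integral>y. 3 / \<kappa>\<^sup>2 * (h (Complex (height n) y) * (norm (szego_kernel (of_real w) (Complex (height n) y)))\<^sup>2) \<partial>lborel)"
    proof (rule integral_mono[OF P(1)[OF height_pos Res] integrable_mult_right[OF P(1)[OF height_pos w']]])
      fix y
      have "h (Complex (height n) y) \<ge> 0" by (rule h0) (simp add: rhp_def)
      from mult_left_mono[OF ker[OF height_pos] this]
      show "h (Complex (height n) y) * (norm (szego_kernel s (Complex (height n) y)))\<^sup>2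
         \<le> 3 / \<kappa>\<^sup>2 * (h (Complex (height n) y) * (norm (szego_kernel (of_real w) (Complex (height n) y)))\<^sup>2)"
        by (simp only: mult_ac)
    qed
    also have "\<dots> = 3 / \<kappa>\<^sup>2 * (pi / (height n + w) * h (of_real (2 * height n) + of_real w))"
      unfolding integral_mult_right_zero P(2)[OF height_pos w'] by simp
    finally show ?thesis .
  qed
  moreover have "(\<lambda>n. h (of_real (2 * height n) + v)) \<longlonglongrightarrow> h v" if "Re v > 0" for v
    unfolding h_def by (intro tendsto_intros shifted_value_tendsto hol that)
  then have "(\<lambda>n. pi / (height n + Re s) * h (of_real (2 * height n) + s)) \<longlonglongrightarrow> pi / (0 + Re s) * h s"
    "(\<lambda>n. 3 / \<kappa>\<^sup>2 * (pi / (height n + w) * h (of_real (2 * height n) + of_real w))) \<longlonglongrightarrow> 3 / \<kappa>\<^sup>2 * (pi / (0 + w) * h (of_real w))"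
    using Res w by (intro tendsto_intros height_tendsto; simp)+
  ultimately have "pi / (0 + Re s) * h s \<le> 3 / \<kappa>\<^sup>2 * (pi / (0 + w) * h (of_real w))"
    by (intro LIMSEQ_le) auto
  moreover have "pi / w * h s \<le> pi / (0 + Re s) * h s"
    using Res Resw w h0[of s] by (intro mult_right_mono divide_left_mono) (auto simp: rhp_def)
  ultimately have "pi / w * h s \<le> pi / w * (3 / \<kappa>\<^sup>2 * h (of_real w))"
    by (simp add: mult_ac)
  then have "h s \<le> 3 / \<kappa>\<^sup>2 * h (of_real w)"
    using w by (subst (asm) mult_le_cancel_left_pos) auto
  moreover have "1 - norm (\<theta> s) \<le> h s"
    using Rele[of s] by (simp add: h_def)
  moreover have "h (of_real w) = 1 - norm (\<theta> (of_real w))"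
    unfolding h_def c(2) by simp
  ultimately show ?thesis unfolding w_def by simp
qed

section \<open>Boundary regularity of inner functions off the spectrum\<close>

lemma open_rhp: "open rhp" and convex_rhp: "convex rhp"
  by (simp_all add: rhp_def open_halfspace_Re_gt convex_halfspace_Re_gt)

lemma norm_diff_inverse_le:
  fixes z a b :: complex
  assumes "norm (z - a) \<ge> r" "norm (z - b) \<ge> r" "r > 0"
  shows "norm (1 / (z - a) - 1 / (z - b)) \<le> norm (a - b) / r\<^sup>2"
proof -
  have ne: "z - a \<noteq> 0" "z - b \<noteq> 0" using assms by auto
  have "1 / (z - a) - 1 / (z - b) = (a - b) / ((z - a) * (z - b))"
    using ne by (simp add: divide_simps)
  then have "norm (1 / (z - a) - 1 / (z - b)) = norm (a - b) / (norm (z - a) * norm (z - b))"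
    by (simp add: norm_divide norm_mult)
  also have "\<dots> \<le> norm (a - b) / (r * r)"
    using assms by (intro divide_left_mono mult_mono mult_pos_pos) auto
  finally show ?thesis by (simp add: power2_eq_square)
qed

text \<open>
  The part of the boundary integral over the rectangle with corners \<open>x - ih\<close> and \<open>h + ih\<close> that does not
  come from the left side, the side that approaches the imaginary axis.
\<close>

definition rect_outer :: "real \<Rightarrow> real \<Rightarrow> (complex \<Rightarrow> complex) \<Rightarrow> complex" where
  "rect_outer h x f = integral {x..h} (\<lambda>t. f (Complex t (-h))) - integral {x..h} (\<lambda>t. f (Complex t h))
     + \<i> * integral {-h..h} (\<lambda>y. f (Complex h y))"

lemma norm_rect_outer_le:
  assumes x: "0 < x" "x < h"
    and cont: "continuous_on (path_image (rectpath (Complex x (-h)) (Complex h h))) f"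
    and B: "\<And>z. z \<in> path_image (rectpath (Complex x (-h)) (Complex h h)) \<Longrightarrow> norm z \<ge> h \<Longrightarrow> norm (f z) \<le> B"
    and B0: "B \<ge> 0"
  shows "norm (rect_outer h x f) \<le> 4 * h * B"
proof -
  let ?R = "path_image (rectpath (Complex x (-h)) (Complex h h))"
  have R: "?R = {z. Re z \<in> {x, h} \<and> Im z \<in> {-h..h}} \<union> {z. Im z \<in> {-h, h} \<and> Re z \<in> {x..h}}"
    using x by (subst path_image_rectpath) auto
  have b: "norm (integral {u..v} g) \<le> (v - u) * B"
    if "u \<le> v" "continuous_on {u..v} g" "\<And>t. t \<in> {u..v} \<Longrightarrow> norm (g t) \<le> B" for u v and g :: "real \<Rightarrow> complex"
    using integral_bound[OF that] by (simp add: mult.commute)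
  have nIm: "norm (Complex t s) \<ge> \<bar>s\<bar>" "norm (Complex t s) \<ge> \<bar>t\<bar>" for t s
    using abs_Im_le_cmod[of "Complex t s"] abs_Re_le_cmod[of "Complex t s"] by auto
  have 1: "norm (integral {x..h} (\<lambda>t. f (Complex t (-h)))) \<le> (h - x) * B"
    using x nIm(1)[where s="-h"] by (intro b continuous_on_compose2[OF cont] B) (auto intro!: continuous_intros simp: R)
  have 2: "norm (integral {x..h} (\<lambda>t. f (Complex t h))) \<le> (h - x) * B"
    using x nIm(1)[where s=h] by (intro b continuous_on_compose2[OF cont] B) (auto intro!: continuous_intros simp: R)
  have 3: "norm (integral {-h..h} (\<lambda>y. f (Complex h y))) \<le> (h - (-h)) * B"
    using x nIm(2)[where t=h] by (intro b continuous_on_compose2[OF cont] B) (auto intro!: continuous_intros simp: R)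
  have "norm (rect_outer h x f) \<le> norm (integral {x..h} (\<lambda>t. f (Complex t (-h)))) + norm (integral {x..h} (\<lambda>t. f (Complex t h)))
     + norm (\<i> * integral {-h..h} (\<lambda>y. f (Complex h y)))"
    unfolding rect_outer_def by (intro order_trans[OF norm_triangle_ineq] add_mono norm_triangle_ineq4) auto
  also have "\<dots> \<le> (h - x) * B + (h - x) * B + 2 * h * B"
    using 1 2 3 by (intro add_mono) (auto simp: norm_mult)
  also have "\<dots> = 4 * h * B - 2 * x * B" by (simp add: algebra_simps)
  also have "\<dots> \<le> 4 * h * B" using x B0 by simp
  finally show ?thesis .
qed

text \<open>
  A quantitative Schwarz reflection that needs only almost everywhere boundary values. Let
  \<open>D(z) = 1 / (z - s) - 1 / (z - s')\<close>. The boundary integral of \<open>\<theta> D\<close> over a rectangle in the right half-plane is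
  \<open>2\<pi>i (\<theta> s - \<theta> s')\<close>. The reflected function \<open>1 / cnj (\<theta> (- cnj z))\<close> has no pole in the
  reflected rectangle, so its integral against \<open>D\<close> vanishes. Conjugating and substituting
  \<open>z \<mapsto> - cnj z\<close> moves the latter integral to the first rectangle, where it becomes that of
  \<open>D' / \<theta>\<close>, where \<open>D'(z) = 1 / (z + cnj s) - 1 / (z + cnj s')\<close>, up to sign. On the imaginary axis the two
  left sides cancel because \<open>\<bar>\<theta>\<bar> = 1\<close>; on the other sides \<open>D\<close> and \<open>D'\<close> are of size \<open>\<bar>s - s'\<bar> / h\<^sup>2\<close>.
\<close>

lemma inner_function_Lipschitz_near_zero:
  assumes inner: "inner_function \<theta>" and h: "h > 0" and \<delta>: "\<delta> > 0"
    and low: "\<And>z. z \<in> rhp \<Longrightarrow> norm z < 2 * h \<Longrightarrow> norm (\<theta> z) \<ge> \<delta>"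
    and s: "s \<in> rhp" "norm s \<le> h / 4" and s': "s' \<in> rhp" "norm s' \<le> h / 4"
  shows "norm (\<theta> s - \<theta> s') \<le> 8 / h * (1 + 1 / \<delta>) * norm (s - s')"
proof -
  have hol: "\<theta> holomorphic_on rhp" by (rule inner_function_holomorphic[OF inner])
  have le1: "norm (\<theta> z) \<le> 1" if "z \<in> rhp" for z by (rule inner_function_norm_le_1[OF inner that])
  define m where "m = min (min (Re s) (Re s') / 2) (h / 4)"
  have m: "m > 0" using s s' h by (auto simp: m_def rhp_def)
  have mle: "2 * m \<le> Re s" "2 * m \<le> Re s'" "m < h" using h by (auto simp: m_def)
  define D where "D = (\<lambda>z. 1 / (z - s) - 1 / (z - s'))"
  define D' where "D' = (\<lambda>z. 1 / (z + cnj s) - 1 / (z + cnj s'))"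
  define S where "S = rhp \<inter> ball 0 (2 * h)"
  have S: "convex S" "open S" by (auto simp: S_def open_rhp convex_rhp intro: convex_Int)
  have holS: "\<theta> holomorphic_on S" using hol by (rule holomorphic_on_subset) (auto simp: S_def)
  have lowS: "norm (\<theta> z) \<ge> \<delta>" if "z \<in> S" for z using that low by (auto simp: S_def)
  \<comment> \<open>The combined integrand on the left sides of the two contours.\<close>
  define E where "E = (\<lambda>z. \<theta> z * D z + cnj (D' z / \<theta> z))"
  define B where "B = 2 * norm (s - s') / h\<^sup>2"
  have B0: "B \<ge> 0" by (simp add: B_def)
  have ident: "2 * pi * \<i> * (\<theta> s - \<theta> s') = rect_outer h x (\<lambda>z. \<theta> z * D z) - cnj (rect_outer h x (\<lambda>z. D' z / \<theta> z))
        - \<i> * integral {-h..h} (\<lambda>y. E (Complex x y))"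
    and outer: "norm (rect_outer h x (\<lambda>z. \<theta> z * D z)) \<le> 4 * h * B"
      "norm (rect_outer h x (\<lambda>z. D' z / \<theta> z)) \<le> 4 * h * (B / \<delta>)"
    if x: "0 < x" "x < m" for x
  proof -
    let ?a = "Complex x (-h)" and ?b = "Complex h h"
    have xh: "x < h" using x mle by simp
    have box: "s \<in> box ?a ?b" "s' \<in> box ?a ?b"
      using s s' x mle abs_Re_le_cmod[of s] abs_Im_le_cmod[of s] abs_Re_le_cmod[of s'] abs_Im_le_cmod[of s'] h
      by (auto simp: in_box_complex_iff)
    have cb: "cbox ?a ?b \<subseteq> S"
    proof
      fix z assume "z \<in> cbox ?a ?b"
      then have z: "x \<le> Re z" "Re z \<le> h" "\<bar>Im z\<bar> \<le> h" by (auto simp: in_cbox_complex_iff)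
      then have "(Re z)\<^sup>2 \<le> h\<^sup>2" "(Im z)\<^sup>2 \<le> h\<^sup>2"
        using x h by (auto intro: power_mono simp flip: abs_le_square_iff)
      then have "(norm z)\<^sup>2 < (2 * h)\<^sup>2"
      proof -
        have "(2 * h)\<^sup>2 = 4 * h\<^sup>2" by (simp add: power_mult_distrib)
        with \<open>(Re z)\<^sup>2 \<le> h\<^sup>2\<close> \<open>(Im z)\<^sup>2 \<le> h\<^sup>2\<close> zero_less_power[OF h, of 2] show ?thesis
          unfolding cmod_power2 by linarith
      qed
      then have "norm z < 2 * h" using h by (intro power2_less_imp_less[of "norm z"]) auto
      then show "z \<in> S" using z x by (simp add: S_def rhp_def)
    qed
    have img: "path_image (rectpath ?a ?b) \<subseteq> S" "s \<notin> path_image (rectpath ?a ?b)" "s' \<notin> path_image (rectpath ?a ?b)"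
      using path_image_rectpath_cbox_minus_box[of ?a ?b] box cb xh h by auto
    have cth: "continuous_on (path_image (rectpath ?a ?b)) \<theta>"
      using img(1) holS holomorphic_on_imp_continuous_on continuous_on_subset by blast
    have c1: "continuous_on (path_image (rectpath ?a ?b)) (\<lambda>z. \<theta> z * D z)"
      unfolding D_def by (intro continuous_intros cth) (use img in auto)
    have ne': "z + cnj s \<noteq> 0" "z + cnj s' \<noteq> 0" "\<theta> z \<noteq> 0" if "z \<in> S" for z
    proof -
      show "z + cnj s \<noteq> 0" "z + cnj s' \<noteq> 0"
        using that s s' by (auto simp: S_def rhp_def complex_eq_iff)
      show "\<theta> z \<noteq> 0" using lowS[OF that] \<delta> by auto
    qed
    have hol': "(\<lambda>z. D' z / \<theta> z) holomorphic_on S"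
      unfolding D'_def by (intro holomorphic_intros holS) (use ne' in auto)
    then have c2: "continuous_on (path_image (rectpath ?a ?b)) (\<lambda>z. D' z / \<theta> z)"
      using img(1) holomorphic_on_imp_continuous_on continuous_on_subset by blast
    have far: "norm (z - s) \<ge> 3 / 4 * h" "norm (z - s') \<ge> 3 / 4 * h" "norm (z - (- cnj s)) \<ge> 3 / 4 * h" "norm (z - (- cnj s')) \<ge> 3 / 4 * h"
      if "norm z \<ge> h" for z
      using norm_triangle_ineq2[of z s] norm_triangle_ineq2[of z s'] norm_triangle_ineq2[of z "- cnj s"] norm_triangle_ineq2[of z "- cnj s'"] s s' that
      by auto
    have sq: "norm (a - b) / (3 / 4 * h)\<^sup>2 \<le> 2 * norm (a - b) / h\<^sup>2" for a b :: complex
    proof -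
      have "norm (a - b) / (3 / 4 * h)\<^sup>2 = 16 / 9 * (norm (a - b) / h\<^sup>2)"
        by (simp add: power_mult_distrib power2_eq_square)
      also have "\<dots> \<le> 2 * (norm (a - b) / h\<^sup>2)" by (intro mult_right_mono) auto
      finally show ?thesis by simp
    qed
    have DB: "norm (D z) \<le> B" "norm (D' z) \<le> B" if "norm z \<ge> h" for z
    proof -
      show "norm (D z) \<le> B"
        unfolding D_def B_def using norm_diff_inverse_le[OF far(1,2)[OF that]] h sq[of s s'] by fastforce
      have "norm (- cnj s - - cnj s') = norm (s - s')"
        by (metis complex_cnj_diff complex_mod_cnj minus_diff_eq minus_diff_minus norm_minus_cancel)
      then show "norm (D' z) \<le> B"
        unfolding D'_def B_def using norm_diff_inverse_le[OF far(3,4)[OF that]] h sq[of "- cnj s" "- cnj s'"] by fastforce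
    qed
    show "norm (rect_outer h x (\<lambda>z. \<theta> z * D z)) \<le> 4 * h * B"
    proof (rule norm_rect_outer_le[OF x(1) xh c1 _ B0])
      fix z assume z: "z \<in> path_image (rectpath ?a ?b)" "h \<le> norm z"
      have "norm (\<theta> z) * norm (D z) \<le> 1 * B"
        using DB(1)[OF z(2)] le1[of z] z(1) img(1) by (intro mult_mono) (auto simp: S_def)
      then show "norm (\<theta> z * D z) \<le> B" by (simp add: norm_mult)
    qed
    show "norm (rect_outer h x (\<lambda>z. D' z / \<theta> z)) \<le> 4 * h * (B / \<delta>)"
    proof (rule norm_rect_outer_le[OF x(1) xh c2])
      fix z assume z: "z \<in> path_image (rectpath ?a ?b)" "h \<le> norm z"
      have "norm (D' z) / norm (\<theta> z) \<le> B / \<delta>"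
        using DB(2)[OF z(2)] lowS[of z] z(1) img(1) \<delta> B0 by (intro frac_le) auto
      then show "norm (D' z / \<theta> z) \<le> B / \<delta>" by (simp add: norm_divide)
    qed (use B0 \<delta> in auto)
    have I1: "((\<lambda>z. \<theta> z * D z) has_contour_integral (2 * pi * \<i> * \<theta> s - 2 * pi * \<i> * \<theta> s')) (rectpath ?a ?b)"
    proof -
      have "(\<lambda>z. \<theta> z * D z) = (\<lambda>z. \<theta> z / (z - s) - \<theta> z / (z - s'))"
        by (simp add: D_def fun_eq_iff right_diff_distrib)
      then show ?thesis
        using has_contour_integral_diff[OF has_contour_integral_rectpath_pole[OF holS S cb box(1)]
          has_contour_integral_rectpath_pole[OF holS S cb box(2)]] by simp
    qed
    have I2: "((\<lambda>z. D' z / \<theta> z) has_contour_integral 0) (rectpath ?a ?b)"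
      by (rule Cauchy_theorem_convex_simple[OF hol' S(1) _ img(1)]) auto
    define J1 where "J1 = integral {-h..h} (\<lambda>y. \<theta> (Complex x y) * D (Complex x y))"
    define J2 where "J2 = integral {-h..h} (\<lambda>y. D' (Complex x y) / \<theta> (Complex x y))"
    have hh: "- h < h" using h by simp
    have "2 * pi * \<i> * (\<theta> s - \<theta> s') = contour_integral (rectpath ?a ?b) (\<lambda>z. \<theta> z * D z)"
      unfolding contour_integral_unique[OF I1] by (simp only: right_diff_distrib)
    also have "\<dots> = rect_outer h x (\<lambda>z. \<theta> z * D z) - \<i> * J1"
      unfolding contour_integral_rectpath[OF xh hh c1] rect_outer_def J1_def by (simp add: algebra_simps)
    finally have e1: "2 * pi * \<i> * (\<theta> s - \<theta> s') = rect_outer h x (\<lambda>z. \<theta> z * D z) - \<i> * J1" .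
    have "0 = contour_integral (rectpath ?a ?b) (\<lambda>z. D' z / \<theta> z)"
      unfolding contour_integral_unique[OF I2] ..
    also have "\<dots> = rect_outer h x (\<lambda>z. D' z / \<theta> z) - \<i> * J2"
      unfolding contour_integral_rectpath[OF xh hh c2] rect_outer_def J2_def by (simp add: algebra_simps)
    finally have e2: "0 = rect_outer h x (\<lambda>z. D' z / \<theta> z) - \<i> * J2" .
    have sub: "(\<lambda>y. Complex x y) ` {-h..h} \<subseteq> path_image (rectpath ?a ?b)"
      using xh h by (subst path_image_rectpath) auto
    have cl: "continuous_on {-h..h} (\<lambda>y. Complex x y)" by (intro continuous_intros)
    have "integral {-h..h} (\<lambda>y. E (Complex x y)) = J1 + cnj J2"
      unfolding E_def J1_def J2_def integral_cnj
      by (intro Henstock_Kurzweil_Integration.integral_add integrable_continuous_real continuous_on_cnj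
          continuous_on_compose2[OF c1 cl sub] continuous_on_compose2[OF c2 cl sub])
    moreover have "cnj (rect_outer h x (\<lambda>z. D' z / \<theta> z)) = - \<i> * cnj J2"
      using arg_cong[OF e2, of cnj] by (simp add: eq_neg_iff_add_eq_0)
    ultimately show "2 * pi * \<i> * (\<theta> s - \<theta> s') = rect_outer h x (\<lambda>z. \<theta> z * D z) - cnj (rect_outer h x (\<lambda>z. D' z / \<theta> z))
        - \<i> * integral {-h..h} (\<lambda>y. E (Complex x y))"
      unfolding e1 by (simp add: algebra_simps)
  qed
  obtain n0 where n0: "\<And>n. n \<ge> n0 \<Longrightarrow> height n < m"
    using order_tendstoD(2)[OF height_tendsto m] by (auto simp: eventually_sequentially)
  define \<xi> where "\<xi> n = height (n + n0)" for n
  have \<xi>: "0 < \<xi> n" "\<xi> n < m" for n using n0 by (auto simp: \<xi>_def)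
  have \<xi>0: "\<xi> \<longlonglongrightarrow> 0" unfolding \<xi>_def by (rule LIMSEQ_ignore_initial_segment[OF height_tendsto])
  have inS: "Complex (\<xi> n) y \<in> S" if "y \<in> {-h..h}" for n y
  proof -
    have "\<bar>\<xi> n\<bar> + \<bar>y\<bar> < 2 * h" using \<xi>[of n] mle that by auto
    then have "norm (Complex (\<xi> n) y) < 2 * h"
      using cmod_le[of "Complex (\<xi> n) y"] by simp
    then show ?thesis using \<xi>[of n] by (simp add: S_def rhp_def)
  qed
  have farD: "norm (Complex x y - s) \<ge> m" "norm (Complex x y - s') \<ge> m" "norm (Complex x y + cnj s) \<ge> m" "norm (Complex x y + cnj s') \<ge> m"
    if "0 \<le> x" "x < m" for x y
    using that mle m abs_Re_le_cmod[of "Complex x y - s"] abs_Re_le_cmod[of "Complex x y - s'"]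
      abs_Re_le_cmod[of "Complex x y + cnj s"] abs_Re_le_cmod[of "Complex x y + cnj s'"] by auto
  have inv2: "norm (1 / a - 1 / b) \<le> 2 / m" if "norm a \<ge> m" "norm b \<ge> m" for a b :: complex
  proof -
    have "norm (1 / a) \<le> 1 / m" "norm (1 / b) \<le> 1 / m"
      using that m by (auto simp: norm_divide intro!: frac_le)
    then show ?thesis using norm_triangle_ineq4[of "1 / a" "1 / b"] by simp
  qed
  have DM: "norm (D (Complex x y)) \<le> 2 / m" "norm (D' (Complex x y)) \<le> 2 / m" if "0 \<le> x" "x < m" for x y
    unfolding D_def D'_def using farD[OF that] by (auto intro!: inv2)
  have lim: "(\<lambda>n. integral {-h..h} (\<lambda>y. E (Complex (\<xi> n) y))) \<longlonglongrightarrow> 0"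
  proof -
    have c: "continuous_on {-h..h} (\<lambda>y. E (Complex (\<xi> n) y))" for n
    proof -
      have "continuous_on {-h..h} (\<lambda>y. \<theta> (Complex (\<xi> n) y))"
        using inS by (intro continuous_on_compose2[OF holomorphic_on_imp_continuous_on[OF holS]] continuous_intros) auto
      moreover have "Complex (\<xi> n) y - s \<noteq> 0" "Complex (\<xi> n) y - s' \<noteq> 0" "Complex (\<xi> n) y + cnj s \<noteq> 0" "Complex (\<xi> n) y + cnj s' \<noteq> 0" for y
        using farD[of "\<xi> n" y] \<xi>[of n] m by auto
      moreover have "\<theta> (Complex (\<xi> n) y) \<noteq> 0" if "y \<in> {-h..h}" for y
        using lowS[OF inS[OF that, of n]] \<delta> by auto
      ultimately show ?thesis
        unfolding E_def D_def D'_def by (intro continuous_intros continuous_on_cnj) auto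
    qed
    have eq: "integral {-h..h} (\<lambda>y. E (Complex (\<xi> n) y)) = (\<integral>y. indicator {-h..h} y *\<^sub>R E (Complex (\<xi> n) y) \<partial>lborel)" for n
      using set_borel_integral_eq_integral(2)[OF borel_integrable_atLeastAtMost'[OF c]]
      by (simp add: set_lebesgue_integral_def)
    define M where "M = 2 / m + 2 / m / \<delta>"
    have "(\<lambda>n. \<integral>y. indicator {-h..h} y *\<^sub>R E (Complex (\<xi> n) y) \<partial>lborel) \<longlonglongrightarrow> (\<integral>y. (0::complex) \<partial>(lborel::real measure))"
    proof (rule integral_dominated_convergence[where w="\<lambda>y. indicator {-h..h} y * M"])
      show "(\<lambda>y. indicator {-h..h} y *\<^sub>R E (Complex (\<xi> n) y)) \<in> borel_measurable lborel" for n
        using borel_measurable_continuous_on_indicator[OF _ c[of n]] by simp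
      show "integrable lborel (\<lambda>y. indicator {-h..h} y * M)"
        using h by (intro integrable_mult_left integrable_real_indicator) auto
      show "AE y in lborel. norm (indicator {-h..h} y *\<^sub>R E (Complex (\<xi> n) y)) \<le> indicator {-h..h} y * M" for n
      proof
        fix y
        show "norm (indicator {-h..h} y *\<^sub>R E (Complex (\<xi> n) y)) \<le> indicator {-h..h} y * M"
        proof (cases "y \<in> {-h..h}")
          case True
          let ?z = "Complex (\<xi> n) y"
          have "norm (E ?z) \<le> norm (\<theta> ?z * D ?z) + norm (cnj (D' ?z / \<theta> ?z))"
            unfolding E_def by (rule norm_triangle_ineq)
          also have "norm (\<theta> ?z * D ?z) \<le> 1 * (2 / m)"
            unfolding norm_mult using DM(1)[of "\<xi> n" y] \<xi>[of n] le1[of ?z]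
            by (intro mult_mono) (auto simp: rhp_def)
          also have "norm (cnj (D' ?z / \<theta> ?z)) \<le> 2 / m / \<delta>"
            unfolding complex_mod_cnj norm_divide using DM(2)[of "\<xi> n" y] \<xi>[of n] lowS[OF inS[OF True]] \<delta> m
            by (intro frac_le) auto
          finally show ?thesis using True by (simp add: M_def)
        qed simp
      qed
      show "AE y in lborel. (\<lambda>n. indicator {-h..h} y *\<^sub>R E (Complex (\<xi> n) y)) \<longlonglongrightarrow> 0"
        using inner_function_boundary_modulus[OF inner]
      proof eventually_elim
        case (elim y)
        show ?case
        proof (cases "y \<in> {-h..h}")
          case True
          have t1: "(\<lambda>n. norm (\<theta> (Complex (\<xi> n) y))) \<longlonglongrightarrow> 1"
            unfolding \<xi>_def by (rule LIMSEQ_ignore_initial_segment[OF elim])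
          have zlim: "(\<lambda>n. Complex (\<xi> n) y) \<longlonglongrightarrow> Complex 0 y"
            by (intro tendsto_intros \<xi>0)
          have nz: "Complex 0 y - s \<noteq> 0" "Complex 0 y - s' \<noteq> 0" "Complex 0 y + cnj s \<noteq> 0" "Complex 0 y + cnj s' \<noteq> 0"
            using farD[of 0 y] m by auto
          have "(\<lambda>n. D (Complex (\<xi> n) y) + cnj (D' (Complex (\<xi> n) y))) \<longlonglongrightarrow> D (Complex 0 y) + cnj (D' (Complex 0 y))"
            unfolding D_def D'_def using nz by (intro tendsto_intros zlim)
          moreover have "D (Complex 0 y) + cnj (D' (Complex 0 y)) = 0"
          proof -
            have "cnj (Complex 0 y + cnj u) = - (Complex 0 y - u)" for u by (simp add: complex_eq_iff)
            then have "cnj (1 / (Complex 0 y + cnj u)) = - (1 / (Complex 0 y - u))" for u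
              by (metis complex_cnj_divide complex_cnj_one divide_minus_right)
            then show ?thesis unfolding D_def D'_def by (simp del: complex_cnj_divide)
          qed
          ultimately have t2: "(\<lambda>n. norm (D (Complex (\<xi> n) y) + cnj (D' (Complex (\<xi> n) y)))) \<longlonglongrightarrow> 0"
            using tendsto_norm_zero by fastforce
          have "(\<lambda>n. 2 / m * (1 - (norm (\<theta> (Complex (\<xi> n) y)))\<^sup>2) / \<delta> + norm (D (Complex (\<xi> n) y) + cnj (D' (Complex (\<xi> n) y))) / \<delta>)
             \<longlonglongrightarrow> 2 / m * (1 - 1\<^sup>2) / \<delta> + 0 / \<delta>"
            using m \<delta> by (intro tendsto_intros t1 t2) auto
          then have t3: "(\<lambda>n. 2 / m * (1 - (norm (\<theta> (Complex (\<xi> n) y)))\<^sup>2) / \<delta> + norm (D (Complex (\<xi> n) y) + cnj (D' (Complex (\<xi> n) y))) / \<delta>) \<longlonglongrightarrow> 0"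
            by simp
          have "(\<lambda>n. E (Complex (\<xi> n) y)) \<longlonglongrightarrow> 0"
          proof (rule Lim_null_comparison[OF always_eventually t3], rule allI)
            fix n
            let ?z = "Complex (\<xi> n) y"
            have nth: "norm (\<theta> ?z) \<ge> \<delta>" by (rule lowS[OF inS[OF True]])
            then have th: "cnj (\<theta> ?z) \<noteq> 0" using \<delta> by auto
            have n1: "norm (\<theta> ?z) \<le> 1" using le1[of ?z] \<xi>[of n] by (simp add: rhp_def)
            \<comment> \<open>The first summand vanishes in the limit since the modulus of the inner function tends to 1, the second since the reflected kernels cancel on the imaginary axis.\<close>
            have "E ?z = (D ?z * (of_real ((norm (\<theta> ?z))\<^sup>2) - 1) + (D ?z + cnj (D' ?z))) / cnj (\<theta> ?z)"
              unfolding E_def complex_norm_square using th by (simp add: field_simps)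
            also have "norm \<dots> \<le> (norm (D ?z) * (1 - (norm (\<theta> ?z))\<^sup>2) + norm (D ?z + cnj (D' ?z))) / norm (\<theta> ?z)"
            proof -
              have "norm (of_real ((norm (\<theta> ?z))\<^sup>2) - 1 :: complex) = 1 - (norm (\<theta> ?z))\<^sup>2"
                using n1 power_le_one[OF norm_ge_zero n1, of 2]
                by (metis abs_minus_commute abs_of_nonneg diff_ge_0_iff_ge norm_of_real of_real_1 of_real_diff)
              then show ?thesis
                unfolding norm_divide complex_mod_cnj
                by (intro divide_right_mono order_trans[OF norm_triangle_ineq]) (auto simp: norm_mult)
            qed
            also have "\<dots> \<le> (2 / m * (1 - (norm (\<theta> ?z))\<^sup>2) + norm (D ?z + cnj (D' ?z))) / \<delta>"
              using DM(1)[of "\<xi> n" y] \<xi>[of n] n1 nth \<delta> m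
              by (intro frac_le add_mono mult_right_mono) (auto simp: power_le_one intro!: add_nonneg_nonneg mult_nonneg_nonneg)
            finally show "norm (E ?z) \<le> 2 / m * (1 - (norm (\<theta> ?z))\<^sup>2) / \<delta> + norm (D ?z + cnj (D' ?z)) / \<delta>"
              by (simp add: add_divide_distrib)
          qed
          then show ?thesis using True by simp
        qed simp
      qed
    qed simp
    then show ?thesis unfolding eq by simp
  qed
  have est: "norm (2 * pi * \<i> * (\<theta> s - \<theta> s')) \<le> 4 * h * B + 4 * h * (B / \<delta>) + norm (integral {-h..h} (\<lambda>y. E (Complex (\<xi> n) y)))" for n
  proof -
    have "norm (2 * pi * \<i> * (\<theta> s - \<theta> s')) \<le> norm (rect_outer h (\<xi> n) (\<lambda>z. \<theta> z * D z)) + norm (cnj (rect_outer h (\<xi> n) (\<lambda>z. D' z / \<theta> z)))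
        + norm (\<i> * integral {-h..h} (\<lambda>y. E (Complex (\<xi> n) y)))"
      unfolding ident[OF \<xi>[of n]] by (intro order_trans[OF norm_triangle_ineq4] add_mono norm_triangle_ineq4) auto
    also have "\<dots> \<le> 4 * h * B + 4 * h * (B / \<delta>) + norm (integral {-h..h} (\<lambda>y. E (Complex (\<xi> n) y)))"
      using outer[OF \<xi>[of n]] by (intro add_mono) (auto simp: norm_mult)
    finally show ?thesis .
  qed
  have "norm (2 * pi * \<i> * (\<theta> s - \<theta> s')) \<le> 4 * h * B + 4 * h * (B / \<delta>) + norm (0::complex)"
    by (rule LIMSEQ_le_const[OF tendsto_add[OF tendsto_const tendsto_norm[OF lim]]]) (use est in auto)
  then have "2 * pi * norm (\<theta> s - \<theta> s') \<le> 4 * h * B + 4 * h * (B / \<delta>)"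
    unfolding norm_mult by simp
  also have "4 * h * B + 4 * h * (B / \<delta>) = 4 * h * B * (1 + 1 / \<delta>)"
    by (simp add: distrib_left)
  finally have "2 * pi * norm (\<theta> s - \<theta> s') \<le> 4 * h * B * (1 + 1 / \<delta>)" .
  moreover have "1 * norm (\<theta> s - \<theta> s') \<le> 2 * pi * norm (\<theta> s - \<theta> s')"
    using pi_gt3 by (intro mult_right_mono) auto
  ultimately have "norm (\<theta> s - \<theta> s') \<le> 4 * h * B * (1 + 1 / \<delta>)"
    unfolding mult_1 by (rule order_trans[rotated])
  also have "\<dots> = 8 / h * (1 + 1 / \<delta>) * norm (s - s')"
    using h by (simp add: B_def power2_eq_square)
  finally show ?thesis .
qed

lemma AE_lborel_ex_in_interval:
  assumes "AE y in lborel. P y" "a < (b::real)"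
  shows "\<exists>y. a < y \<and> y < b \<and> P y"
proof (rule ccontr)
  assume neg: "\<not> ?thesis"
  have "AE y in lborel. y \<notin> {a<..<b}"
    using assms(1) by eventually_elim (use neg in auto)
  then have "{a<..<b} \<in> null_sets lborel"
    by (subst AE_iff_null_sets) auto
  then show False using assms(2) by (simp add: null_sets_def)
qed

text \<open>
  Compare \<open>\<theta> s\<close> with values near a boundary point \<open>iy\<close> with \<open>0 < y < \<bar>s\<bar>\<close> at which the
  boundary modulus is \<open>1\<close>.
\<close>

lemma inner_function_defect_near_zero:
  assumes inner: "inner_function \<theta>" and h: "h > 0" and \<delta>: "\<delta> > 0"
    and low: "\<And>z. z \<in> rhp \<Longrightarrow> norm z < 2 * h \<Longrightarrow> norm (\<theta> z) \<ge> \<delta>"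
    and s: "s \<in> rhp" "norm s \<le> h / 4"
  shows "1 - norm (\<theta> s) \<le> 16 / h * (1 + 1 / \<delta>) * norm s"
proof -
  let ?C = "8 / h * (1 + 1 / \<delta>)"
  have C0: "?C \<ge> 0" using h \<delta> by simp
  have "0 < norm s" using s by (auto simp: rhp_def)
  then obtain y where y: "0 < y" "y < norm s" "(\<lambda>n. norm (\<theta> (Complex (height n) y))) \<longlonglongrightarrow> 1"
    using AE_lborel_ex_in_interval[OF inner_function_boundary_modulus[OF inner]] by blast
  have "(\<lambda>n. Complex (height n) y) \<longlonglongrightarrow> Complex 0 y"
    by (intro tendsto_intros height_tendsto)
  then have nlim: "(\<lambda>n. norm (Complex (height n) y)) \<longlonglongrightarrow> y"
    using tendsto_norm[of "\<lambda>n. Complex (height n) y" "Complex 0 y"] y(1) by (simp add: complex_norm)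
  have "(\<lambda>n. 1 - norm (\<theta> (Complex (height n) y)) + ?C * (norm s + norm (Complex (height n) y))) \<longlonglongrightarrow> 1 - 1 + ?C * (norm s + y)"
    by (intro tendsto_intros y nlim)
  moreover have "\<forall>\<^sub>F n in sequentially. 1 - norm (\<theta> s) \<le> 1 - norm (\<theta> (Complex (height n) y)) + ?C * (norm s + norm (Complex (height n) y))"
    using order_tendstoD(2)[OF nlim y(2)]
  proof eventually_elim
    case (elim n)
    let ?z = "Complex (height n) y"
    have "norm (\<theta> ?z - \<theta> s) \<le> ?C * norm (?z - s)"
      using elim y(2) s by (intro inner_function_Lipschitz_near_zero[OF inner h \<delta> low]) (auto simp: rhp_def)
    also have "\<dots> \<le> ?C * (norm s + norm ?z)"
      using norm_triangle_ineq4[of ?z s] C0 by (intro mult_left_mono) auto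
    finally show ?case
      using norm_triangle_ineq2[of "\<theta> ?z" "\<theta> s"] by linarith
  qed
  ultimately have "1 - norm (\<theta> s) \<le> 1 - 1 + ?C * (norm s + y)"
    by (intro tendsto_lowerbound) auto
  also have "\<dots> \<le> ?C * (norm s + norm s)"
    using y(2) mult_left_mono[OF _ C0, of "norm s + y" "norm s + norm s"] by simp
  also have "\<dots> = 16 / h * (1 + 1 / \<delta>) * norm s" by simp
  finally show ?thesis .
qed

lemma Liminf_norm_nonzero_imp_eventually_bounded_below:
  assumes "Liminf F (\<lambda>z. ereal (norm (f z))) \<noteq> 0"
  shows "\<exists>\<delta>>0. \<forall>\<^sub>F z in F. \<delta> \<le> norm (f z)"
proof -
  have "0 \<le> Liminf F (\<lambda>z. ereal (norm (f z)))"
    by (rule Liminf_bounded) simp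
  then have "0 < Liminf F (\<lambda>z. ereal (norm (f z)))" using assms by simp
  then obtain c where c: "0 < c" "c < Liminf F (\<lambda>z. ereal (norm (f z)))"
    using dense by blast
  then obtain \<delta> where \<delta>: "c = ereal \<delta>" by (cases c) auto
  have "\<forall>\<^sub>F z in F. c < ereal (norm (f z))"
    by (rule less_LiminfD[OF c(2)])
  then have "\<forall>\<^sub>F z in F. \<delta> \<le> norm (f z)"
    by eventually_elim (simp add: \<delta>)
  then show ?thesis using c(1) \<delta> by auto
qed

lemma zero_notin_spectrum_bounded_below:
  assumes "Some 0 \<notin> inner_spectrum \<theta>"
  shows "\<exists>\<delta>>0. \<exists>h>0. \<forall>z\<in>rhp. norm z < 2 * h \<longrightarrow> norm (\<theta> z) \<ge> \<delta>"
proof -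
  have "(0::complex) \<in> closure rhp"
  proof -
    have "(\<lambda>n. complex_of_real (height n)) \<longlonglongrightarrow> 0"
      using tendsto_of_real[OF height_tendsto] by simp
    moreover have "complex_of_real (height n) \<in> rhp" for n by (simp add: rhp_def)
    ultimately show ?thesis
      unfolding closure_sequential by (intro exI[of _ "\<lambda>n. complex_of_real (height n)"] conjI allI)
  qed
  then have "Liminf (at 0 within rhp) (\<lambda>z. ereal (norm (\<theta> z))) \<noteq> 0"
    using assms by (auto simp: inner_spectrum_def approach_rhp_def)
  then obtain \<delta> where \<delta>: "\<delta> > 0" "\<forall>\<^sub>F z in at 0 within rhp. \<delta> \<le> norm (\<theta> z)"
    using Liminf_norm_nonzero_imp_eventually_bounded_below by blast
  then obtain d where d: "d > 0" "\<And>z. z \<in> rhp \<Longrightarrow> z \<noteq> 0 \<Longrightarrow> dist z 0 < d \<Longrightarrow> \<delta> \<le> norm (\<theta> z)"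
    unfolding eventually_at by blast
  have "\<forall>z\<in>rhp. norm z < 2 * (d / 2) \<longrightarrow> \<delta> \<le> norm (\<theta> z)"
  proof (intro ballI impI)
    fix z assume z: "z \<in> rhp" "norm z < 2 * (d / 2)"
    moreover from z have "z \<noteq> 0" by (auto simp: rhp_def)
    ultimately show "\<delta> \<le> norm (\<theta> z)" by (intro d(2)) auto
  qed
  then show ?thesis using \<delta>(1) half_gt_zero[OF d(1)] by blast
qed

lemma infinity_notin_spectrum_bounded_below:
  assumes "None \<notin> inner_spectrum \<theta>"
  shows "\<exists>\<delta>>0. \<exists>h>0. \<forall>z\<in>rhp. norm z < 2 * h \<longrightarrow> norm (\<theta> (1 / z)) \<ge> \<delta>"
proof -
  have "Liminf (inf at_infinity (principal rhp)) (\<lambda>z. ereal (norm (\<theta> z))) \<noteq> 0"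
    using assms by (auto simp: inner_spectrum_def approach_rhp_def)
  then obtain \<delta> where \<delta>: "\<delta> > 0" "\<forall>\<^sub>F z in inf at_infinity (principal rhp). \<delta> \<le> norm (\<theta> z)"
    using Liminf_norm_nonzero_imp_eventually_bounded_below by blast
  then obtain b where b: "\<And>z. norm z \<ge> b \<Longrightarrow> z \<in> rhp \<Longrightarrow> \<delta> \<le> norm (\<theta> z)"
    unfolding eventually_inf_principal eventually_at_infinity by blast
  define B where "B = max b 1"
  have B0: "B > 0" by (simp add: B_def)
  have "\<delta> \<le> norm (\<theta> (1 / z))" if z: "z \<in> rhp" "norm z < 2 * (1 / (2 * B))" for z
  proof -
    have z0: "norm z > 0" using z by (auto simp: rhp_def)
    have "norm (1 / z) \<ge> B"
      using z z0 B0 by (simp add: norm_divide field_simps)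
    moreover have "1 / z \<in> rhp"
      using z by (auto simp: rhp_def Re_divide intro!: divide_pos_pos add_pos_nonneg)
    ultimately show "\<delta> \<le> norm (\<theta> (1 / z))" by (intro b) (auto simp: B_def)
  qed
  moreover have "1 / (2 * B) > 0" using B0 by simp
  ultimately show ?thesis using \<delta>(1) by blast
qed

lemma bounded_holomorphic_vertical_Lipschitz:
  assumes hol: "\<theta> holomorphic_on rhp" and le1: "\<forall>z\<in>rhp. norm (\<theta> z) \<le> 1" and a: "a > 0"
  shows "norm (\<theta> (Complex a u) - \<theta> (Complex a v)) \<le> 2 / a * \<bar>u - v\<bar>"
proof -
  let ?S = "{z. a \<le> Re z}"
  have "norm (\<theta> (Complex a u) - \<theta> (Complex a v)) \<le> 2 / a * norm (Complex a u - Complex a v)"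
  proof (rule field_differentiable_bound[where S="?S" and f'="deriv \<theta>"])
    show "convex ?S" by (rule convex_halfspace_Re_ge)
    fix z assume "z \<in> ?S"
    then have z: "a \<le> Re z" by simp
    then have zr: "z \<in> rhp" using a by (simp add: rhp_def)
    show "(\<theta> has_field_derivative deriv \<theta> z) (at z within ?S)"
      by (rule has_field_derivative_at_within[OF holomorphic_derivI[OF hol open_rhp zr]])
    have sub: "cball z (a / 2) \<subseteq> rhp"
    proof
      fix v assume "v \<in> cball z (a / 2)"
      then have "\<bar>Re (z - v)\<bar> \<le> a / 2"
        using abs_Re_le_cmod[of "z - v"] by (simp add: dist_norm)
      then have "Re v > 0" using z a unfolding minus_complex.sel by linarith
      then show "v \<in> rhp" by (simp add: rhp_def)
    qed
    have "norm ((deriv ^^ 1) \<theta> z) \<le> fact 1 * 1 / (a / 2) ^ 1"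
    proof (rule Cauchy_inequality)
      show "\<theta> holomorphic_on ball z (a / 2)"
        using hol sub ball_subset_cball by (blast intro: holomorphic_on_subset)
      show "continuous_on (cball z (a / 2)) \<theta>"
        using hol sub by (blast intro: holomorphic_on_imp_continuous_on holomorphic_on_subset)
      show "norm (\<theta> x) \<le> 1" if "norm (z - x) = a / 2" for x
        using le1 sub that by (auto simp: dist_norm)
    qed (use a in auto)
    then show "norm (deriv \<theta> z) \<le> 2 / a" by simp
  qed (use a in auto)
  also have "Complex a u - Complex a v = Complex 0 (u - v)" by (simp add: complex_eq_iff)
  finally show ?thesis by (simp add: complex_norm)
qed

text \<open>
  The image of a null set that avoids \<open>0\<close> under \<open>y \<mapsto> - 1 / y\<close> is null, because this map is
  differentiable there.
\<close>

lemma AE_lborel_negative_reciprocal: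
  assumes "AE y in lborel. P (y::real)"
  shows "AE y in lborel. P (- 1 / y)"
proof -
  obtain N where N: "N \<in> null_sets lborel" "{y. \<not> P y} \<subseteq> N"
    using assms unfolding eventually_ae_filter by auto
  have "N \<in> null_sets lebesgue" by (rule null_sets_completionI[OF N(1)])
  then have "negligible N" by (simp only: negligible_iff_null_sets)
  then have "negligible (N - {0})" by (rule negligible_subset) auto
  then have "negligible ((\<lambda>y. - 1 / y) ` (N - {0}))"
    by (rule negligible_differentiable_image_negligible[OF order_refl])
      (auto intro!: derivative_intros differentiable_at_imp_differentiable_on)
  then have "negligible (insert 0 ((\<lambda>y. - 1 / y) ` (N - {0})))"
    by (simp add: negligible_insert)
  then have "AE y in lebesgue. y \<notin> insert 0 ((\<lambda>y. - 1 / y) ` (N - {0}))"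
    unfolding negligible_iff_null_sets by (rule AE_not_in)
  then have "AE y in lborel. y \<notin> insert 0 ((\<lambda>y. - 1 / y) ` (N - {0}))"
    by (simp add: AE_completion_iff)
  then show ?thesis
  proof eventually_elim
    case (elim y)
    then have "y \<noteq> 0" by auto
    have "- 1 / y \<notin> N"
    proof
      assume "- 1 / y \<in> N"
      then have "- 1 / (- 1 / y) \<in> (\<lambda>y. - 1 / y) ` (N - {0})"
        using \<open>y \<noteq> 0\<close> by (intro imageI) auto
      moreover have "- 1 / (- 1 / y) = y" by simp
      ultimately show False using elim by simp
    qed
    then show ?case using N(2) by blast
  qed
qed

text \<open>
  Inversion maps the horizontal line through \<open>iy\<close> to a curve that ends at \<open>- i / y\<close>. At abscissa \<open>a\<close> this curve
  deviates from the horizontal line through its end point by \<open>O(a\<^sup>2)\<close>. By Cauchy's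
  estimate \<open>\<bar>\<theta>'\<bar> = O(1 / a)\<close> on the vertical line between them, so the limits along the two curves agree.
\<close>

lemma inner_function_inversion:
  assumes inner: "inner_function \<theta>"
  shows "inner_function (\<lambda>z. \<theta> (1 / z))"
proof -
  have hol: "\<theta> holomorphic_on rhp" by (rule inner_function_holomorphic[OF inner])
  have le1: "\<forall>z\<in>rhp. norm (\<theta> z) \<le> 1" using inner_function_norm_le_1[OF inner] by blast
  have inv: "1 / z \<in> rhp" if "z \<in> rhp" for z
    using that by (auto simp: rhp_def Re_divide intro!: divide_pos_pos add_pos_nonneg)
  have "(\<theta> \<circ> (\<lambda>z. 1 / z)) holomorphic_on rhp"
  proof (rule holomorphic_on_compose_gen[OF _ hol])
    show "(\<lambda>z. 1 / z) holomorphic_on rhp"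
      by (intro holomorphic_intros) (auto simp: rhp_def)
    show "(\<lambda>z. 1 / z) ` rhp \<subseteq> rhp" using inv by blast
  qed
  then have hol': "(\<lambda>z. \<theta> (1 / z)) holomorphic_on rhp" by (simp add: comp_def)
  have bdd: "bounded ((\<lambda>z. \<theta> (1 / z)) ` rhp)"
    unfolding bounded_iff
  proof (intro exI[of _ 1] ballI)
    fix v assume "v \<in> (\<lambda>z. \<theta> (1 / z)) ` rhp"
    then obtain z where "z \<in> rhp" "v = \<theta> (1 / z)" by blast
    then show "norm v \<le> 1" using le1 inv[of z] by blast
  qed
  have "AE y in lborel. \<exists>l. ((\<lambda>x. \<theta> (Complex x (- 1 / y))) \<longlongrightarrow> l) (at_right 0) \<and> norm l = 1"
    using inner by (intro AE_lborel_negative_reciprocal[of "\<lambda>u. \<exists>l. ((\<lambda>x. \<theta> (Complex x u)) \<longlongrightarrow> l) (at_right 0) \<and> norm l = 1"])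
      (simp add: inner_function_def)
  moreover have "AE y in lborel. (y::real) \<noteq> 0"
    using AE_lborel_singleton[of 0] by simp
  ultimately have "AE y in lborel. \<exists>l. ((\<lambda>x. \<theta> (1 / Complex x y)) \<longlongrightarrow> l) (at_right 0) \<and> norm l = 1"
  proof eventually_elim
    case (elim y)
    then obtain l where l: "((\<lambda>x. \<theta> (Complex x (- 1 / y))) \<longlongrightarrow> l) (at_right 0)" "norm l = 1" and y: "y \<noteq> 0"
      by blast
    define a where "a = (\<lambda>x. x / (x\<^sup>2 + y\<^sup>2))"
    have apos: "a x > 0" if "x > 0" for x
      using that y by (auto simp: a_def intro!: divide_pos_pos add_pos_nonneg)
    have alim: "filterlim a (at_right 0) (at_right 0)"
    proof (rule tendsto_imp_filterlim_at_right)
      have "(a \<longlongrightarrow> 0 / (0\<^sup>2 + y\<^sup>2)) (at_right 0)"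
        unfolding a_def using y by (intro tendsto_intros) auto
      then show "(a \<longlongrightarrow> 0) (at_right 0)" by simp
      show "\<forall>\<^sub>F x in at_right 0. a x > 0"
        unfolding eventually_at_right_field using apos by (intro exI[of _ 1]) auto
    qed
    have 1: "((\<lambda>x. \<theta> (Complex (a x) (- 1 / y))) \<longlongrightarrow> l) (at_right 0)"
      by (rule filterlim_compose[OF l(1) alim])
    have "((\<lambda>x. \<theta> (1 / Complex x y) - \<theta> (Complex (a x) (- 1 / y))) \<longlongrightarrow> 0) (at_right 0)"
    proof (rule Lim_null_comparison)
      have "((\<lambda>x. 2 * x / \<bar>y\<bar>) \<longlongrightarrow> 2 * 0 / \<bar>y\<bar>) (at_right 0)"
        using y by (intro tendsto_intros) auto
      then show "((\<lambda>x. 2 * x / \<bar>y\<bar>) \<longlongrightarrow> 0) (at_right 0)" by simp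
      have "norm (\<theta> (1 / Complex x y) - \<theta> (Complex (a x) (- 1 / y))) \<le> 2 * x / \<bar>y\<bar>" if x: "x > 0" for x
      proof -
        have pos: "x\<^sup>2 + y\<^sup>2 > 0" using x by (auto intro: add_pos_nonneg)
        have eq: "1 / Complex x y = Complex (a x) (- y / (x\<^sup>2 + y\<^sup>2))"
          by (simp add: complex_eq_iff a_def Re_divide Im_divide)
        have "- y / (x\<^sup>2 + y\<^sup>2) - (- 1 / y) = x\<^sup>2 / (y * (x\<^sup>2 + y\<^sup>2))"
          using y pos by (simp add: field_simps power2_eq_square)
        then have d: "\<bar>- y / (x\<^sup>2 + y\<^sup>2) - (- 1 / y)\<bar> = x\<^sup>2 / (\<bar>y\<bar> * (x\<^sup>2 + y\<^sup>2))"
          using pos by (simp add: abs_mult)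
        have "norm (\<theta> (1 / Complex x y) - \<theta> (Complex (a x) (- 1 / y))) \<le> 2 / a x * \<bar>- y / (x\<^sup>2 + y\<^sup>2) - (- 1 / y)\<bar>"
          unfolding eq by (rule bounded_holomorphic_vertical_Lipschitz[OF hol le1 apos[OF x]])
        also have "\<dots> = 2 * x / \<bar>y\<bar>"
        proof -
          have "2 / (x / q) * (x * x / (u * q)) = 2 * x / u" if "q \<noteq> 0" "u \<noteq> 0" for q u :: real
            using that x by (simp add: field_simps)
          from this[of "x\<^sup>2 + y\<^sup>2" "\<bar>y\<bar>"] show ?thesis
            unfolding d a_def using y pos by (simp add: power2_eq_square[of x])
        qed
        finally show ?thesis .
      qed
      then show "\<forall>\<^sub>F x in at_right 0. norm (\<theta> (1 / Complex x y) - \<theta> (Complex (a x) (- 1 / y))) \<le> 2 * x / \<bar>y\<bar>"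
        unfolding eventually_at_right_field by (intro exI[of _ 1]) auto
    qed
    from tendsto_add[OF this 1] l(2) show ?case by auto
  qed
  then show ?thesis using hol' bdd by (simp add: inner_function_def)
qed

section \<open>A Hilbert-type inequality\<close>

text \<open>
  The integral that drives the Schur test for the kernel \<open>1 / (w + v)\<close> with the weight \<open>1 / sqrt w\<close>.
\<close>

lemma nn_integral_sqrt_kernel_le:
  fixes N v :: real
  assumes N: "N > 0" and v: "v > 0"
  shows "(\<integral>\<^sup>+w. ennreal (1 / (sqrt w * (w + v))) * indicator {N..} w \<partial>lborel) \<le> ennreal (pi / sqrt v)"
proof -
  let ?F = "\<lambda>w. 2 / sqrt v * arctan (sqrt w / sqrt v)"
  have "(\<integral>\<^sup>+w. ennreal (1 / (sqrt w * (w + v))) * indicator {N..} w \<partial>lborel) = ennreal (pi / sqrt v - ?F N)"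
  proof (rule nn_integral_FTC_atLeast)
    show "(\<lambda>w. 1 / (sqrt w * (w + v))) \<in> borel_measurable borel" by measurable
    fix w assume "N \<le> w"
    then have w: "w > 0" using N by simp
    show "0 \<le> 1 / (sqrt w * (w + v))" using w v by simp
    have "((\<lambda>w. 2 / c * arctan (sqrt w / c)) has_real_derivative 2 / c * (inverse (1 + (sqrt w / c)\<^sup>2) * (inverse (sqrt w) / 2 / c))) (at w)"
      if "c > 0" for c
      using w that by (auto intro!: derivative_eq_intros)
    from this[of "sqrt v"] have "(?F has_real_derivative 2 / sqrt v * (inverse (1 + (sqrt w / sqrt v)\<^sup>2) * (inverse (sqrt w) / 2 / sqrt v))) (at w)"
      using v by simp
    moreover have "2 / sqrt v * (inverse (1 + (sqrt w / sqrt v)\<^sup>2) * (inverse (sqrt w) / 2 / sqrt v)) = 1 / (sqrt w * (w + v))"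
    proof -
      have "2 / q * (inverse (1 + (p / q)\<^sup>2) * (inverse p / 2 / q)) = 1 / (p * (p\<^sup>2 + q\<^sup>2))"
        if "p > 0" "q > 0" for p q :: real
      proof -
        have "1 + (p / q)\<^sup>2 = (p\<^sup>2 + q\<^sup>2) / q\<^sup>2" using that by (simp add: field_simps)
        moreover have "2 / q * (inverse (X / q\<^sup>2) * (inverse p / 2 / q)) = 1 / (p * X)" if "X > 0" for X
          using that \<open>p > 0\<close> \<open>q > 0\<close> by (simp add: field_simps power2_eq_square)
        moreover have "p\<^sup>2 + q\<^sup>2 > 0" using that by (simp add: add_pos_pos)
        ultimately show ?thesis by simp
      qed
      from this[of "sqrt w" "sqrt v"] show ?thesis using w v by simp
    qed
    ultimately show "(?F has_real_derivative 1 / (sqrt w * (w + v))) (at w)" by simp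
  next
    have "((\<lambda>w. 2 / c * arctan (sqrt w / c)) \<longlongrightarrow> pi / c) at_top" if "c > 0" for c :: real
      using that by (real_asymp simp: field_simps)
    then show "(?F \<longlongrightarrow> pi / sqrt v) at_top" using v by simp
  qed
  also have "\<dots> \<le> ennreal (pi / sqrt v)"
    using N v by (intro ennreal_leI) (simp add: arctan_le_zero_iff)
  finally show ?thesis .
qed

lemma nn_integral_sqrt_kernel_abs_le:
  fixes N r :: real
  assumes N: "N > 0" and r: "r > 0"
  shows "(\<integral>\<^sup>+y. ennreal (1 / (sqrt (N + \<bar>y\<bar>) * (r + (N + \<bar>y\<bar>)))) \<partial>lborel) \<le> ennreal (2 * pi / sqrt r)"
proof -
  define g where "g = (\<lambda>w. ennreal (1 / (sqrt w * (w + r))) * indicator {N..} w)"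
  have [measurable]: "g \<in> borel_measurable borel" unfolding g_def by measurable
  have "(\<integral>\<^sup>+y. ennreal (1 / (sqrt (N + \<bar>y\<bar>) * (r + (N + \<bar>y\<bar>)))) \<partial>lborel) \<le> (\<integral>\<^sup>+y. g (N + 1 * y) + g (N + (-1) * y) \<partial>lborel)"
  proof (rule nn_integral_mono)
    fix y :: real
    have e: "ennreal (1 / (sqrt (N + \<bar>y\<bar>) * (r + (N + \<bar>y\<bar>)))) = g (N + \<bar>y\<bar>)"
      by (simp add: g_def add.commute[of r])
    show "ennreal (1 / (sqrt (N + \<bar>y\<bar>) * (r + (N + \<bar>y\<bar>)))) \<le> g (N + 1 * y) + g (N + (-1) * y)"
      unfolding e by (cases "y \<ge> 0") (auto intro: add_increasing add_increasing2)
  qed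
  also have "\<dots> = (\<integral>\<^sup>+y. g (N + 1 * y) \<partial>lborel) + (\<integral>\<^sup>+y. g (N + (-1) * y) \<partial>lborel)"
    by (rule nn_integral_add) measurable
  also have "(\<integral>\<^sup>+y. g (N + 1 * y) \<partial>lborel) = (\<integral>\<^sup>+w. g w \<partial>lborel)"
    using nn_integral_real_affine[of g 1 N] by simp
  also have "(\<integral>\<^sup>+y. g (N + (-1) * y) \<partial>lborel) = (\<integral>\<^sup>+w. g w \<partial>lborel)"
    using nn_integral_real_affine[of g "-1" N] by simp
  also have "(\<integral>\<^sup>+w. g w \<partial>lborel) + (\<integral>\<^sup>+w. g w \<partial>lborel) \<le> ennreal (pi / sqrt r) + ennreal (pi / sqrt r)"
    unfolding g_def by (intro add_mono nn_integral_sqrt_kernel_le N r)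
  also have "\<dots> = ennreal (2 * pi / sqrt r)"
    using r by (subst ennreal_plus[symmetric]) auto
  finally show ?thesis .
qed

text \<open>
  The operator with the homogeneous kernel \<open>1 / (r + v)\<close>, where \<open>v = N + \<bar>y\<bar>\<close>. The shift by \<open>N\<close> keeps the variable \<open>v\<close>
  in the range \<open>v \<ge> N\<close> of \<open>r\<close>, away from the singularity of the weight at \<open>0\<close>.
\<close>

definition hilbert_operator :: "real \<Rightarrow> (real \<Rightarrow> real) \<Rightarrow> real \<Rightarrow> ennreal" where
  "hilbert_operator N \<phi> r = (\<integral>\<^sup>+y. ennreal (\<phi> y / (r + (N + \<bar>y\<bar>))) \<partial>lborel)"

lemma hilbert_operator_measurable [measurable]:
  assumes [measurable]: "\<phi> \<in> borel_measurable borel"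
  shows "hilbert_operator N \<phi> \<in> borel_measurable borel"
  unfolding hilbert_operator_def by measurable

text \<open>
  The Cauchy-Schwarz step of the Schur test: the kernel is split as
  \<open>a b\<close> with \<open>a\<^sup>2 = v powr (-1/2) / (r + v)\<close> and \<open>b\<^sup>2 = v powr (1/2) / (r + v)\<close>.
\<close>

lemma hilbert_operator_sq_le:
  fixes \<phi> :: "real \<Rightarrow> real"
  assumes [measurable]: "\<phi> \<in> borel_measurable borel" and nn: "\<And>y. \<phi> y \<ge> 0" and N: "N > 0" and r: "r > 0"
  shows "(hilbert_operator N \<phi> r)\<^sup>2 \<le> ennreal (2 * pi / sqrt r) *
    (\<integral>\<^sup>+y. ennreal ((\<phi> y)\<^sup>2) * ennreal (sqrt (N + \<bar>y\<bar>) / (r + (N + \<bar>y\<bar>))) \<partial>lborel)"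
proof -
  define a where "a = (\<lambda>y. sqrt (1 / (sqrt (N + \<bar>y\<bar>) * (r + (N + \<bar>y\<bar>)))))"
  define b where "b = (\<lambda>y. \<phi> y * sqrt (sqrt (N + \<bar>y\<bar>) / (r + (N + \<bar>y\<bar>))))"
  have v: "N + \<bar>y\<bar> > 0" "r + (N + \<bar>y\<bar>) > 0" for y using N r by auto
  have [measurable]: "a \<in> borel_measurable borel" "b \<in> borel_measurable borel"
    unfolding a_def b_def by measurable
  have ab0: "a y \<ge> 0" "b y \<ge> 0" for y using v[of y] nn[of y] by (auto simp: a_def b_def)
  have ab: "\<phi> y / (r + (N + \<bar>y\<bar>)) = a y * b y" for y
  proof -
    have "a y * b y = \<phi> y * sqrt (1 / (sqrt (N + \<bar>y\<bar>) * (r + (N + \<bar>y\<bar>))) * (sqrt (N + \<bar>y\<bar>) / (r + (N + \<bar>y\<bar>))))"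
      unfolding a_def b_def real_sqrt_mult by simp
    also have "1 / (sqrt (N + \<bar>y\<bar>) * (r + (N + \<bar>y\<bar>))) * (sqrt (N + \<bar>y\<bar>) / (r + (N + \<bar>y\<bar>))) = (1 / (r + (N + \<bar>y\<bar>)))\<^sup>2"
      using v[of y] by (simp add: power2_eq_square)
    finally show ?thesis using v[of y] by simp
  qed
  have "(hilbert_operator N \<phi> r)\<^sup>2 = (\<integral>\<^sup>+y. ennreal (a y) * ennreal (b y) \<partial>lborel)\<^sup>2"
    unfolding hilbert_operator_def ab using ab0 by (simp add: ennreal_mult')
  also have "\<dots> \<le> (\<integral>\<^sup>+y. ennreal (a y) ^ 2 \<partial>lborel) * (\<integral>\<^sup>+y. ennreal (b y) ^ 2 \<partial>lborel)"
    by (rule Cauchy_Schwarz_nn_integral) auto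
  also have "(\<integral>\<^sup>+y. ennreal (a y) ^ 2 \<partial>lborel) = (\<integral>\<^sup>+y. ennreal (1 / (sqrt (N + \<bar>y\<bar>) * (r + (N + \<bar>y\<bar>)))) \<partial>lborel)"
  proof (rule nn_integral_cong)
    fix y
    have "(a y)\<^sup>2 = 1 / (sqrt (N + \<bar>y\<bar>) * (r + (N + \<bar>y\<bar>)))"
      unfolding a_def using v[of y] by (intro real_sqrt_pow2) auto
    then show "ennreal (a y) ^ 2 = ennreal (1 / (sqrt (N + \<bar>y\<bar>) * (r + (N + \<bar>y\<bar>))))"
      using ab0(1)[of y] by (simp only: ennreal_power)
  qed
  also have "(\<integral>\<^sup>+y. ennreal (b y) ^ 2 \<partial>lborel) = (\<integral>\<^sup>+y. ennreal ((\<phi> y)\<^sup>2) * ennreal (sqrt (N + \<bar>y\<bar>) / (r + (N + \<bar>y\<bar>))) \<partial>lborel)"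
  proof (rule nn_integral_cong)
    fix y
    have "(b y)\<^sup>2 = (\<phi> y)\<^sup>2 * (sqrt (N + \<bar>y\<bar>) / (r + (N + \<bar>y\<bar>)))"
      unfolding b_def power_mult_distrib using v[of y] by (subst real_sqrt_pow2) auto
    then show "ennreal (b y) ^ 2 = ennreal ((\<phi> y)\<^sup>2) * ennreal (sqrt (N + \<bar>y\<bar>) / (r + (N + \<bar>y\<bar>)))"
      using ab0(2)[of y] by (simp only: ennreal_power ennreal_mult'[symmetric] zero_le_power2)
  qed
  finally show ?thesis
    by (rule order_trans[OF _ mult_right_mono[OF nn_integral_sqrt_kernel_abs_le[OF N r]]]) simp
qed

lemma Hilbert_inequality:
  fixes \<phi> :: "real \<Rightarrow> real"
  assumes [measurable]: "\<phi> \<in> borel_measurable borel" and nn: "\<And>y. \<phi> y \<ge> 0" and N: "N > 0"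
  shows "(\<integral>\<^sup>+r. (hilbert_operator N \<phi> r)\<^sup>2 * indicator {N..} r \<partial>lborel) \<le> ennreal (2 * pi\<^sup>2) * (\<integral>\<^sup>+y. ennreal ((\<phi> y)\<^sup>2) \<partial>lborel)"
proof -
  have v: "N + \<bar>y\<bar> > 0" for y using N by auto
  let ?k = "\<lambda>r y. ennreal (2 * pi / sqrt r) * (ennreal ((\<phi> y)\<^sup>2) * ennreal (sqrt (N + \<bar>y\<bar>) / (r + (N + \<bar>y\<bar>)))) * indicator {N..} r"
  have "(\<integral>\<^sup>+r. (hilbert_operator N \<phi> r)\<^sup>2 * indicator {N..} r \<partial>lborel) \<le> (\<integral>\<^sup>+r. \<integral>\<^sup>+y. ?k r y \<partial>lborel \<partial>lborel)"
  proof (rule nn_integral_mono)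
    fix r :: real
    show "(hilbert_operator N \<phi> r)\<^sup>2 * indicator {N..} r \<le> (\<integral>\<^sup>+y. ?k r y \<partial>lborel)"
    proof (cases "r \<in> {N..}")
      case True
      then have "r > 0" using N by simp
      from hilbert_operator_sq_le[OF assms(1) nn N this] True show ?thesis
        by (simp add: nn_integral_cmult)
    qed simp
  qed
  also have "\<dots> = (\<integral>\<^sup>+y. \<integral>\<^sup>+r. ?k r y \<partial>lborel \<partial>lborel)"
    by (rule lborel_pair.Fubini'[symmetric]) measurable
  also have "\<dots> \<le> (\<integral>\<^sup>+y. ennreal (2 * pi\<^sup>2) * ennreal ((\<phi> y)\<^sup>2) \<partial>lborel)"
  proof (rule nn_integral_mono)
    fix y :: real
    let ?v = "N + \<bar>y\<bar>"
    have "(\<integral>\<^sup>+r. ?k r y \<partial>lborel) = (\<integral>\<^sup>+r. ennreal (2 * pi * (\<phi> y)\<^sup>2 * sqrt ?v) * (ennreal (1 / (sqrt r * (r + ?v))) * indicator {N..} r) \<partial>lborel)"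
    proof (rule nn_integral_cong)
      fix r :: real
      show "?k r y = ennreal (2 * pi * (\<phi> y)\<^sup>2 * sqrt ?v) * (ennreal (1 / (sqrt r * (r + ?v))) * indicator {N..} r)"
      proof (cases "r \<in> {N..}")
        case True
        then have r: "r > 0" using N by simp
        have "ennreal (2 * pi / sqrt r) * (ennreal ((\<phi> y)\<^sup>2) * ennreal (sqrt ?v / (r + ?v))) = ennreal (2 * pi / sqrt r * ((\<phi> y)\<^sup>2 * (sqrt ?v / (r + ?v))))"
          using r v[of y] by (simp only: ennreal_mult'[symmetric] zero_le_power2 divide_nonneg_pos real_sqrt_gt_zero mult_nonneg_nonneg pi_ge_zero zero_le_numeral)
        also have "2 * pi / sqrt r * ((\<phi> y)\<^sup>2 * (sqrt ?v / (r + ?v))) = 2 * pi * (\<phi> y)\<^sup>2 * sqrt ?v * (1 / (sqrt r * (r + ?v)))"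
          by simp
        also have "ennreal \<dots> = ennreal (2 * pi * (\<phi> y)\<^sup>2 * sqrt ?v) * ennreal (1 / (sqrt r * (r + ?v)))"
          using v[of y] by (intro ennreal_mult') auto
        finally show ?thesis using True by simp
      qed simp
    qed
    also have "\<dots> = ennreal (2 * pi * (\<phi> y)\<^sup>2 * sqrt ?v) * (\<integral>\<^sup>+r. ennreal (1 / (sqrt r * (r + ?v))) * indicator {N..} r \<partial>lborel)"
      by (rule nn_integral_cmult) measurable
    also have "\<dots> \<le> ennreal (2 * pi * (\<phi> y)\<^sup>2 * sqrt ?v) * ennreal (pi / sqrt ?v)"
      by (intro mult_left_mono nn_integral_sqrt_kernel_le N v) auto
    also have "\<dots> = ennreal (2 * pi * (\<phi> y)\<^sup>2 * sqrt ?v * (pi / sqrt ?v))"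
      using v[of y] by (intro ennreal_mult'[symmetric]) auto
    also have "2 * pi * (\<phi> y)\<^sup>2 * sqrt ?v * (pi / sqrt ?v) = 2 * pi\<^sup>2 * (\<phi> y)\<^sup>2"
      using v[of y] by (simp add: power2_eq_square[of pi])
    also have "ennreal \<dots> = ennreal (2 * pi\<^sup>2) * ennreal ((\<phi> y)\<^sup>2)"
      by (intro ennreal_mult') auto
    finally show "(\<integral>\<^sup>+r. ?k r y \<partial>lborel) \<le> ennreal (2 * pi\<^sup>2) * ennreal ((\<phi> y)\<^sup>2)" .
  qed
  also have "\<dots> = ennreal (2 * pi\<^sup>2) * (\<integral>\<^sup>+y. ennreal ((\<phi> y)\<^sup>2) \<partial>lborel)"
    by (rule nn_integral_cmult) measurable
  finally show ?thesis .
qed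

lemma hilbert_operator_le_double:
  assumes nn: "\<And>y. \<phi> y \<ge> 0" and meas[measurable]: "\<phi> \<in> borel_measurable borel" and N: "N > 0" and r: "0 < r" "r \<le> w" "w \<le> 2 * r"
  shows "hilbert_operator N \<phi> r \<le> 2 * hilbert_operator N \<phi> w"
proof -
  have "hilbert_operator N \<phi> r \<le> (\<integral>\<^sup>+y. 2 * ennreal (\<phi> y / (w + (N + \<bar>y\<bar>))) \<partial>lborel)"
    unfolding hilbert_operator_def
  proof (rule nn_integral_mono)
    fix y
    have "\<phi> y / (r + (N + \<bar>y\<bar>)) \<le> \<phi> y / ((w + (N + \<bar>y\<bar>)) / 2)"
      using r N nn[of y] by (intro divide_left_mono) (auto intro!: mult_pos_pos add_pos_nonneg)
    also have "\<dots> = 2 * (\<phi> y / (w + (N + \<bar>y\<bar>)))" by simp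
    finally have "ennreal (\<phi> y / (r + (N + \<bar>y\<bar>))) \<le> ennreal (2 * (\<phi> y / (w + (N + \<bar>y\<bar>))))"
      by (rule ennreal_leI)
    also have "\<dots> = 2 * ennreal (\<phi> y / (w + (N + \<bar>y\<bar>)))"
      by (subst ennreal_mult') auto
    finally show "ennreal (\<phi> y / (r + (N + \<bar>y\<bar>))) \<le> 2 * ennreal (\<phi> y / (w + (N + \<bar>y\<bar>)))" .
  qed
  also have "\<dots> = 2 * hilbert_operator N \<phi> w"
    unfolding hilbert_operator_def by (rule nn_integral_cmult) measurable
  finally show ?thesis .
qed

text \<open>
  The value at \<open>r\<close> is comparable to the values on \<open>[r, 2r]\<close>, where \<open>w / (w + r)\<^sup>2\<close> is at least
  \<open>1 / (9r)\<close>; the constant is \<open>36 = 2\<^sup>2 * 9\<close>.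
\<close>

lemma hilbert_operator_sq_le_average:
  assumes nn: "\<And>y. \<phi> y \<ge> 0" and [measurable]: "\<phi> \<in> borel_measurable borel" and N: "N > 0" and r: "N \<le> r"
  shows "(hilbert_operator N \<phi> r)\<^sup>2 \<le> 36 * (\<integral>\<^sup>+w. (hilbert_operator N \<phi> w)\<^sup>2 * ennreal (w / (w + r)\<^sup>2) * indicator {N..} w \<partial>lborel)"
proof -
  let ?H = "hilbert_operator N \<phi>"
  have r0: "r > 0" using N r by simp
  have "(?H r)\<^sup>2 = (?H r)\<^sup>2 * ennreal (1 / r) * emeasure lborel {r..2 * r}"
    using r0 by (simp add: mult.assoc ennreal_mult'[symmetric])
  also have "\<dots> = (\<integral>\<^sup>+w. (?H r)\<^sup>2 * ennreal (1 / r) * indicator {r..2 * r} w \<partial>lborel)"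
    by (rule nn_integral_cmult_indicator[symmetric]) simp
  also have "\<dots> \<le> (\<integral>\<^sup>+w. 36 * ((?H w)\<^sup>2 * ennreal (w / (w + r)\<^sup>2) * indicator {N..} w) \<partial>lborel)"
  proof (rule nn_integral_mono)
    fix w :: real
    show "(?H r)\<^sup>2 * ennreal (1 / r) * indicator {r..2 * r} w \<le> 36 * ((?H w)\<^sup>2 * ennreal (w / (w + r)\<^sup>2) * indicator {N..} w)"
    proof (cases "w \<in> {r..2 * r}")
      case True
      then have w: "r \<le> w" "w \<le> 2 * r" by auto
      have "(?H r)\<^sup>2 \<le> (2 * ?H w)\<^sup>2"
        by (intro power_mono hilbert_operator_le_double nn assms(2) N r0 w) auto
      also have "\<dots> = 4 * (?H w)\<^sup>2" by (simp add: power_mult_distrib)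
      finally have 1: "(?H r)\<^sup>2 \<le> 4 * (?H w)\<^sup>2" .
      have "1 / r = r / (r * r)" using r0 by simp
      also have "\<dots> \<le> w / ((w + r)\<^sup>2 / 9)"
      proof (rule frac_le)
        have "(w + r)\<^sup>2 \<le> (3 * r)\<^sup>2" using w r0 by (intro power_mono) auto
        then show "(w + r)\<^sup>2 / 9 \<le> r * r" by (simp add: power2_eq_square)
        show "0 < (w + r)\<^sup>2 / 9" using w r0 by simp
      qed (use w r0 in auto)
      also have "\<dots> = 9 * (w / (w + r)\<^sup>2)" by simp
      finally have "ennreal (1 / r) \<le> ennreal (9 * (w / (w + r)\<^sup>2))" by (rule ennreal_leI)
      also have "\<dots> = 9 * ennreal (w / (w + r)\<^sup>2)" by (subst ennreal_mult') auto
      finally have "(?H r)\<^sup>2 * ennreal (1 / r) \<le> (4 * (?H w)\<^sup>2) * (9 * ennreal (w / (w + r)\<^sup>2))"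
        by (intro mult_mono 1) auto
      also have "\<dots> = (4 * 9) * ((?H w)\<^sup>2 * ennreal (w / (w + r)\<^sup>2))" by (simp only: mult_ac)
      finally show ?thesis using True r by simp
    qed simp
  qed
  also have "\<dots> = 36 * (\<integral>\<^sup>+w. (?H w)\<^sup>2 * ennreal (w / (w + r)\<^sup>2) * indicator {N..} w \<partial>lborel)"
    by (rule nn_integral_cmult) measurable
  finally show ?thesis .
qed

text \<open>
  Averaging turns the integral over \<open>M\<close> into a double integral. Its inner integral over \<open>M\<close> is
  the tested quantity, and what remains is the Hilbert inequality for Lebesgue measure.
\<close>

proposition hilbert_operator_Carleson:
  assumes nn: "\<And>y. \<phi> y \<ge> 0" and [measurable]: "\<phi> \<in> borel_measurable borel" and N: "N > 0"
    and sf: "sigma_finite_measure M" and \<rho>[measurable]: "\<rho> \<in> borel_measurable M"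
    and \<rho>N: "\<And>s. s \<in> A \<Longrightarrow> \<rho> s \<ge> N" and A[measurable]: "A \<in> sets M"
    and test: "\<And>w. w \<ge> N \<Longrightarrow> (\<integral>\<^sup>+s\<in>A. ennreal (w / (w + \<rho> s)\<^sup>2) \<partial>M) \<le> ennreal c"
  shows "(\<integral>\<^sup>+s\<in>A. (hilbert_operator N \<phi> (\<rho> s))\<^sup>2 \<partial>M) \<le> 36 * ennreal c * (ennreal (2 * pi\<^sup>2) * (\<integral>\<^sup>+y. ennreal ((\<phi> y)\<^sup>2) \<partial>lborel))"
proof -
  interpret M: sigma_finite_measure M by (rule sf)
  interpret P: pair_sigma_finite lborel M ..
  let ?H = "hilbert_operator N \<phi>"
  let ?k = "\<lambda>w s. (?H w)\<^sup>2 * ennreal (w / (w + \<rho> s)\<^sup>2) * indicator {N..} w * indicator A s"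
  have "(\<integral>\<^sup>+s\<in>A. (?H (\<rho> s))\<^sup>2 \<partial>M) \<le> (\<integral>\<^sup>+s. 36 * (\<integral>\<^sup>+w. ?k w s \<partial>lborel) \<partial>M)"
  proof (rule nn_integral_mono)
    fix s
    show "(?H (\<rho> s))\<^sup>2 * indicator A s \<le> 36 * (\<integral>\<^sup>+w. ?k w s \<partial>lborel)"
      using hilbert_operator_sq_le_average[OF nn assms(2) N \<rho>N] by (cases "s \<in> A") auto
  qed
  also have "\<dots> = 36 * (\<integral>\<^sup>+s. \<integral>\<^sup>+w. ?k w s \<partial>lborel \<partial>M)"
    by (rule nn_integral_cmult) measurable
  also have "(\<integral>\<^sup>+s. \<integral>\<^sup>+w. ?k w s \<partial>lborel \<partial>M) = (\<integral>\<^sup>+w. \<integral>\<^sup>+s. ?k w s \<partial>M \<partial>lborel)"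
    by (rule P.Fubini') measurable
  also have "\<dots> \<le> (\<integral>\<^sup>+w. ennreal c * ((?H w)\<^sup>2 * indicator {N..} w) \<partial>lborel)"
  proof (rule nn_integral_mono)
    fix w :: real
    show "(\<integral>\<^sup>+s. ?k w s \<partial>M) \<le> ennreal c * ((?H w)\<^sup>2 * indicator {N..} w)"
    proof (cases "w \<in> {N..}")
      case True
      have "(\<integral>\<^sup>+s. ?k w s \<partial>M) = (\<integral>\<^sup>+s. (?H w)\<^sup>2 * (ennreal (w / (w + \<rho> s)\<^sup>2) * indicator A s) \<partial>M)"
        using True by (simp add: mult.assoc)
      also have "\<dots> = (?H w)\<^sup>2 * (\<integral>\<^sup>+s\<in>A. ennreal (w / (w + \<rho> s)\<^sup>2) \<partial>M)"
        by (rule nn_integral_cmult) measurable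
      also have "\<dots> \<le> (?H w)\<^sup>2 * ennreal c"
        using True by (intro mult_left_mono test) auto
      finally show ?thesis using True by (simp add: mult.commute)
    qed simp
  qed
  also have "\<dots> = ennreal c * (\<integral>\<^sup>+w. (?H w)\<^sup>2 * indicator {N..} w \<partial>lborel)"
    by (rule nn_integral_cmult) measurable
  also have "\<dots> \<le> ennreal c * (ennreal (2 * pi\<^sup>2) * (\<integral>\<^sup>+y. ennreal ((\<phi> y)\<^sup>2) \<partial>lborel))"
    by (intro mult_left_mono Hilbert_inequality nn assms(2) N) auto
  finally show ?thesis
    by (simp add: mult.assoc mult_left_mono)
qed

section \<open>Sectors and the Carleson embedding of the Hardy space\<close>

text \<open>
  The sector enters most arguments only through the comparability of \<open>Re s\<close> and \<open>\<bar>s\<bar>\<close>.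
\<close>

lemma sector_cone:
  assumes "- pi / 2 < \<alpha>" "\<alpha> < \<beta>" "\<beta> < pi / 2"
  shows "\<exists>\<kappa>>0. \<kappa> \<le> 1 \<and> (\<forall>s\<in>sector \<alpha> \<beta>. s \<noteq> 0 \<and> Re s \<ge> \<kappa> * norm s)"
proof (intro exI[of _ "min (cos \<alpha>) (cos \<beta>)"] conjI ballI)
  show "0 < min (cos \<alpha>) (cos \<beta>)" using assms by (simp add: cos_gt_zero_pi)
  show "min (cos \<alpha>) (cos \<beta>) \<le> 1" by (simp add: min.coboundedI1)
  fix s assume "s \<in> sector \<alpha> \<beta>"
  then obtain r \<phi> where s: "s = of_real r * cis \<phi>" "r > 0" "\<alpha> \<le> \<phi>" "\<phi> \<le> \<beta>"
    by (auto simp: sector_def)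
  show "s \<noteq> 0" using s by simp
  have "min (cos \<alpha>) (cos \<beta>) \<le> cos \<phi>"
  proof (cases "\<phi> \<ge> 0")
    case True
    then have "cos \<beta> \<le> cos \<phi>" using s assms by (intro cos_monotone_0_pi_le) auto
    then show ?thesis by simp
  next
    case False
    then have "cos (- \<alpha>) \<le> cos (- \<phi>)" using s assms by (intro cos_monotone_0_pi_le) auto
    then show ?thesis by simp
  qed
  then show "min (cos \<alpha>) (cos \<beta>) * norm s \<le> Re s"
    using s by (simp add: norm_mult mult.commute[of r] mult_right_mono)
qed

text \<open>
  This description makes measurability of the sector evident.
\<close>

lemma sector_eq_Arg:
  assumes "- pi / 2 < \<alpha>" "\<alpha> < \<beta>" "\<beta> < pi / 2"
  shows "sector \<alpha> \<beta> = {s \<in> rhp. \<alpha> \<le> Arg s \<and> Arg s \<le> \<beta>}"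
proof (intro set_eqI iffI)
  fix s assume "s \<in> sector \<alpha> \<beta>"
  then obtain r \<phi> where s: "s = of_real r * cis \<phi>" "r > 0" "\<alpha> \<le> \<phi>" "\<phi> \<le> \<beta>"
    by (auto simp: sector_def)
  have "cos \<phi> > 0" using s assms by (intro cos_gt_zero_pi) auto
  moreover have "Arg s = \<phi>"
    unfolding s(1) using s(2-4) assms by (subst Arg_times_of_real) (auto simp: Arg_cis)
  ultimately show "s \<in> {s \<in> rhp. \<alpha> \<le> Arg s \<and> Arg s \<le> \<beta>}"
    using s by (simp add: rhp_def)
next
  fix s assume s: "s \<in> {s \<in> rhp. \<alpha> \<le> Arg s \<and> Arg s \<le> \<beta>}"
  then have "s \<noteq> 0" by (auto simp: rhp_def)
  then have "s = of_real (norm s) * cis (Arg s)" "norm s > 0"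
    using cis_Arg[of s] by (auto simp: sgn_eq)
  then show "s \<in> sector \<alpha> \<beta>" using s unfolding sector_def by blast
qed

lemma sector_measurable:
  assumes "- pi / 2 < \<alpha>" "\<alpha> < \<beta>" "\<beta> < pi / 2" and sets: "sets \<mu> = sets (restrict_space borel rhp)"
  shows "sector \<alpha> \<beta> \<in> sets \<mu>"
proof -
  have "continuous_on rhp Arg"
    by (intro continuous_at_imp_continuous_on ballI continuous_at_Arg) (auto simp: rhp_def complex_nonpos_Reals_iff)
  then have "Arg \<in> borel_measurable (restrict_space borel rhp)"
    by (rule borel_measurable_continuous_on_restrict)
  then have [measurable]: "Arg \<in> borel_measurable \<mu>"
    using sets by (simp cong: measurable_cong_sets)
  have "{s \<in> space \<mu>. \<alpha> \<le> Arg s \<and> Arg s \<le> \<beta>} \<in> sets \<mu>" by measurable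
  then show ?thesis
    unfolding sector_eq_Arg[OF assms(1-3)] space_measure_rhp[OF sets] .
qed

lemma szego_kernel_cone_bound:
  assumes \<kappa>: "0 < \<kappa>" "\<kappa> \<le> 1" and s: "Re s \<ge> \<kappa> * norm s" "norm s \<ge> N" and N: "N > 0" and x: "x > 0"
  shows "norm (szego_kernel s (Complex x y)) \<le> 8 / \<kappa> * (1 / (norm s + (N + \<bar>y\<bar>)))"
proof -
  let ?d = "norm (Complex x y + cnj s)" and ?r = "norm s"
  have r: "?r > 0" using s N by linarith
  have d1: "?d \<ge> \<kappa> * ?r"
    using abs_Re_le_cmod[of "Complex x y + cnj s"] s(1) x by simp
  have d2: "?d \<ge> \<bar>y\<bar> - ?r"
    using abs_Im_le_cmod[of "Complex x y + cnj s"] abs_Im_le_cmod[of s] by simp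
  have "\<kappa> / 4 * (?r + \<bar>y\<bar>) \<le> ?d"
  proof (cases "\<bar>y\<bar> \<le> 2 * ?r")
    case True
    then have "\<kappa> / 4 * (?r + \<bar>y\<bar>) \<le> \<kappa> / 4 * (4 * ?r)"
      using \<kappa> r by (intro mult_left_mono) auto
    then show ?thesis using d1 by simp
  next
    case False
    have "\<kappa> / 4 * (?r + \<bar>y\<bar>) \<le> 1 / 4 * (?r + \<bar>y\<bar>)"
      using \<kappa> r by (intro mult_right_mono) auto
    also have "1 / 4 * (?r + \<bar>y\<bar>) \<le> \<bar>y\<bar> - ?r" using False r by simp
    finally show ?thesis using d2 by (rule order_trans)
  qed
  moreover have "\<kappa> / 8 * (?r + (N + \<bar>y\<bar>)) \<le> \<kappa> / 4 * (?r + \<bar>y\<bar>)"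
  proof -
    have "\<kappa> / 8 * (?r + (N + \<bar>y\<bar>)) \<le> \<kappa> / 8 * (2 * (?r + \<bar>y\<bar>))"
      using \<kappa> s(2) by (intro mult_left_mono) auto
    moreover have "\<kappa> / 8 * (2 * q) = \<kappa> / 4 * q" for q by simp
    ultimately show ?thesis by metis
  qed
  ultimately have le: "\<kappa> / 8 * (?r + (N + \<bar>y\<bar>)) \<le> ?d" by linarith
  have "norm (szego_kernel s (Complex x y)) = 1 / ?d"
    by (simp add: szego_kernel_def norm_divide)
  also have "\<dots> \<le> 1 / (\<kappa> / 8 * (?r + (N + \<bar>y\<bar>)))"
  proof (rule frac_le[OF _ order_refl _ le])
    have "?r + (N + \<bar>y\<bar>) > 0" using r N by linarith
    then show "0 < \<kappa> / 8 * (?r + (N + \<bar>y\<bar>))" using \<kappa> by simp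
  qed simp
  finally show ?thesis by simp
qed

lemma hardy2_le_hilbert_operator:
  assumes f: "f \<in> hardy2" and \<kappa>: "0 < \<kappa>" "\<kappa> \<le> 1" and s: "Re s \<ge> \<kappa> * norm s" "norm s \<ge> N" and N: "N > 0" and x: "x > 0"
  shows "ennreal (norm (f (of_real (2 * x) + s))) \<le> ennreal (2 / \<kappa>) * hilbert_operator N (\<lambda>y. norm (f (Complex x y))) (norm s)"
proof -
  have "norm s > 0" using s N by linarith
  then have Res: "Re s > 0" using s(1) \<kappa> by (metis less_le_trans mult_pos_pos)
  let ?k = "szego_kernel s"
  have [measurable]: "(\<lambda>y. f (Complex x y)) \<in> borel_measurable borel"
    by (rule holomorphic_line_measurable[OF hardy2_holomorphic[OF f] x])
  have int: "integrable lborel (\<lambda>y. norm (f (Complex x y) * cnj (?k (Complex x y))))"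
    by (intro integrable_norm hardy2_line_pairing(1)[OF f szego_kernel_hardy2[OF Res] x])
  have "2 * pi * norm (f (of_real (2 * x) + s)) = norm (line_pairing f ?k x)"
    unfolding hardy2_pairing_szego_kernel[OF f x Res] by (simp add: norm_mult)
  also have "\<dots> \<le> (\<integral>y. norm (f (Complex x y) * cnj (?k (Complex x y))) \<partial>lborel)"
    unfolding line_pairing_def by (rule integral_norm_bound)
  finally have "ennreal (2 * pi * norm (f (of_real (2 * x) + s))) \<le> ennreal (\<integral>y. norm (f (Complex x y) * cnj (?k (Complex x y))) \<partial>lborel)"
    by (rule ennreal_leI)
  also have "\<dots> = (\<integral>\<^sup>+y. ennreal (norm (f (Complex x y) * cnj (?k (Complex x y)))) \<partial>lborel)"
    by (rule nn_integral_eq_integral[symmetric, OF int]) auto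
  also have "\<dots> \<le> (\<integral>\<^sup>+y. ennreal (8 / \<kappa>) * ennreal (norm (f (Complex x y)) / (norm s + (N + \<bar>y\<bar>))) \<partial>lborel)"
  proof (rule nn_integral_mono)
    fix y
    have "norm (f (Complex x y) * cnj (?k (Complex x y))) \<le> norm (f (Complex x y)) * (8 / \<kappa> * (1 / (norm s + (N + \<bar>y\<bar>))))"
      unfolding norm_mult complex_mod_cnj by (intro mult_left_mono szego_kernel_cone_bound \<kappa> s N x) auto
    also have "\<dots> = 8 / \<kappa> * (norm (f (Complex x y)) / (norm s + (N + \<bar>y\<bar>)))" by simp
    finally show "ennreal (norm (f (Complex x y) * cnj (?k (Complex x y)))) \<le> ennreal (8 / \<kappa>) * ennreal (norm (f (Complex x y)) / (norm s + (N + \<bar>y\<bar>)))"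
      using \<kappa> by (subst ennreal_mult'[symmetric]) (auto intro: ennreal_leI)
  qed
  also have "\<dots> = ennreal (8 / \<kappa>) * hilbert_operator N (\<lambda>y. norm (f (Complex x y))) (norm s)"
    unfolding hilbert_operator_def by (rule nn_integral_cmult) measurable
  finally have *: "ennreal (2 * pi * norm (f (of_real (2 * x) + s))) \<le> ennreal (8 / \<kappa>) * hilbert_operator N (\<lambda>y. norm (f (Complex x y))) (norm s)" .
  have "ennreal (4 * norm (f (of_real (2 * x) + s))) \<le> ennreal (2 * pi * norm (f (of_real (2 * x) + s)))"
    using pi_gt3 by (intro ennreal_leI mult_right_mono) auto
  then have "ennreal (1 / 4) * ennreal (4 * norm (f (of_real (2 * x) + s))) \<le> ennreal (1 / 4) * (ennreal (8 / \<kappa>) * hilbert_operator N (\<lambda>y. norm (f (Complex x y))) (norm s))"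
    by (intro mult_left_mono[OF order_trans[OF _ *]]) simp_all
  moreover have "ennreal (1 / 4) * ennreal (4 * norm (f (of_real (2 * x) + s))) = ennreal (norm (f (of_real (2 * x) + s)))"
    by (subst ennreal_mult'[symmetric]) auto
  moreover have "ennreal (1 / 4) * ennreal (8 / \<kappa>) = ennreal (2 / \<kappa>)"
    by (subst ennreal_mult'[symmetric]) auto
  ultimately show ?thesis by (simp add: mult.assoc[symmetric])
qed

lemma hardy2_line_nn_integral_le:
  assumes f: "f \<in> hardy2" and x: "x > 0"
  shows "(\<integral>\<^sup>+y. ennreal ((norm (f (Complex x y)))\<^sup>2) \<partial>lborel) \<le> ennreal (2 * pi * enn2real (h2_norm_sq f))"
proof -
  have "(\<integral>\<^sup>+y. ennreal ((norm (f (Complex x y)))\<^sup>2) \<partial>lborel) = ennreal (line_energy f x)"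
    unfolding line_energy_def using hardy2_line(1)[OF f x]
    by (intro nn_integral_eq_integral) (auto simp: sq_integrable_def)
  also have "\<dots> \<le> ennreal (2 * pi * enn2real (h2_norm_sq f))"
    by (rule ennreal_leI[OF hardy2_line(2)[OF f x]])
  finally show ?thesis .
qed

text \<open>
  The Cauchy formula over the line through \<open>x > 0\<close> bounds \<open>f (2x + s)\<close> on the cone by the Hilbert operator of
  \<open>\<bar>f (x + i y)\<bar>\<close>, uniformly in \<open>x\<close>. The values of \<open>f\<close> itself are reached by Fatou's lemma as \<open>x\<close> decreases to \<open>0\<close>.
\<close>

proposition hardy2_Carleson_embedding_cone:
  assumes sets: "sets \<mu> = sets (restrict_space borel rhp)" and sf: "sigma_finite_measure \<mu>"
    and \<kappa>: "0 < \<kappa>" "\<kappa> \<le> 1" and N: "N > 0" and A: "A \<in> sets \<mu>"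
    and cone: "\<And>s. s \<in> A \<Longrightarrow> Re s \<ge> \<kappa> * norm s \<and> norm s \<ge> N"
    and c: "c \<ge> 0" and test: "\<And>w. w \<ge> N \<Longrightarrow> (\<integral>\<^sup>+s\<in>A. ennreal (w / (norm (of_real w + s))\<^sup>2) \<partial>\<mu>) \<le> ennreal c"
    and f: "f \<in> hardy2"
  shows "(\<integral>\<^sup>+s\<in>A. ennreal ((norm (f s))\<^sup>2) \<partial>\<mu>) \<le> ennreal ((2 / \<kappa>)\<^sup>2 * (36 * c * (2 * pi\<^sup>2 * (2 * pi))) * enn2real (h2_norm_sq f))"
proof -
  note [measurable] = A
  have rhp: "s \<in> rhp" if "s \<in> A" for s
    using that sets.sets_into_space[OF A] space_measure_rhp[OF sets] by auto
  have norm_meas[measurable]: "(\<lambda>s. norm s) \<in> borel_measurable \<mu>"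
    by (rule measurable_compose[OF _ borel_measurable_norm])
      (use holomorphic_measurable_rhp[OF sets, of "\<lambda>s. s"] in \<open>auto intro: holomorphic_intros\<close>)
  define B where "B = ennreal ((2 / \<kappa>)\<^sup>2 * (36 * c * (2 * pi\<^sup>2 * (2 * pi))) * enn2real (h2_norm_sq f))"
  have shifted: "(\<integral>\<^sup>+s\<in>A. ennreal ((norm (f (of_real (2 * x) + s)))\<^sup>2) \<partial>\<mu>) \<le> B" if x: "x > 0" for x
  proof -
    let ?\<phi> = "\<lambda>y. norm (f (Complex x y))"
    have pm[measurable]: "?\<phi> \<in> borel_measurable borel"
      using holomorphic_line_measurable[OF hardy2_holomorphic[OF f] x] by measurable
    have "(\<integral>\<^sup>+s\<in>A. ennreal ((norm (f (of_real (2 * x) + s)))\<^sup>2) \<partial>\<mu>) \<le> (\<integral>\<^sup>+s. ennreal ((2 / \<kappa>)\<^sup>2) * ((hilbert_operator N ?\<phi> (norm s))\<^sup>2 * indicator A s) \<partial>\<mu>)"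
    proof (rule nn_integral_mono)
      fix s
      show "ennreal ((norm (f (of_real (2 * x) + s)))\<^sup>2) * indicator A s \<le> ennreal ((2 / \<kappa>)\<^sup>2) * ((hilbert_operator N ?\<phi> (norm s))\<^sup>2 * indicator A s)"
      proof (cases "s \<in> A")
        case True
        have "ennreal (norm (f (of_real (2 * x) + s))) ^ 2 \<le> (ennreal (2 / \<kappa>) * hilbert_operator N ?\<phi> (norm s)) ^ 2"
          using cone[OF True] by (intro power_mono hardy2_le_hilbert_operator f \<kappa> N x) auto
        then show ?thesis
          using True \<kappa> by (simp add: ennreal_power power_mult_distrib)
      qed simp
    qed
    also have "\<dots> = ennreal ((2 / \<kappa>)\<^sup>2) * (\<integral>\<^sup>+s\<in>A. (hilbert_operator N ?\<phi> (norm s))\<^sup>2 \<partial>\<mu>)"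
      by (rule nn_integral_cmult) measurable
    also have "\<dots> \<le> ennreal ((2 / \<kappa>)\<^sup>2) * (36 * ennreal c * (ennreal (2 * pi\<^sup>2) * (\<integral>\<^sup>+y. ennreal ((?\<phi> y)\<^sup>2) \<partial>lborel)))"
    proof (intro mult_left_mono hilbert_operator_Carleson[OF _ pm N sf norm_meas _ A])
      fix w :: real assume w: "w \<ge> N"
      have "(\<integral>\<^sup>+s\<in>A. ennreal (w / (w + norm s)\<^sup>2) \<partial>\<mu>) \<le> (\<integral>\<^sup>+s\<in>A. ennreal (w / (norm (of_real w + s))\<^sup>2) \<partial>\<mu>)"
      proof (rule nn_integral_mono)
        fix s
        show "ennreal (w / (w + norm s)\<^sup>2) * indicator A s \<le> ennreal (w / (norm (of_real w + s))\<^sup>2) * indicator A s"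
        proof (cases "s \<in> A")
          case True
          have "norm (of_real w + s) \<le> w + norm s"
            using norm_triangle_ineq[of "of_real w" s] w N by simp
          moreover have "norm (of_real w + s) > 0"
            using of_real_add_rhp_nonzero[OF rhp[OF True], of w] w N by simp
          ultimately have "w / (w + norm s)\<^sup>2 \<le> w / (norm (of_real w + s))\<^sup>2"
            using w N by (intro frac_le power_mono zero_less_power) auto
          then show ?thesis using True by (simp add: ennreal_leI)
        qed simp
      qed
      also have "\<dots> \<le> ennreal c" by (rule test[OF w])
      finally show "(\<integral>\<^sup>+s\<in>A. ennreal (w / (w + norm s)\<^sup>2) \<partial>\<mu>) \<le> ennreal c" .
    qed (use cone in auto)
    also have "\<dots> \<le> ennreal ((2 / \<kappa>)\<^sup>2) * (36 * ennreal c * (ennreal (2 * pi\<^sup>2) * ennreal (2 * pi * enn2real (h2_norm_sq f))))"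
      by (intro mult_left_mono hardy2_line_nn_integral_le f x) auto
    also have "\<dots> = B"
    proof -
      have "ennreal ((2 / \<kappa>)\<^sup>2 * (36 * c * (2 * pi\<^sup>2 * (2 * pi))) * enn2real (h2_norm_sq f))
        = ennreal ((2 / \<kappa>)\<^sup>2 * ((36 * c) * ((2 * pi\<^sup>2) * (2 * pi * enn2real (h2_norm_sq f)))))"
        by (rule arg_cong[of _ _ ennreal]) (simp only: mult_ac)
      also have "\<dots> = ennreal ((2 / \<kappa>)\<^sup>2) * (ennreal (36 * c) * (ennreal (2 * pi\<^sup>2) * ennreal (2 * pi * enn2real (h2_norm_sq f))))"
      proof -
        have e: "ennreal (a * (b * (u * v))) = ennreal a * (ennreal b * (ennreal u * ennreal v))"
          if "0 \<le> a" "0 \<le> b" "0 \<le> u" for a b u v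
          using that by (simp add: ennreal_mult')
        show ?thesis by (rule e) (use c in auto)
      qed
      also have "ennreal (36 * c) = 36 * ennreal c"
        by (subst ennreal_mult') auto
      finally show ?thesis by (simp add: B_def)
    qed
    finally show ?thesis .
  qed
  have holf: "f holomorphic_on rhp" by (rule hardy2_holomorphic[OF f])
  have shift_meas: "(\<lambda>s. f (of_real (2 * height n) + s)) \<in> borel_measurable \<mu>" for n
  proof (rule holomorphic_measurable_rhp[OF sets])
    have "(f \<circ> (\<lambda>s. of_real (2 * height n) + s)) holomorphic_on rhp"
    proof (rule holomorphic_on_compose_gen[OF _ holf])
      show "(\<lambda>s. of_real (2 * height n) + s) ` rhp \<subseteq> rhp"
        by (auto simp: rhp_def add_pos_pos)
    qed (intro holomorphic_intros)
    then show "(\<lambda>s. f (of_real (2 * height n) + s)) holomorphic_on rhp" by (simp add: comp_def)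
  qed
  have "(\<integral>\<^sup>+s\<in>A. ennreal ((norm (f s))\<^sup>2) \<partial>\<mu>)
      = (\<integral>\<^sup>+s. liminf (\<lambda>n. ennreal ((norm (f (of_real (2 * height n) + s)))\<^sup>2) * indicator A s) \<partial>\<mu>)"
  proof (rule nn_integral_cong)
    fix s
    show "ennreal ((norm (f s))\<^sup>2) * indicator A s = liminf (\<lambda>n. ennreal ((norm (f (of_real (2 * height n) + s)))\<^sup>2) * indicator A s)"
    proof (cases "s \<in> A")
      case True
      then have "Re s > 0" using rhp by (auto simp: rhp_def)
      then have "(\<lambda>n. ennreal ((norm (f (of_real (2 * height n) + s)))\<^sup>2)) \<longlonglongrightarrow> ennreal ((norm (f s))\<^sup>2)"
        by (intro tendsto_intros tendsto_ennrealI shifted_value_tendsto holf)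
      then have "liminf (\<lambda>n. ennreal ((norm (f (of_real (2 * height n) + s)))\<^sup>2)) = ennreal ((norm (f s))\<^sup>2)"
        by (intro lim_imp_Liminf) simp_all
      then show ?thesis using True by simp
    qed (simp add: Liminf_const)
  qed
  also have "\<dots> \<le> liminf (\<lambda>n. \<integral>\<^sup>+s\<in>A. ennreal ((norm (f (of_real (2 * height n) + s)))\<^sup>2) \<partial>\<mu>)"
    by (rule nn_integral_liminf) (use shift_meas in measurable)
  also have "\<dots> \<le> liminf (\<lambda>n::nat. B)"
    by (intro Liminf_mono always_eventually allI shifted height_pos)
  also have "\<dots> = B" by (simp add: Liminf_const)
  finally show ?thesis unfolding B_def .
qed

text \<open>
  Fubini's theorem is applied to \<open>\<mu>\<close> below, but the measures considered may be infinite on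
  compact sets. One finite test integral excludes this.
\<close>

lemma sigma_finite_measure_rhpI:
  assumes sets: "sets \<mu> = sets (restrict_space borel rhp)" and w: "w > 0"
    and fin: "(\<integral>\<^sup>+ s. ennreal (w / (norm (of_real w + s))\<^sup>2) \<partial>\<mu>) < \<infinity>"
  shows "sigma_finite_measure \<mu>"
proof -
  have sp: "space \<mu> = rhp" by (rule space_measure_rhp[OF sets])
  have idm[measurable]: "(\<lambda>s. s) \<in> borel_measurable \<mu>"
    by (rule holomorphic_measurable_rhp[OF sets]) (intro holomorphic_intros)
  define A where "A = (\<lambda>n::nat. {s \<in> space \<mu>. norm s \<le> real n})"
  have A: "A n \<in> sets \<mu>" for n unfolding A_def by measurable
  have "emeasure \<mu> (A n) \<noteq> \<infinity>" for n
  proof -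
    have "emeasure \<mu> (A n) = (\<integral>\<^sup>+ s. indicator (A n) s \<partial>\<mu>)" using A by simp
    also have "\<dots> \<le> (\<integral>\<^sup>+ s. ennreal ((w + real n)\<^sup>2 / w) * ennreal (w / (norm (of_real w + s))\<^sup>2) \<partial>\<mu>)"
    proof (rule nn_integral_mono)
      fix s assume "s \<in> space \<mu>"
      then have s: "s \<in> rhp" using sp by simp
      show "indicator (A n) s \<le> ennreal ((w + real n)\<^sup>2 / w) * ennreal (w / (norm (of_real w + s))\<^sup>2)"
      proof (cases "s \<in> A n")
        case True
        have pos: "norm (of_real w + s) > 0" using of_real_add_rhp_nonzero[OF s w] by simp
        have "norm (of_real w + s) \<le> w + real n"
          using norm_triangle_ineq[of "of_real w" s] w True by (simp add: A_def)
        then have "(norm (of_real w + s))\<^sup>2 \<le> (w + real n)\<^sup>2" by (intro power_mono) auto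
        then have "1 \<le> (w + real n)\<^sup>2 / w * (w / (norm (of_real w + s))\<^sup>2)"
          using pos w by simp
        then have "ennreal 1 \<le> ennreal ((w + real n)\<^sup>2 / w * (w / (norm (of_real w + s))\<^sup>2))" by (rule ennreal_leI)
        also have "\<dots> = ennreal ((w + real n)\<^sup>2 / w) * ennreal (w / (norm (of_real w + s))\<^sup>2)"
          using w by (intro ennreal_mult') auto
        finally show ?thesis using True by simp
      qed simp
    qed
    also have "\<dots> = ennreal ((w + real n)\<^sup>2 / w) * (\<integral>\<^sup>+ s. ennreal (w / (norm (of_real w + s))\<^sup>2) \<partial>\<mu>)"
      by (rule nn_integral_cmult) measurable
    also have "\<dots> < \<infinity>" using fin by (simp add: ennreal_mult_less_top)
    finally show ?thesis by simp
  qed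
  moreover have "(\<Union>n. A n) = space \<mu>"
    using real_arch_simple by (auto simp: A_def)
  ultimately show ?thesis
    using A by (intro sigma_finite_measure.intro exI[of _ "range A"]) auto
qed

section \<open>Carleson measures of the model space\<close>

lemma defect_sq_le: "0 \<le> t \<Longrightarrow> t \<le> 1 \<Longrightarrow> 1 - t\<^sup>2 \<le> 2 * (1 - (t::real))"
  using zero_le_power2[of "1 - t"] by (simp add: power2_diff)

text \<open>
  Here \<open>Re s\<close> is at least \<open>\<kappa> \<bar>s\<bar>\<close>, so the quotient is bounded near \<open>0\<close> because the defect is \<open>O(\<bar>s\<bar>)\<close>, and
  away from \<open>0\<close> because \<open>Re s\<close> is bounded below. The function on the right is bounded below on bounded sets.
\<close>

lemma cone_defect_bound_bounded_part:
  assumes inner: "inner_function \<theta>" and zero: "Some 0 \<notin> inner_spectrum \<theta>"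
    and \<kappa>: "0 < \<kappa>" and w: "w > 0" and R: "R > 0"
  shows "\<exists>D\<ge>0. \<forall>s. s \<noteq> 0 \<and> Re s \<ge> \<kappa> * norm s \<and> norm s \<le> R \<longrightarrow>
     (1 - (norm (\<theta> s))\<^sup>2) / (2 * Re s) \<le> D * (w / (norm (of_real w + s))\<^sup>2)"
proof -
  obtain \<delta> h where \<delta>: "\<delta> > 0" and h: "h > 0" and low: "\<forall>z\<in>rhp. norm z < 2 * h \<longrightarrow> norm (\<theta> z) \<ge> \<delta>"
    using zero_notin_spectrum_bounded_below[OF zero] by blast
  define C where "C = 16 / h * (1 + 1 / \<delta>)"
  define E where "E = C / \<kappa> + 2 / (\<kappa> * h)"
  have C0: "C \<ge> 0" using h \<delta> by (simp add: C_def)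
  have E0: "E \<ge> 0" using C0 h \<kappa> by (simp add: E_def)
  have "(1 - (norm (\<theta> s))\<^sup>2) / (2 * Re s) \<le> (E * ((w + R)\<^sup>2 / w)) * (w / (norm (of_real w + s))\<^sup>2)"
    if s: "s \<noteq> 0" "Re s \<ge> \<kappa> * norm s" "norm s \<le> R" for s
  proof -
    have ns: "norm s > 0" using s by simp
    have ks: "\<kappa> * norm s > 0" using ns \<kappa> by simp
    then have Res: "Re s > 0" using s(2) by linarith
    then have sr: "s \<in> rhp" by (simp add: rhp_def)
    have t1: "norm (\<theta> s) \<le> 1" by (rule inner_function_norm_le_1[OF inner sr])
    have E: "(1 - (norm (\<theta> s))\<^sup>2) / (2 * Re s) \<le> E"
    proof (cases "norm s \<le> h / 4")
      case True
      have "1 - (norm (\<theta> s))\<^sup>2 \<le> 2 * (1 - norm (\<theta> s))" by (rule defect_sq_le) (use t1 in auto)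
      also have "1 - norm (\<theta> s) \<le> C * norm s"
        unfolding C_def using low by (intro inner_function_defect_near_zero[OF inner h \<delta> _ sr True]) auto
      finally have "1 - (norm (\<theta> s))\<^sup>2 \<le> 2 * (C * norm s)" by simp
      then have "(1 - (norm (\<theta> s))\<^sup>2) / (2 * Re s) \<le> 2 * (C * norm s) / (2 * (\<kappa> * norm s))"
        using s(2) ks C0 by (intro frac_le) auto
      also have "\<dots> = C / \<kappa>" using ns \<kappa> by simp
      also have "\<dots> \<le> E" using h \<kappa> by (simp add: E_def)
      finally show ?thesis .
    next
      case False
      have "\<kappa> * (h / 4) \<le> Re s"
        using False s(2) \<kappa> mult_left_mono[of "h / 4" "norm s" \<kappa>] by linarith
      then have "(1 - (norm (\<theta> s))\<^sup>2) / (2 * Re s) \<le> 1 / (2 * (\<kappa> * (h / 4)))"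
        using \<kappa> h by (intro frac_le) auto
      also have "\<dots> = 2 / (\<kappa> * h)" by simp
      also have "\<dots> \<le> E" using C0 \<kappa> by (simp add: E_def)
      finally show ?thesis .
    qed
    have pos: "norm (of_real w + s) > 0" using of_real_add_rhp_nonzero[OF sr w] by simp
    have "norm (of_real w + s) \<le> w + R"
      using norm_triangle_ineq[of "of_real w" s] w s(3) by simp
    then have "(norm (of_real w + s))\<^sup>2 \<le> (w + R)\<^sup>2" by (intro power_mono) auto
    then have "1 \<le> (w + R)\<^sup>2 / (norm (of_real w + s))\<^sup>2" using pos by simp
    then have "E * 1 \<le> E * ((w + R)\<^sup>2 / (norm (of_real w + s))\<^sup>2)" using E0 by (rule mult_left_mono)
    also have "\<dots> = (E * ((w + R)\<^sup>2 / w)) * (w / (norm (of_real w + s))\<^sup>2)" using w by simp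
    finally show ?thesis using E by linarith
  qed
  moreover have "E * ((w + R)\<^sup>2 / w) \<ge> 0" using E0 w by simp
  ultimately show ?thesis by blast
qed

text \<open>
  The inverted function satisfies the estimate near \<open>0\<close>, so the defect of \<open>\<theta>\<close> is \<open>O(1 / \<bar>s\<bar>)\<close>, and
  the quotient is \<open>O(1 / \<bar>s\<bar>\<^sup>2)\<close>.
\<close>

lemma cone_defect_bound_near_infinity:
  assumes inner: "inner_function \<theta>" and inf: "None \<notin> inner_spectrum \<theta>"
    and \<kappa>: "0 < \<kappa>" and w: "w > 0"
  shows "\<exists>R>0. \<exists>D\<ge>0. \<forall>s. Re s \<ge> \<kappa> * norm s \<and> norm s \<ge> R \<longrightarrow>
     (1 - (norm (\<theta> s))\<^sup>2) / (2 * Re s) \<le> D * (w / (norm (of_real w + s))\<^sup>2)"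
proof -
  obtain \<delta> h where \<delta>: "\<delta> > 0" and h: "h > 0" and low: "\<forall>z\<in>rhp. norm z < 2 * h \<longrightarrow> norm (\<theta> (1 / z)) \<ge> \<delta>"
    using infinity_notin_spectrum_bounded_below[OF inf] by blast
  define C where "C = 16 / h * (1 + 1 / \<delta>)"
  define R where "R = 4 / h"
  have C0: "C \<ge> 0" using h \<delta> by (simp add: C_def)
  have R: "R > 0" using h by (simp add: R_def)
  have "(1 - (norm (\<theta> s))\<^sup>2) / (2 * Re s) \<le> (C / \<kappa> * ((w / R + 1)\<^sup>2 / w)) * (w / (norm (of_real w + s))\<^sup>2)"
    if s: "Re s \<ge> \<kappa> * norm s" "norm s \<ge> R" for s
  proof -
    have ns: "norm s > 0" using s R by linarith
    have ks: "\<kappa> * norm s > 0" using ns \<kappa> by simp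
    then have Res: "Re s > 0" using s(1) by linarith
    then have sr: "s \<in> rhp" by (simp add: rhp_def)
    have t1: "norm (\<theta> s) \<le> 1" by (rule inner_function_norm_le_1[OF inner sr])
    have ir: "1 / s \<in> rhp"
      using Res by (auto simp: rhp_def Re_divide intro!: divide_pos_pos add_pos_nonneg)
    have "norm (1 / s) \<le> h / 4"
      using s(2) ns h by (simp add: norm_divide R_def field_simps)
    then have "1 - norm (\<theta> (1 / (1 / s))) \<le> C * norm (1 / s)"
      unfolding C_def using low
      by (intro inner_function_defect_near_zero[OF inner_function_inversion[OF inner] h \<delta> _ ir]) auto
    then have d: "1 - norm (\<theta> s) \<le> C / norm s" by (simp add: norm_divide)
    have "1 - (norm (\<theta> s))\<^sup>2 \<le> 2 * (1 - norm (\<theta> s))" by (rule defect_sq_le) (use t1 in auto)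
    also have "\<dots> \<le> 2 * (C / norm s)" using d by simp
    finally have "(1 - (norm (\<theta> s))\<^sup>2) / (2 * Re s) \<le> 2 * (C / norm s) / (2 * (\<kappa> * norm s))"
      using s(1) ks C0 by (intro frac_le) auto
    also have "\<dots> = C / \<kappa> / (norm s)\<^sup>2" by (simp add: power2_eq_square)
    also have "\<dots> \<le> C / \<kappa> * ((w / R + 1)\<^sup>2 / (norm (of_real w + s))\<^sup>2)"
    proof -
      have pos: "norm (of_real w + s) > 0" using of_real_add_rhp_nonzero[OF sr w] by simp
      have "w \<le> w / R * norm s" using mult_left_mono[OF s(2), of "w / R"] w R by simp
      then have "norm (of_real w + s) \<le> (w / R + 1) * norm s"
        using norm_triangle_ineq[of "of_real w" s] w by (simp add: distrib_right)
      then have "(norm (of_real w + s))\<^sup>2 \<le> ((w / R + 1) * norm s)\<^sup>2" by (intro power_mono) auto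
      then have "1 / (norm s)\<^sup>2 \<le> (w / R + 1)\<^sup>2 / (norm (of_real w + s))\<^sup>2"
        using pos ns by (simp add: power_mult_distrib pos_le_divide_eq pos_divide_le_eq)
      then have "C / \<kappa> * (1 / (norm s)\<^sup>2) \<le> C / \<kappa> * ((w / R + 1)\<^sup>2 / (norm (of_real w + s))\<^sup>2)"
        using C0 \<kappa> by (intro mult_left_mono) auto
      then show ?thesis by simp
    qed
    also have "\<dots> = (C / \<kappa> * ((w / R + 1)\<^sup>2 / w)) * (w / (norm (of_real w + s))\<^sup>2)" using w by simp
    finally show ?thesis .
  qed
  moreover have "C / \<kappa> * ((w / R + 1)\<^sup>2 / w) \<ge> 0" using C0 \<kappa> w by simp
  ultimately show ?thesis using R by blast
qed

lemma h2_norm_sq_eq_enn2real: "f \<in> hardy2 \<Longrightarrow> h2_norm_sq f = ennreal (enn2real (h2_norm_sq f))"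
  by (simp add: hardy2_def)

text \<open>
  The embedding may be proved separately on a set \<open>A\<close>, where it holds for the whole Hardy space, and on its
  complement, where the pointwise bound for the model space is dominated by an integrable function.
\<close>

lemma carleson_measure_split:
  assumes inner: "inner_function \<theta>" and sets: "sets \<mu> = sets (restrict_space borel rhp)"
    and \<Gamma>: "AE s in \<mu>. s \<in> \<Gamma>" and A: "A \<in> sets \<mu>"
    and near: "\<And>s. s \<in> \<Gamma> \<Longrightarrow> s \<in> rhp \<Longrightarrow> s \<notin> A \<Longrightarrow> (1 - (norm (\<theta> s))\<^sup>2) / (2 * Re s) \<le> D * (w / (norm (of_real w + s))\<^sup>2)"
    and D: "D \<ge> 0" and w: "w > 0"
    and q: "(\<integral>\<^sup>+ s. ennreal (w / (norm (of_real w + s))\<^sup>2) \<partial>\<mu>) \<le> ennreal q" "q \<ge> 0"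
    and far: "\<And>f. f \<in> hardy2 \<Longrightarrow> (\<integral>\<^sup>+s\<in>A. ennreal ((norm (f s))\<^sup>2) \<partial>\<mu>) \<le> ennreal (K * enn2real (h2_norm_sq f))"
    and K: "K \<ge> 0"
  shows "carleson_measure (model_space \<theta>) \<mu>"
  unfolding carleson_measure_def
proof (intro exI[of _ "sqrt (K + D * q)"] ballI)
  fix f assume f: "f \<in> model_space \<theta>"
  then have fH: "f \<in> hardy2" by (simp add: model_space_def)
  define H where "H = enn2real (h2_norm_sq f)"
  have H0: "H \<ge> 0" by (simp add: H_def)
  note [measurable] = A
  have [measurable]: "f \<in> borel_measurable \<mu>"
    by (rule holomorphic_measurable_rhp[OF sets hardy2_holomorphic[OF fH]])
  have [measurable]: "(\<lambda>s. s) \<in> borel_measurable \<mu>"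
    by (rule holomorphic_measurable_rhp[OF sets]) (intro holomorphic_intros)
  have sp: "AE s in \<mu>. s \<in> rhp"
    using space_measure_rhp[OF sets] by (intro AE_I2) simp
  have "(\<integral>\<^sup>+ s. ennreal ((norm (f s))\<^sup>2) \<partial>\<mu>)
     \<le> (\<integral>\<^sup>+ s. ennreal ((norm (f s))\<^sup>2) * indicator A s + ennreal (D * H) * ennreal (w / (norm (of_real w + s))\<^sup>2) \<partial>\<mu>)"
  proof (rule nn_integral_mono_AE)
    show "AE s in \<mu>. ennreal ((norm (f s))\<^sup>2) \<le> ennreal ((norm (f s))\<^sup>2) * indicator A s + ennreal (D * H) * ennreal (w / (norm (of_real w + s))\<^sup>2)"
      using \<Gamma> sp
    proof eventually_elim
      case (elim s)
      show ?case
      proof (cases "s \<in> A")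
        case True
        then show ?thesis by (simp add: add_increasing2)
      next
        case False
        have "Re s > 0" using elim by (simp add: rhp_def)
        then have "(norm (f s))\<^sup>2 \<le> (1 - (norm (\<theta> s))\<^sup>2) / (2 * Re s) * H"
          unfolding H_def by (rule model_space_pointwise_bound[OF inner f])
        also have "\<dots> \<le> D * (w / (norm (of_real w + s))\<^sup>2) * H"
          by (rule mult_right_mono[OF near[OF elim False] H0])
        also have "\<dots> = (D * H) * (w / (norm (of_real w + s))\<^sup>2)" by simp
        finally have "ennreal ((norm (f s))\<^sup>2) \<le> ennreal ((D * H) * (w / (norm (of_real w + s))\<^sup>2))"
          by (rule ennreal_leI)
        also have "\<dots> = ennreal (D * H) * ennreal (w / (norm (of_real w + s))\<^sup>2)"
          using D H0 by (intro ennreal_mult') auto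
        finally show ?thesis using False by simp
      qed
    qed
  qed
  also have "\<dots> = (\<integral>\<^sup>+s\<in>A. ennreal ((norm (f s))\<^sup>2) \<partial>\<mu>) + (\<integral>\<^sup>+ s. ennreal (D * H) * ennreal (w / (norm (of_real w + s))\<^sup>2) \<partial>\<mu>)"
    by (rule nn_integral_add) measurable
  also have "(\<integral>\<^sup>+ s. ennreal (D * H) * ennreal (w / (norm (of_real w + s))\<^sup>2) \<partial>\<mu>) = ennreal (D * H) * (\<integral>\<^sup>+ s. ennreal (w / (norm (of_real w + s))\<^sup>2) \<partial>\<mu>)"
    by (rule nn_integral_cmult) measurable
  also have "(\<integral>\<^sup>+s\<in>A. ennreal ((norm (f s))\<^sup>2) \<partial>\<mu>) + ennreal (D * H) * (\<integral>\<^sup>+ s. ennreal (w / (norm (of_real w + s))\<^sup>2) \<partial>\<mu>)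
     \<le> ennreal (K * H) + ennreal (D * H) * ennreal q"
    unfolding H_def by (intro add_mono far fH mult_left_mono q(1)) auto
  also have "\<dots> = ennreal ((K + D * q) * H)"
    using K D H0 q(2) by (simp add: ennreal_mult'[symmetric] ennreal_plus[symmetric] algebra_simps del: ennreal_plus)
  also have "\<dots> = ennreal ((sqrt (K + D * q))\<^sup>2) * h2_norm_sq f"
    using K D q(2) by (subst h2_norm_sq_eq_enn2real[OF fH]) (simp add: H_def[symmetric] ennreal_mult')
  finally show "(\<integral>\<^sup>+ s. ennreal ((norm (f s))\<^sup>2) \<partial>\<mu>) \<le> ennreal ((sqrt (K + D * q))\<^sup>2) * h2_norm_sq f" .
qed

text \<open>
  In this degenerate case every function of the model space vanishes on the half-plane.
\<close>

lemma carleson_measure_of_unimodular: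
  assumes inner: "inner_function \<theta>" and sets: "sets \<mu> = sets (restrict_space borel rhp)"
    and uni: "\<And>s. s \<in> rhp \<Longrightarrow> norm (\<theta> s) = 1"
  shows "carleson_measure (model_space \<theta>) \<mu>"
  unfolding carleson_measure_def
proof (intro exI[of _ 0] ballI)
  fix f assume f: "f \<in> model_space \<theta>"
  have "(\<integral>\<^sup>+ s. ennreal ((norm (f s))\<^sup>2) \<partial>\<mu>) = (\<integral>\<^sup>+ s. 0 \<partial>\<mu>)"
  proof (rule nn_integral_cong)
    fix s assume "s \<in> space \<mu>"
    then have s: "s \<in> rhp" using space_measure_rhp[OF sets] by simp
    then have "(norm (f s))\<^sup>2 \<le> 0"
      using model_space_pointwise_bound[OF inner f, of s] uni[OF s] by (simp add: rhp_def)
    then show "ennreal ((norm (f s))\<^sup>2) = 0" by simp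
  qed
  then show "(\<integral>\<^sup>+ s. ennreal ((norm (f s))\<^sup>2) \<partial>\<mu>) \<le> ennreal (0\<^sup>2) * h2_norm_sq f" by simp
qed

theorem theorem3p9:
  fixes \<theta> :: "complex \<Rightarrow> complex" and \<mu> :: "complex measure" and \<alpha> \<beta> :: real
  assumes "inner_function \<theta>"
    and "regular_borel_measure_rhp \<mu>"
    and "- pi / 2 < \<alpha>" and "\<alpha> < \<beta>" and "\<beta> < pi / 2"
    and "emeasure \<mu> (rhp - sector \<alpha> \<beta>) = 0"
    and "Some 0 \<notin> inner_spectrum \<theta>"
    and "None \<notin> inner_spectrum \<theta> \<or>
         (\<exists>N>0. \<exists>\<eta><1. \<forall>z\<in>sector \<alpha> \<beta>. Re z \<ge> N \<longrightarrow> norm (\<theta> z) \<le> \<eta>)"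
  shows "carleson_measure (model_space \<theta>) \<mu> \<longleftrightarrow>
         (\<exists>c>0. \<forall>w>0.
            (\<integral>\<^sup>+ s. ennreal (w / (norm (of_real w + s))\<^sup>2) \<partial>\<mu>)
              \<le> ennreal c / ennreal (1 - norm (\<theta> (of_real w))))"
proof -
  note inner = assms(1) and zero = assms(7)
  have sets: "sets \<mu> = sets (restrict_space borel rhp)"
    using assms(2) by (simp add: regular_borel_measure_rhp_def)
  show ?thesis
  proof
    assume "carleson_measure (model_space \<theta>) \<mu>"
    then show "\<exists>c>0. \<forall>w>0. (\<integral>\<^sup>+ s. ennreal (w / (norm (of_real w + s))\<^sup>2) \<partial>\<mu>)
              \<le> ennreal c / ennreal (1 - norm (\<theta> (of_real w)))"
      by (rule carleson_measure_imp_kernel_test[OF inner sets])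
  next
    assume "\<exists>c>0. \<forall>w>0. (\<integral>\<^sup>+ s. ennreal (w / (norm (of_real w + s))\<^sup>2) \<partial>\<mu>)
              \<le> ennreal c / ennreal (1 - norm (\<theta> (of_real w)))"
    then obtain c where c: "c > 0" and test: "\<And>w. w > 0 \<Longrightarrow> (\<integral>\<^sup>+ s. ennreal (w / (norm (of_real w + s))\<^sup>2) \<partial>\<mu>)
              \<le> ennreal c / ennreal (1 - norm (\<theta> (of_real w)))"
      by blast
    have test': "(\<integral>\<^sup>+ s. ennreal (w / (norm (of_real w + s))\<^sup>2) \<partial>\<mu>) \<le> ennreal (c / e)"
      if "w > 0" "e > 0" "1 - norm (\<theta> (of_real w)) \<ge> e" for w e
    proof -
      have "(\<integral>\<^sup>+ s. ennreal (w / (norm (of_real w + s))\<^sup>2) \<partial>\<mu>) \<le> ennreal c / ennreal (1 - norm (\<theta> (of_real w)))"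
        by (rule test[OF that(1)])
      also have "\<dots> = ennreal (c / (1 - norm (\<theta> (of_real w))))"
        using that c by (subst divide_ennreal) auto
      also have "\<dots> \<le> ennreal (c / e)"
        using that c by (intro ennreal_leI divide_left_mono) auto
      finally show ?thesis .
    qed
    have hol: "\<theta> holomorphic_on rhp" by (rule inner_function_holomorphic[OF inner])
    have le1: "\<forall>z\<in>rhp. norm (\<theta> z) \<le> 1" using inner_function_norm_le_1[OF inner] by blast
    show "carleson_measure (model_space \<theta>) \<mu>"
    proof (cases "\<forall>s\<in>rhp. norm (\<theta> s) = 1")
      case True
      then show ?thesis by (intro carleson_measure_of_unimodular inner sets) auto
    next
      case False
      then obtain s0 where s0: "s0 \<in> rhp" "norm (\<theta> s0) < 1"
        using le1 by fastforce
      define w where "w = norm s0"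
      have s0': "s0 \<noteq> 0" "Re s0 > 0" using s0 by (auto simp: rhp_def)
      then have w: "w > 0" by (simp add: w_def)
      \<comment> \<open>Every point of the half-plane lies in some cone, so the modulus is below 1 at a point of the real axis as well.\<close>
      define k0 where "k0 = Re s0 / norm s0"
      have k0: "k0 > 0" "k0 * norm s0 \<le> Re s0" using s0' by (auto simp: k0_def)
      have "1 - norm (\<theta> s0) \<le> 3 / k0\<^sup>2 * (1 - norm (\<theta> (of_real w)))"
        unfolding w_def by (rule Harnack_inequality_sector[OF hol le1 k0 s0'(1)])
      then have "3 / k0\<^sup>2 * (1 - norm (\<theta> (of_real w))) > 0" using s0 by linarith
      then have e: "1 - norm (\<theta> (of_real w)) > 0"
        by (rule zero_less_mult_pos) (use k0 in simp)
      define q where "q = c / (1 - norm (\<theta> (of_real w)))"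
      have q: "(\<integral>\<^sup>+ s. ennreal (w / (norm (of_real w + s))\<^sup>2) \<partial>\<mu>) \<le> ennreal q" "q \<ge> 0"
        unfolding q_def using test'[OF w e] e c by auto
      have sf: "sigma_finite_measure \<mu>"
        by (rule sigma_finite_measure_rhpI[OF sets w]) (rule le_less_trans[OF q(1)], simp)
      obtain \<kappa> where \<kappa>: "0 < \<kappa>" "\<kappa> \<le> 1" and cone: "\<And>s. s \<in> sector \<alpha> \<beta> \<Longrightarrow> s \<noteq> 0 \<and> Re s \<ge> \<kappa> * norm s"
        using sector_cone[OF assms(3-5)] by blast
      have \<Gamma>s: "sector \<alpha> \<beta> \<in> sets \<mu>" by (rule sector_measurable[OF assms(3-5) sets])
      have \<Gamma>: "AE s in \<mu>. s \<in> sector \<alpha> \<beta>"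
      proof (rule AE_I)
        show "{s \<in> space \<mu>. s \<notin> sector \<alpha> \<beta>} \<subseteq> rhp - sector \<alpha> \<beta>"
          using space_measure_rhp[OF sets] by auto
        show "rhp - sector \<alpha> \<beta> \<in> sets \<mu>"
          using \<Gamma>s space_measure_rhp[OF sets] by (metis sets.compl_sets)
      qed (rule assms(6))
      consider (inf) "None \<notin> inner_spectrum \<theta>"
        | (away) N \<eta> where "N > 0" "\<eta> < 1" "\<And>z. z \<in> sector \<alpha> \<beta> \<Longrightarrow> Re z \<ge> N \<Longrightarrow> norm (\<theta> z) \<le> \<eta>"
        using assms(8) by blast
      then show ?thesis
      proof cases
        case inf
        obtain R D1 where R: "R > 0" and D1: "D1 \<ge> 0" and D1': "\<And>s. Re s \<ge> \<kappa> * norm s \<Longrightarrow> norm s \<ge> R \<Longrightarrow>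
             (1 - (norm (\<theta> s))\<^sup>2) / (2 * Re s) \<le> D1 * (w / (norm (of_real w + s))\<^sup>2)"
          using cone_defect_bound_near_infinity[OF inner inf \<kappa>(1) w] by blast
        obtain D2 where D2: "D2 \<ge> 0" and D2': "\<And>s. s \<noteq> 0 \<Longrightarrow> Re s \<ge> \<kappa> * norm s \<Longrightarrow> norm s \<le> R \<Longrightarrow>
             (1 - (norm (\<theta> s))\<^sup>2) / (2 * Re s) \<le> D2 * (w / (norm (of_real w + s))\<^sup>2)"
          using cone_defect_bound_bounded_part[OF inner zero \<kappa>(1) w R] by blast
        show ?thesis
        proof (rule carleson_measure_split[OF inner sets \<Gamma>, where A="{}" and D="max D1 D2" and K=0, OF _ _ _ w q])
          fix s assume "s \<in> sector \<alpha> \<beta>"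
          then have s: "s \<noteq> 0" "Re s \<ge> \<kappa> * norm s" using cone by auto
          have W: "w / (norm (of_real w + s))\<^sup>2 \<ge> 0" using w by simp
          show "(1 - (norm (\<theta> s))\<^sup>2) / (2 * Re s) \<le> max D1 D2 * (w / (norm (of_real w + s))\<^sup>2)"
          proof (cases "norm s \<ge> R")
            case True
            from D1'[OF s(2) True] mult_right_mono[OF max.cobounded1 W, of D1 D2] show ?thesis by linarith
          next
            case False
            from D2'[OF s] False mult_right_mono[OF max.cobounded2 W, of D2 D1] show ?thesis by linarith
          qed
        qed (use D1 in auto)
      next
        case away
        have cpos: "cos \<alpha> > 0" using assms(3-5) by (intro cos_gt_zero_pi) auto
        \<comment> \<open>The sector need not contain the real axis: the bound is taken on its lower edge and moved to the real axis. Points of the edge with modulus at least R have real part at least N.\<close>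
        define R where "R = N / cos \<alpha>"
        have R: "R > 0" using away(1) cpos by (simp add: R_def)
        obtain D where D: "D \<ge> 0" and D': "\<And>s. s \<noteq> 0 \<Longrightarrow> Re s \<ge> \<kappa> * norm s \<Longrightarrow> norm s \<le> R \<Longrightarrow>
             (1 - (norm (\<theta> s))\<^sup>2) / (2 * Re s) \<le> D * (w / (norm (of_real w + s))\<^sup>2)"
          using cone_defect_bound_bounded_part[OF inner zero \<kappa>(1) w R] by blast
        define e where "e = \<kappa>\<^sup>2 / 3 * (1 - \<eta>)"
        have e0: "e > 0" using \<kappa> away(2) by (simp add: e_def)
        have gap: "1 - norm (\<theta> (of_real v)) \<ge> e" if v: "v \<ge> R" for v
        proof -
          have v0: "v > 0" using v R by linarith
          define s where "s = of_real v * cis \<alpha>"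
          have s: "s \<in> sector \<alpha> \<beta>" using v0 assms(4) unfolding s_def sector_def by force
          have ns: "norm s = v" using v0 by (simp add: s_def norm_mult)
          have "Re s = v * cos \<alpha>" by (simp add: s_def)
          then have "Re s \<ge> N" using v cpos by (simp add: R_def pos_divide_le_eq)
          then have "norm (\<theta> s) \<le> \<eta>" by (rule away(3)[OF s])
          moreover have "1 - norm (\<theta> s) \<le> 3 / \<kappa>\<^sup>2 * (1 - norm (\<theta> (of_real (norm s))))"
            using cone[OF s] by (intro Harnack_inequality_sector[OF hol le1 \<kappa>(1)]) auto
          ultimately have "1 - \<eta> \<le> 3 / \<kappa>\<^sup>2 * (1 - norm (\<theta> (of_real v)))" unfolding ns by linarith
          then have "\<kappa>\<^sup>2 / 3 * (1 - \<eta>) \<le> \<kappa>\<^sup>2 / 3 * (3 / \<kappa>\<^sup>2 * (1 - norm (\<theta> (of_real v))))"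
            by (intro mult_left_mono) auto
          also have "\<dots> = 1 - norm (\<theta> (of_real v))" using \<kappa> by simp
          finally show ?thesis by (simp add: e_def)
        qed
        define A where "A = {s \<in> sector \<alpha> \<beta>. norm s \<ge> R}"
        have [measurable]: "(\<lambda>s. s) \<in> borel_measurable \<mu>"
          by (rule holomorphic_measurable_rhp[OF sets]) (intro holomorphic_intros)
        have "{s \<in> space \<mu>. norm s \<ge> R} \<in> sets \<mu>" by measurable
        then have "sector \<alpha> \<beta> \<inter> {s \<in> space \<mu>. norm s \<ge> R} \<in> sets \<mu>" using \<Gamma>s by blast
        moreover have "sector \<alpha> \<beta> \<inter> {s \<in> space \<mu>. norm s \<ge> R} = A"
          using sets.sets_into_space[OF \<Gamma>s] by (auto simp: A_def)
        ultimately have A: "A \<in> sets \<mu>" by simp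
        have testA: "(\<integral>\<^sup>+s\<in>A. ennreal (v / (norm (of_real v + s))\<^sup>2) \<partial>\<mu>) \<le> ennreal (c / e)" if v: "v \<ge> R" for v
        proof -
          have "(\<integral>\<^sup>+s\<in>A. ennreal (v / (norm (of_real v + s))\<^sup>2) \<partial>\<mu>) \<le> (\<integral>\<^sup>+s. ennreal (v / (norm (of_real v + s))\<^sup>2) \<partial>\<mu>)"
            by (intro nn_integral_mono) (auto simp: indicator_def)
          also have "\<dots> \<le> ennreal (c / e)"
            using v R by (intro test' e0 gap) auto
          finally show ?thesis .
        qed
        show ?thesis
        proof (rule carleson_measure_split[OF inner sets \<Gamma> A _ D w q])
          show "(\<integral>\<^sup>+s\<in>A. ennreal ((norm (f s))\<^sup>2) \<partial>\<mu>) \<le> ennreal ((2 / \<kappa>)\<^sup>2 * (36 * (c / e) * (2 * pi\<^sup>2 * (2 * pi))) * enn2real (h2_norm_sq f))"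
            if "f \<in> hardy2" for f
            using cone c e0 that by (intro hardy2_Carleson_embedding_cone[OF sets sf \<kappa> R A _ _ testA]) (auto simp: A_def)
          show "0 \<le> (2 / \<kappa>)\<^sup>2 * (36 * (c / e) * (2 * pi\<^sup>2 * (2 * pi)))" using c e0 by simp
          fix s assume "s \<in> sector \<alpha> \<beta>" "s \<notin> A"
          then show "(1 - (norm (\<theta> s))\<^sup>2) / (2 * Re s) \<le> D * (w / (norm (of_real w + s))\<^sup>2)"
            using cone[of s] by (intro D') (auto simp: A_def)
        qed
      qed
    qed
  qed
qed

end
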